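(* Fix an integer base $b\ge 2$. For every real $y$ with $0<y\le 1/2$, the numbers $\theta_{\Omega,y}$ and $\theta_{\omega,y}$ are normal in base $b$. For every real $y$ with $y>1/2$, the numbers $\theta_{\Omega,y}$ and $\theta_{\omega,y}$ are not normal in base $b$.
   Context: A function $f$ on the positive integers is additive if $f(mn)=f(m)+f(n)$ for all relatively prime $m,n$. $\Omega$ and $\omega$ are the additive functions with $\Omega(p^k)=k$ and $\omega(p^k)=1$ for all primes $p$ and integers $k\ge1$ (number of prime factors counted with, respectively without, multiplicity). A fixed integer base $b\ge 2$ is used throughout. Normality: a real number $z$ with fractional part $\{z\}=0.z_1z_2z_3\dots$ written in base $b$ is normal (in base $b$) if for every $k\ge 1$ and every string $a_1a_2\dots a_k$ of $k$ base $b$ digits, $$\lim_{x\to\infty}\frac{\#\{1\le n\le x-k : z_{n-1+i}=a_i,\ 1\le i\le k\}}{x}=b^{-k}.$$ Truncation: for real $z\ge 0$ and a positive integer $m$, $T_b(z,m)$ is the string of the last $m$ base $b$ digits of $\lfloor z\rfloor$, padded with zeros at the head if $\lfloor z\rfloor$ has fewer than $m$ digits, so that the string has length exactly $m$ (e.g. $T_{10}(151,2)=(51)$, $T_{10}(1,2)=(01)$, $T_{10}(0.5,2)=(00)$). For $y>0$ let $K_y(x)=\left\lceil y\,\dfrac{\log\log\log x}{\log b}\right\rceil$ if $x>e^e$, and $K_y(x)=1$ otherwise. For a non-negative additive function $f$ let $f_y(n)=T_b(f(n),K_y(n))$, a string of $K_y(n)$ digits, and let $$\theta_{f,y}=0.(f_y(1))(f_y(2))(f_y(3))(f_y(4))\dots$$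 be the real number whose base $b$ expansion after the point is the concatenation of the digit strings $f_y(1),f_y(2),f_y(3),\dots$ in order. *)

theory Defs
  imports "HOL-Analysis.Analysis" "HOL-Computational_Algebra.Primes"
begin

subsection \<open>Additive functions\<close>

text \<open>Arithmetic functions are total on \<open>nat\<close>; their value at \<open>0\<close> is never used.\<close>

definition additive_arith :: "(nat \<Rightarrow> real) \<Rightarrow> bool" where
  "additive_arith f \<longleftrightarrow>
     (\<forall>m n. 0 < m \<longrightarrow> 0 < n \<longrightarrow> coprime m n \<longrightarrow> f (m * n) = f m + f n)"

definition big_omega :: "nat \<Rightarrow> real" where
  "big_omega n = real (size (prime_factorization n))"

definition small_omega :: "nat \<Rightarrow> real" where
  "small_omega n = real (card (prime_factors n))"

lemma big_omega_additive: "additive_arith big_omega"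
  by (auto simp: additive_arith_def big_omega_def prime_factorization_mult)

lemma big_omega_prime_power: "prime p \<Longrightarrow> big_omega (p ^ k) = real k"
  by (simp add: big_omega_def prime_factorization_prime_power)

lemma small_omega_additive: "additive_arith small_omega"
proof -
  have "card (prime_factors (m * n)) = card (prime_factors m) + card (prime_factors n)"
    if "0 < m" "0 < n" "coprime m n" for m n :: nat
  proof -
    have "prime_factors m \<inter> prime_factors n = {}"
    proof (rule equals0I)
      fix p assume "p \<in> prime_factors m \<inter> prime_factors n"
      then have "p dvd m" "p dvd n" "prime p"
        by (auto simp: in_prime_factors_iff)
      with \<open>coprime m n\<close> show False
        using coprime_common_divisor not_prime_unit by blast
    qed
    with that show ?thesis
      by (simp add: prime_factorization_mult card_Un_disjoint)
  qed
  then show ?thesis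
    by (auto simp: additive_arith_def small_omega_def)
qed

lemma small_omega_prime_power: "prime p \<Longrightarrow> 1 \<le> k \<Longrightarrow> small_omega (p ^ k) = 1"
  by (simp add: small_omega_def prime_factorization_prime_power)

subsection \<open>Normal numbers\<close>

text \<open>
  The \<open>n\<close>-th digit after the point (\<open>n \<ge> 1\<close>). When a number has two expansions, this is
  the terminating one; neither of the two has all digit strings with the right frequency.
\<close>

definition base_digit :: "nat \<Rightarrow> real \<Rightarrow> nat \<Rightarrow> nat" where
  "base_digit b z n = nat \<lfloor>real b ^ n * frac z\<rfloor> mod b"

definition normal_in_base :: "nat \<Rightarrow> real \<Rightarrow> bool" where
  "normal_in_base b z \<longleftrightarrow>
     (\<forall>k \<ge> 1. \<forall>a :: nat list. length a = k \<longrightarrow> set a \<subseteq> {..<b} \<longrightarrow>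
       ((\<lambda>x :: real. real (card {n :: nat. 1 \<le> n \<and> real n \<le> x - real k \<and>
              (\<forall>i \<in> {1..k}. base_digit b z (n - 1 + i) = a ! (i - 1))}) / x)
          \<longlongrightarrow> 1 / real b ^ k) at_top)"

subsection \<open>Truncation and concatenation\<close>

text \<open>Most significant digit first: the \<open>i\<close>-th entry is the coefficient of \<open>b ^ (m - i)\<close>.\<close>

definition trunc_digits :: "nat \<Rightarrow> real \<Rightarrow> nat \<Rightarrow> nat list" where
  "trunc_digits b z m = map (\<lambda>i. (nat \<lfloor>z\<rfloor> div b ^ (m - i)) mod b) [1..<Suc m]"

lemma length_trunc_digits [simp]: "length (trunc_digits b z m) = m"
  by (simp add: trunc_digits_def)

lemma "trunc_digits 10 151 2 = [5, 1]" "trunc_digits 10 1 2 = [0, 1]"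
      "trunc_digits 10 (1/2) 2 = [0, 0]"
  by (simp_all add: trunc_digits_def upt_rec)

definition trunc_len :: "nat \<Rightarrow> real \<Rightarrow> real \<Rightarrow> nat" where
  "trunc_len b y x =
     (if x > exp (exp 1) then nat \<lceil>y * (ln (ln (ln x)) / ln (real b))\<rceil> else 1)"

lemma trunc_len_pos:
  assumes "b \<ge> 2" "y > 0"
  shows "trunc_len b y x \<ge> 1"
proof (cases "x > exp (exp 1)")
  case True
  then have "ln x > exp 1"
    by (metis exp_gt_zero less_trans ln_exp ln_less_cancel_iff)
  then have "ln (ln x) > 1"
    by (metis exp_gt_zero less_trans ln_exp ln_less_cancel_iff)
  then have "y * (ln (ln (ln x)) / ln (real b)) > 0"
    using assms by simp
  then have "\<lceil>y * (ln (ln (ln x)) / ln (real b))\<rceil> > 0"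
    by simp
  then have "nat \<lceil>y * (ln (ln (ln x)) / ln (real b))\<rceil> \<ge> 1"
    by linarith
  with True show ?thesis
    unfolding trunc_len_def by presburger
qed (simp add: trunc_len_def)

text \<open>
  The entry at (zero-based) position \<open>j\<close> of the infinite string \<open>s 1 @ s 2 @ s 3 @ \<dots>\<close>. When
  all \<open>s n\<close> are nonempty, its first \<open>j + 1\<close> blocks already contain position \<open>j\<close>.
\<close>

definition concat_nth :: "(nat \<Rightarrow> 'a list) \<Rightarrow> nat \<Rightarrow> 'a" where
  "concat_nth s j = concat (map s [1..<j + 2]) ! j"

lemma length_concat_blocks_ge:
  assumes "\<And>n. n \<ge> 1 \<Longrightarrow> s n \<noteq> []"
  shows "length (concat (map s [1..<Suc N])) \<ge> N"
proof (induction N)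
  case (Suc N)
  have "length (s (Suc N)) \<ge> 1"
    using assms[of "Suc N"] by (simp add: Suc_le_eq)
  with Suc show ?case by simp
qed simp

lemma concat_blocks_prefix:
  assumes "M \<le> N" "j < length (concat (map s [1..<Suc M]))"
  shows "concat (map s [1..<Suc N]) ! j = concat (map s [1..<Suc M]) ! j"
  using assms(1)
proof (induction N rule: dec_induct)
  case (step N)
  have "[1..<Suc N] = [1..<Suc M] @ [Suc M..<Suc N]"
    using step.hyps upt_add_eq_append[of 1 "Suc M" "N - M"] by simp
  then have "length (concat (map s [1..<Suc N])) \<ge> length (concat (map s [1..<Suc M]))"
    by simp
  with assms(2) have "j < length (concat (map s [1..<Suc N]))"
    by linarith
  with step.IH show ?case
    by (simp add: nth_append)
qed simp

lemma concat_nth_correct: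
  assumes "\<And>n. n \<ge> 1 \<Longrightarrow> s n \<noteq> []" "j < length (concat (map s [1..<Suc N]))"
  shows "concat (map s [1..<Suc N]) ! j = concat_nth s j"
proof (cases "N \<le> Suc j")
  case True
  from concat_blocks_prefix[OF this assms(2)] show ?thesis
    by (simp add: concat_nth_def)
next
  case False
  have "j < length (concat (map s [1..<Suc (Suc j)]))"
    using length_concat_blocks_ge[of s "Suc j"] assms(1) by (meson Suc_le_eq)
  from concat_blocks_prefix[OF _ this, of N] False show ?thesis
    by (simp add: concat_nth_def)
qed

definition theta :: "nat \<Rightarrow> (nat \<Rightarrow> real) \<Rightarrow> real \<Rightarrow> real" where
  "theta b f y =
     (\<Sum>j. real (concat_nth (\<lambda>n. trunc_digits b (f n) (trunc_len b y (real n))) j)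
             / real b ^ Suc j)"

end

theory Submission
  imports Defs "HOL-Computational_Algebra.Squarefree" "HOL-Real_Asymp.Real_Asymp"
begin

text \<open>
  Only two properties of \<open>f = \<Omega>\<close> or \<open>f = \<omega>\<close> are used: \<open>f 1 = 0\<close>, and \<open>f (p m) = f m + 1\<close> for
  primes \<open>p\<close> not dividing \<open>m\<close>.

  Normality for \<open>y \<le> 1/2\<close>. With the weights \<open>1/m\<close>, summing over \<open>n = p m\<close> and using Turan's variance
  bound for the number of primes \<open>p \<le> z\<close> dividing \<open>n\<close> shows that the law of \<open>f\<close> is almost invariant
  under the shift by \<open>1\<close>, with error \<open>O((log log x) powr -1/2)\<close> in total variation. Hence the mean
  of a nonnegative \<open>b ^ M\<close>-periodic function of \<open>f\<close> is close to its mean over a period as long as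
  \<open>b ^ M\<close> is small against \<open>sqrt (log log x)\<close>. Applied to the squared deviation of a digit count, which
  over a period is the variance for independent uniform digits, this gives a law of large numbers
  for the digits of \<open>f n\<close> in logarithmic density. It passes to natural density because that
  deviation is nonnegative: weighting \<open>n \<le> x\<close> with the sum of \<open>ln p\<close> over the primes \<open>p\<close> dividing \<open>n\<close> and
  using Chebyshev's bound loses only a constant factor. Only a bounded number of the top digits
  of each block is not covered.

  Failure for \<open>y > 1/2\<close>. By Turan's inequality \<open>f n\<close> lies within \<open>O(sqrt (log log x))\<close> of
  \<open>\<mu> x = (\<Sum>p\<le>x. 1/p)\<close> for a positive proportion of the squarefree \<open>n \<le> x\<close>. If \<open>\<mu> x\<close> is slightly above \<open>b ^ M\<close>,
  then these \<open>f n\<close> have zeros in nearly all positions between \<open>M/2\<close> and \<open>M\<close>, of which a positive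
  proportion is visible in the block. So long runs of zeros are too frequent.
\<close>

section \<open>Sums over primes\<close>

text \<open>Why 1/2 is the threshold: the values of \<open>f\<close> up to x have mean of order log
  log x and spread of order sqrt (log log x), while a block records \<open>f n\<close> modulo a
  number of order (log log x) powr y. For y < 1/2 this modulus is far below the spread and the
  residues even out; for y > 1/2 it is far above, and the top digits vary too little. At y = 1/2
  both have the same order and the shift error is not small. Giving up T top digits gains a factor b
  ^ T; T depends only on the tolerance, so nothing is lost in the limit, because the block lengths
  tend to infinity.

  Logarithmic weights are forced by the substitution n = p m: the weight 1/n splits into 1/p and
  1/m, and stopping m at x/p instead of x removes only a mass of 1 + ln p.

  Crude bounds for the sum of 1/p suffice throughout, since a constant factor in log log x changes a
  block length by a bounded number of digits. For y > 1/2 the points x are chosen through that sum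
  itself, so no asymptotic formula for it is needed.\<close>

lemma harm_le_ln: "n \<ge> 1 \<Longrightarrow> harm n \<le> 1 + ln (real n)"
proof -
  assume "n \<ge> 1"
  then obtain m where m: "n = Suc m" by (cases n) auto
  have "harm (Suc m) - ln (real (Suc m)) \<le> harm (Suc 0) - ln (real (Suc 0))"
    using decseqD[OF decseq_harm_diff_ln, of 0 m] by simp
  then show ?thesis by (simp add: m harm_expand)
qed

definition primes_upto :: "nat \<Rightarrow> nat set" where
  "primes_upto n = {p. prime p \<and> p \<le> n}"

lemma finite_primes_upto [simp]: "finite (primes_upto n)"
  unfolding primes_upto_def by (rule finite_subset[of _ "{..n}"]) auto

lemma primes_upto_less_2:
  assumes "n < 2"
  shows "primes_upto n = {}"
proof -
  have "\<not> prime p" if "p \<le> n" for p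
    using prime_ge_2_nat[of p] that assms by linarith
  then show ?thesis by (auto simp: primes_upto_def)
qed

lemma primes_upto_2: "primes_upto 2 = {2}"
  by (auto simp: primes_upto_def dest: prime_ge_2_nat intro: antisym)

definition prime_recip_sum :: "nat \<Rightarrow> real" where
  "prime_recip_sum n = (\<Sum>p\<in>primes_upto n. 1 / real p)"

text \<open>Telescoping from k = 3 on leaves 1/4 + 1/2. A bound below 1 matters in
  \<open>card_squarefree_concentrated\<close>, where it leaves at least a quarter of the integers
  squarefree.\<close>

lemma sum_recip_squares_le:
  assumes "finite A" "A \<subseteq> {2..}"
  shows "(\<Sum>k\<in>A. 1 / (real k)\<^sup>2) \<le> 3 / 4"
proof -
  have bound: "(\<Sum>k=2..n. 1 / (real k)\<^sup>2) \<le> 3 / 4 - 1 / real n" if "n \<ge> 2" for n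
    using that
  proof (induction n rule: dec_induct)
    case (step n)
    have "1 / (real (Suc n))\<^sup>2 \<le> 1 / real n - 1 / real (Suc n)"
      using step.hyps by (simp add: divide_simps power2_eq_square)
    with step show ?case by simp
  qed simp
  \<comment> \<open>Inserting 2 covers the empty set and gives N \<ge> 2.\<close>
  define N where "N = Max (insert 2 A)"
  have N: "N \<ge> 2" "A \<subseteq> {2..N}"
    using assms by (auto simp: N_def)
  have "(\<Sum>k\<in>A. 1 / (real k)\<^sup>2) \<le> (\<Sum>k=2..N. 1 / (real k)\<^sup>2)"
    using N by (intro sum_mono2) auto
  also have "\<dots> \<le> 3 / 4" using bound[OF N(1)]
    by (smt (verit) divide_nonneg_nonneg of_nat_0_le_iff)
  finally show ?thesis .
qed

text \<open>
  Multiples of \<open>p\<close> among the smooth numbers contribute at most \<open>1/p\<close> times the whole sum, which gives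
  the factor \<open>1/(1 - 1/p)\<close> of the Euler product without infinite sums.
\<close>

lemma smooth_harmonic_le:
  assumes "finite P" "\<And>p. p \<in> P \<Longrightarrow> prime p"
  shows "(\<Sum>m | m \<in> {1..x} \<and> prime_factors m \<subseteq> P. 1 / real m) \<le> exp (2 * (\<Sum>p\<in>P. 1 / real p))"
  using assms
proof (induction P rule: finite_induct)
  case empty
  have "{m. m \<in> {1..x} \<and> prime_factors m \<subseteq> {}} \<subseteq> {1}"
    by (auto simp: prime_factorization_empty_iff)
  then have "(\<Sum>m | m \<in> {1..x} \<and> prime_factors m \<subseteq> {}. 1 / real m) \<le> (\<Sum>m\<in>{1}. 1 / real m)"
    by (intro sum_mono2) auto
  then show ?case by simp
next
  case (insert p P)
  define S where "S Q = {m. m \<in> {1..x} \<and> prime_factors m \<subseteq> Q}" for Q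
  define H where "H Q = (\<Sum>m\<in>S Q. 1 / real m)" for Q
  have fin: "finite (S Q)" for Q by (simp add: S_def)
  have p: "prime p" using insert by auto
  then have p2: "p \<ge> 2" by (rule prime_ge_2_nat)
  have sub: "S (insert p P) \<subseteq> S P \<union> (\<lambda>m. p * m) ` S (insert p P)"
  proof
    fix m assume m: "m \<in> S (insert p P)"
    show "m \<in> S P \<union> (\<lambda>m. p * m) ` S (insert p P)"
    proof (cases "p dvd m")
      case True
      then obtain k where k: "m = p * k" by auto
      have k0: "k > 0" "k \<le> m" using m k p2 by (auto simp: S_def)
      then have "k \<le> x" using m by (simp add: S_def)
      with k0 have "k \<in> S (insert p P)" using m dvd_prime_factors[of m k]
        by (auto simp: S_def k)
      then show ?thesis using k by auto
    next
      case False
      then have "p \<notin> prime_factors m" by auto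
      then show ?thesis using m by (auto simp: S_def)
    qed
  qed
  have "H (insert p P) \<le> (\<Sum>m\<in>S P \<union> (\<lambda>m. p * m) ` S (insert p P). 1 / real m)"
    unfolding H_def using sub fin by (intro sum_mono2) auto
  also have "\<dots> \<le> H P + (\<Sum>m\<in>(\<lambda>m. p * m) ` S (insert p P). 1 / real m)"
    unfolding H_def using fin by (subst sum_Un) (auto intro!: sum_nonneg)
  also have "(\<Sum>m\<in>(\<lambda>m. p * m) ` S (insert p P). 1 / real m) = (1 / real p) * H (insert p P)"
    unfolding H_def using p2 by (subst sum.reindex) (auto simp: inj_on_def sum_distrib_left)
  finally have rec: "H (insert p P) * (1 - 1 / real p) \<le> H P" by (simp add: algebra_simps)
  have half: "1 / real p \<le> 1 / 2" using p2 by simp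
  \<comment> \<open>The 2 in the exponent is the price for small primes: for t = 1/p \<le> 1/2, ln
    (1 - t) is at least -t - 2t^2, which is at least -2t.\<close>
  have "exp (- (2 * (1 / real p))) \<le> 1 - 1 / real p"
  proof -
    have "(1 / real p)\<^sup>2 \<le> 1 / 2 * (1 / real p)"
      unfolding power2_eq_square using half by (intro mult_right_mono) auto
    then have "- (2 * (1 / real p)) \<le> - (1 / real p) - 2 * (1 / real p)\<^sup>2" by simp
    also have "\<dots> \<le> ln (1 - 1 / real p)"
      using half by (intro ln_one_minus_pos_lower_bound) auto
    finally have "exp (- (2 * (1 / real p))) \<le> exp (ln (1 - 1 / real p))" by simp
    then show ?thesis using half by simp
  qed
  then have "H (insert p P) * exp (- (2 * (1 / real p))) \<le> H (insert p P) * (1 - 1 / real p)"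
    by (intro mult_left_mono) (auto simp: H_def intro!: sum_nonneg)
  also have "\<dots> \<le> H P" by (rule rec)
  also have "\<dots> \<le> exp (2 * (\<Sum>p\<in>P. 1 / real p))"
    using insert unfolding H_def S_def by auto
  finally have "H (insert p P) \<le> exp (2 * (\<Sum>p\<in>P. 1 / real p)) * exp (2 * (1 / real p))"
    by (simp add: exp_minus field_simps)
  also have "\<dots> = exp (2 * (\<Sum>p\<in>insert p P. 1 / real p))"
    using insert by (simp add: exp_add[symmetric] algebra_simps)
  finally show ?case unfolding H_def S_def .
qed

text \<open>Euler's argument: every m up to n has only prime factors up to n, so
  \<open>smooth_harmonic_le\<close> bounds the full harmonic sum. The 1/2 reflects the 2 in that
  exponent.\<close>

lemma prime_recip_sum_ge:
  assumes "n \<ge> 2"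
  shows "prime_recip_sum n \<ge> ln (ln (real n)) / 2"
proof -
  have eq: "{m. m \<in> {1..n} \<and> prime_factors m \<subseteq> primes_upto n} = {1..n}"
    by (auto simp: primes_upto_def in_prime_factors_iff dest!: dvd_imp_le)
  have "ln (real n) \<le> ln (real n + 1)" using assms by simp
  also have "\<dots> \<le> harm n" by (rule ln_le_harm)
  also have "harm n \<le> exp (2 * prime_recip_sum n)"
  proof -
    have "prime p" if "p \<in> primes_upto n" for p using that by (simp add: primes_upto_def)
    then have "(\<Sum>m | m \<in> {1..n} \<and> prime_factors m \<subseteq> primes_upto n. 1 / real m)
        \<le> exp (2 * (\<Sum>p\<in>primes_upto n. 1 / real p))"
      by (intro smooth_harmonic_le) auto
    then show ?thesis
      unfolding eq by (simp add: prime_recip_sum_def harm_def inverse_eq_divide)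
  qed
  finally have le: "ln (real n) \<le> exp (2 * prime_recip_sum n)" .
  have "0 < ln (real n)" using assms by (intro ln_gt_zero) linarith
  from ln_mono[OF le this] show ?thesis by simp
qed

section \<open>Chebyshev's upper bound\<close>

lemma prod_primes_dvd:
  fixes n :: nat
  assumes "finite A" "\<And>p. p \<in> A \<Longrightarrow> prime p" "\<And>p. p \<in> A \<Longrightarrow> p dvd n"
  shows "\<Prod>A dvd n"
  using assms
proof (induction A rule: finite_induct)
  case (insert p A)
  have "coprime p (\<Prod>A)"
  proof (rule prod_coprime_right)
    fix q assume "q \<in> A"
    then show "coprime p q" using insert by (intro primes_coprime) auto
  qed
  with insert show ?case by (auto intro: divides_mult)
qed simp

text \<open>Erdos's induction. For n = 2m + 1 the primes in (m + 1, 2m + 1] divide the binomial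
  coefficient (2m + 1 choose m), which occurs twice in a row of sum 2 * 4^m and hence is at most
  4^m. An even n > 2 adds no prime.\<close>

lemma primorial_le: "(\<Prod>p\<in>primes_upto n. p) \<le> 4 ^ n"
proof (induction n rule: less_induct)
  case (less n)
  consider "n \<le> 2" | "n > 2" "even n" | m where "n = 2 * m + 1" "m \<ge> 1"
  proof -
    show ?thesis if h: "n \<le> 2 \<Longrightarrow> thesis" "2 < n \<Longrightarrow> even n \<Longrightarrow> thesis"
      "\<And>m. n = 2 * m + 1 \<Longrightarrow> 1 \<le> m \<Longrightarrow> thesis"
      by (metis h One_nat_def add_0 less_one mult_0_right not_le oddE one_le_numeral order_trans)
  qed
  then show ?case
  proof cases
    case 1
    show ?thesis
    proof (cases "n = 2")
      case False
      with 1 have "primes_upto n = {}" by (intro primes_upto_less_2) simp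
      then show ?thesis by simp
    qed (simp add: primes_upto_2)
  next
    case 2
    then have "\<not> prime n" using primes_dvd_imp_eq[of 2 n] by auto
    then have "p \<le> n - 1" if "prime p" "p \<le> n" for p
      using that by (cases "p = n") auto
    then have "primes_upto n = primes_upto (n - 1)"
      unfolding primes_upto_def by auto
    then have "(\<Prod>p\<in>primes_upto n. p) \<le> 4 ^ (n - 1)" using less[of "n - 1"] 2 by simp
    also have "(4::nat) ^ (n - 1) \<le> 4 ^ n" by (intro power_increasing) auto
    finally show ?thesis .
  next
    case (3 m)
    define Q where "Q = {p. prime p \<and> m + 1 < p \<and> p \<le> 2 * m + 1}"
    have finQ: "finite Q" unfolding Q_def by (rule finite_subset[of _ "{..2*m+1}"]) auto
    have split: "primes_upto n = primes_upto (m + 1) \<union> Q" "primes_upto (m + 1) \<inter> Q = {}"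
      using 3 by (auto simp: primes_upto_def Q_def)
    have "(\<Prod>p\<in>Q. p) dvd (2 * m + 1 choose m)"
    proof (rule prod_primes_dvd)
      show "prime a" if "a \<in> Q" for a using that by (auto simp: Q_def)
      show "a dvd (2 * m + 1 choose m)" if "a \<in> Q" for a
      proof -
        have a: "prime a" "m + 1 < a" "a \<le> 2 * m + 1" using that by (auto simp: Q_def)
        have "2 * m + 1 - m = m + 1" "m \<le> 2 * m + 1" by linarith+
        then have *: "fact m * fact (m + 1) * (2 * m + 1 choose m) = (fact (2 * m + 1) :: nat)"
          using binomial_fact_lemma[of m "2 * m + 1"] by (simp only:)
        have "a dvd fact (2 * m + 1)" using a by (simp only: prime_dvd_fact_iff)
        then have "a dvd fact m * fact (m + 1) * (2 * m + 1 choose m)" unfolding * .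
        moreover have "\<not> a dvd fact m" "\<not> a dvd fact (m + 1)"
          unfolding prime_dvd_fact_iff[OF a(1)] using a by linarith+
        ultimately show ?thesis unfolding prime_dvd_mult_iff[OF a(1)] by blast
      qed
    qed (rule finQ)
    then have "(\<Prod>p\<in>Q. p) \<le> (2 * m + 1 choose m)" by (rule dvd_imp_le) simp
    also have "(2 * m + 1 choose m) \<le> 4 ^ m"
    proof -
      have "2 * m + 1 - m = m + 1" "m \<le> 2 * m + 1" by linarith+
      then have "(2 * m + 1 choose (m + 1)) = (2 * m + 1 choose m)"
        using binomial_symmetric[of m "2 * m + 1"] by (simp only:)
      then have "2 * (2 * m + 1 choose m) = (\<Sum>k\<in>{m, m + 1}. (2 * m + 1 choose k))"
        by (simp del: binomial_Suc_Suc)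
      also have "\<dots> \<le> (\<Sum>k\<le>2 * m + 1. (2 * m + 1 choose k))" by (intro sum_mono2) auto
      also have "\<dots> = 2 ^ (2 * m + 1)" by (rule choose_row_sum)
      also have "\<dots> = 2 * (2 ^ 2) ^ m" unfolding power_mult[symmetric] by simp
      finally show ?thesis by simp
    qed
    finally have "(\<Prod>p\<in>Q. p) \<le> 4 ^ m" .
    then have "(\<Prod>p\<in>primes_upto n. p) \<le> 4 ^ (m + 1) * 4 ^ m"
      unfolding split(1) using less.IH[of "m + 1"] 3 finQ split(2)
      by (subst prod.union_disjoint) (auto intro!: mult_mono simp del: power_Suc)
    also have "\<dots> = 4 ^ n" using 3 by (simp add: power_add[symmetric])
    finally show ?thesis .
  qed
qed

definition chebyshev_theta :: "nat \<Rightarrow> real" where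
  "chebyshev_theta n = (\<Sum>p\<in>primes_upto n. ln (real p))"

lemma chebyshev_theta_le: "chebyshev_theta n \<le> 2 * real n"
proof -
  have pos: "real p > 0" if "p \<in> primes_upto n" for p
    using that by (auto simp: primes_upto_def prime_gt_0_nat)
  have "chebyshev_theta n = ln (real (\<Prod>p\<in>primes_upto n. p))"
    unfolding chebyshev_theta_def of_nat_prod using pos by (subst ln_prod) force+
  also have "\<dots> \<le> ln (real (4 ^ n))"
  proof (subst ln_le_cancel_iff)
    show "0 < real (\<Prod>p\<in>primes_upto n. p)"
      unfolding of_nat_prod using pos by (intro prod_pos) auto
    show "real (\<Prod>p\<in>primes_upto n. p) \<le> real (4 ^ n)"
      using primorial_le by (simp only: of_nat_le_iff)
  qed auto
  also have "\<dots> = real n * (2 * ln 2)"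
  proof -
    have "ln (4::real) = ln (2 ^ 2)" by simp
    also have "\<dots> = 2 * ln 2" by (subst ln_realpow) auto
    finally show ?thesis by (simp add: ln_realpow)
  qed
  also have "\<dots> \<le> real n * 2" using ln_2_less_1 by (intro mult_left_mono) auto
  finally show ?thesis by simp
qed

section \<open>Upper bound for the sum of 1/p\<close>

lemma prime_recip_sum_mono: "m \<le> n \<Longrightarrow> prime_recip_sum m \<le> prime_recip_sum n"
  unfolding prime_recip_sum_def by (intro sum_mono2) (auto simp: primes_upto_def)

text \<open>Dyadic blocks replace partial summation: for p in (2^m, 2^(m+1)], 1/p is at most ln p /
  (2^m * m ln 2), so Chebyshev's bound gives 4 / (m ln 2) \<le> 6/m \<le> 12/(m+1) for the block.
  Summing over m produces \<open>harm\<close>, that is, a double logarithm.\<close>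

lemma prime_recip_sum_pow2_le:
  assumes "m \<ge> 1"
  shows "prime_recip_sum (2 ^ m) \<le> 1 / 2 + 12 * harm m"
  using assms
proof (induction m rule: dec_induct)
  case base
  show ?case by (simp add: prime_recip_sum_def harm_expand primes_upto_2)
next
  case (step m)
  define Q where "Q = primes_upto (2 ^ Suc m) - primes_upto (2 ^ m)"
  have split: "primes_upto (2 ^ Suc m) = primes_upto (2 ^ m) \<union> Q"
    by (auto simp: Q_def primes_upto_def)
  have "(\<Sum>p\<in>Q. 1 / real p) \<le> (\<Sum>p\<in>Q. ln (real p) / (2 ^ m * (real m * ln 2)))"
  proof (rule sum_mono)
    fix p assume "p \<in> Q"
    then have p: "p > 2 ^ m" by (auto simp: Q_def primes_upto_def)
    then have p': "real p > 2 ^ m" by (metis of_nat_less_iff of_nat_numeral of_nat_power)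
    have "real m * ln 2 = ln (2 ^ m)" by (simp add: ln_realpow)
    also have "\<dots> \<le> ln (real p)" using p' by (subst ln_le_cancel_iff) auto
    finally have "2 ^ m * (real m * ln 2) \<le> real p * ln (real p)"
      using p' step.hyps by (intro mult_mono) auto
    then show "1 / real p \<le> ln (real p) / (2 ^ m * (real m * ln 2))"
      using p' step.hyps by (simp add: divide_simps mult_ac split: if_splits)
  qed
  also have "\<dots> = (\<Sum>p\<in>Q. ln (real p)) / (2 ^ m * (real m * ln 2))"
    by (simp add: sum_divide_distrib)
  also have "(\<Sum>p\<in>Q. ln (real p)) \<le> chebyshev_theta (2 ^ Suc m)"
    unfolding chebyshev_theta_def
    by (intro sum_mono2) (auto simp: Q_def primes_upto_def dest: prime_ge_1_nat)
  also have "\<dots> \<le> 2 * real (2 ^ Suc m)" by (rule chebyshev_theta_le)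
  finally have "(\<Sum>p\<in>Q. 1 / real p) \<le> 2 * real (2 ^ Suc m) / (2 ^ m * (real m * ln 2))"
    using step.hyps by (simp add: divide_right_mono)
  also have "\<dots> = 4 / (real m * ln 2)" by simp
  also have "\<dots> \<le> 4 / (real m * (2 / 3))"
    using ln2_ge_two_thirds step.hyps by (intro divide_left_mono mult_left_mono) auto
  also have "\<dots> = 6 / real m" by simp
  also have "6 / real m \<le> 12 * inverse (real (Suc m))"
    using step.hyps by (simp add: divide_simps)
  finally have Q': "(\<Sum>p\<in>Q. 1 / real p) \<le> 12 * inverse (real (Suc m))" .
  have "prime_recip_sum (2 ^ Suc m) = prime_recip_sum (2 ^ m) + (\<Sum>p\<in>Q. 1 / real p)"
    unfolding prime_recip_sum_def split by (subst sum.union_disjoint) (auto simp: Q_def)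
  with step Q' show ?case by (simp add: harm_Suc algebra_simps)
qed

lemma prime_recip_sum_le:
  assumes "n \<ge> 2"
  shows "prime_recip_sum n \<le> 13 + 12 * ln (ln (real n) / ln 2 + 1)"
proof -
  define m where "m = nat \<lceil>log 2 (real n)\<rceil>"
  have "log 2 (real n) \<ge> 1" using assms by (simp add: le_log_iff)
  then have m: "m \<ge> 1" "real m \<le> log 2 (real n) + 1" "log 2 (real n) \<le> real m"
    unfolding m_def by linarith+
  have "real n = 2 powr (log 2 (real n))" using assms by simp
  also have "\<dots> \<le> 2 powr (real m)" using m by (intro powr_mono) auto
  finally have "real n \<le> real (2 ^ m)" by (simp add: powr_realpow)
  then have "n \<le> 2 ^ m" by (simp only: of_nat_le_iff)
  then have "prime_recip_sum n \<le> prime_recip_sum (2 ^ m)" by (rule prime_recip_sum_mono)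
  also have "\<dots> \<le> 1 / 2 + 12 * harm m" by (rule prime_recip_sum_pow2_le[OF m(1)])
  also have "harm m \<le> 1 + ln (real m)" by (rule harm_le_ln[OF m(1)])
  also have "ln (real m) \<le> ln (log 2 (real n) + 1)" using m by simp
  finally show ?thesis by (simp add: log_def)
qed

section \<open>Almost invariance under shifts in logarithmic density\<close>

lemma sum_multiples:
  fixes \<phi> :: "nat \<Rightarrow> real"
  assumes "d > 0"
  shows "(\<Sum>m=1..x. if d dvd m then \<phi> m else 0) = (\<Sum>k=1..x div d. \<phi> (d * k))"
proof -
  have "{m \<in> {1..x}. d dvd m} = (\<lambda>k. d * k) ` {1..x div d}"
  proof (intro equalityI subsetI)
    fix m assume "m \<in> {m \<in> {1..x}. d dvd m}"
    then obtain k where k: "m = d * k" "1 \<le> m" "m \<le> x" by auto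
    then have "k \<in> {1..x div d}"
      using assms by (auto simp: less_eq_div_iff_mult_less_eq mult.commute Suc_le_eq)
    then show "m \<in> (\<lambda>k. d * k) ` {1..x div d}" using k by auto
  next
    fix m assume "m \<in> (\<lambda>k. d * k) ` {1..x div d}"
    then show "m \<in> {m \<in> {1..x}. d dvd m}"
      using assms by (auto simp: less_eq_div_iff_mult_less_eq mult.commute Suc_le_eq)
  qed
  moreover have "(\<Sum>m=1..x. if d dvd m then \<phi> m else 0) = (\<Sum>m\<in>{m \<in> {1..x}. d dvd m}. \<phi> m)"
    by (subst sum.inter_filter) auto
  ultimately show ?thesis
    using assms by (simp add: sum.reindex inj_on_def)
qed

text \<open>The loss does not grow with x, so it is negligible against \<open>harm x\<close>; under
  counting weights, a passage from x to x/p would keep only about one p-th of the integers.\<close>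

lemma harm_diff_div_le:
  assumes "p > 0" "x > 0"
  shows "harm x - harm (x div p) \<le> 1 + ln (real p)"
proof -
  have "real x / real p \<le> real (x div p) + 1"
  proof -
    have "x = p * (x div p) + x mod p" by simp
    then have "x \<le> p * (x div p) + p"
      using mod_less_divisor[OF assms(1), of x] by linarith
    then have "real x \<le> real (p * (x div p) + p)" by (simp only: of_nat_le_iff)
    then show ?thesis using assms by (simp add: divide_simps algebra_simps)
  qed
  then have "ln (real x / real p) \<le> ln (real (x div p) + 1)"
    using assms by (intro ln_mono) auto
  also have "\<dots> \<le> harm (x div p)" by (rule ln_le_harm)
  finally have "ln (real x) - ln (real p) \<le> harm (x div p)"
    using assms by (simp add: ln_div)
  with harm_le_ln[of x] assms show ?thesis by simp
qed

locale prime_step =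
  fixes f :: "nat \<Rightarrow> nat"
  assumes f_1: "f 1 = 0"
    and f_prime_mult: "prime p \<Longrightarrow> m > 0 \<Longrightarrow> \<not> p dvd m \<Longrightarrow> f (p * m) = Suc (f m)"
begin

text \<open>Two errors occur. Where p divides k, nothing is known about \<open>f (p * k)\<close>,
  but these k have mass at most \<open>harm x / p\<close>. The k beyond \<open>x div p\<close> are
  missing on the left and have mass at most 1 + ln p.\<close>

lemma sum_shift_multiples:
  fixes G :: "nat \<Rightarrow> real"
  assumes p: "prime p" and x: "x > 0" and G: "\<And>t. 0 \<le> G t" "\<And>t. G t \<le> 1"
  shows "\<bar>(\<Sum>k=1..x div p. G (f (p * k)) / real k) - (\<Sum>k=1..x. G (Suc (f k)) / real k)\<bar>
           \<le> 1 + ln (real p) + harm x / real p"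
proof -
  have p0: "p > 0" using p by (rule prime_gt_0_nat)
  define y where "y = x div p"
  have yx: "y \<le> x" by (simp add: y_def)
  have Gd: "\<bar>G s - G t\<bar> \<le> 1" for s t using G[of s] G[of t] by linarith
  have "\<bar>(\<Sum>k=1..y. G (f (p * k)) / real k) - (\<Sum>k=1..y. G (Suc (f k)) / real k)\<bar>
      \<le> (\<Sum>k=1..y. \<bar>(G (f (p * k)) - G (Suc (f k))) / real k\<bar>)"
    unfolding sum_subtractf[symmetric] diff_divide_distrib by (rule sum_abs)
  also have "\<dots> \<le> (\<Sum>k=1..y. if p dvd k then 1 / real k else 0)"
  proof (rule sum_mono)
    fix k assume "k \<in> {1..y}"
    then show "\<bar>(G (f (p * k)) - G (Suc (f k))) / real k\<bar> \<le> (if p dvd k then 1 / real k else 0)"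
      using f_prime_mult[OF p, of k] Gd by (auto simp: divide_right_mono)
  qed
  also have "\<dots> = (\<Sum>k=1..y div p. 1 / real (p * k))" by (rule sum_multiples[OF p0])
  also have "\<dots> = harm (y div p) / real p"
    by (simp add: harm_def sum_divide_distrib divide_simps mult.commute)
  also have "\<dots> \<le> harm x / real p"
    by (intro divide_right_mono harm_mono) (auto intro: order_trans[OF div_le_dividend yx])
  finally have A: "\<bar>(\<Sum>k=1..y. G (f (p * k)) / real k) - (\<Sum>k=1..y. G (Suc (f k)) / real k)\<bar>
      \<le> harm x / real p" .
  have split: "{1..x} = {1..y} \<union> {y<..x}" using yx by auto
  have "(\<Sum>k=1..x. G (Suc (f k)) / real k) =
      (\<Sum>k=1..y. G (Suc (f k)) / real k) + (\<Sum>k\<in>{y<..x}. G (Suc (f k)) / real k)"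
    unfolding split by (rule sum.union_disjoint) auto
  moreover have "(\<Sum>k\<in>{y<..x}. G (Suc (f k)) / real k) \<le> (\<Sum>k\<in>{y<..x}. inverse (real k))"
    using G by (intro sum_mono) (simp add: divide_simps)
  moreover have "(\<Sum>k\<in>{y<..x}. inverse (real k)) = harm x - harm y"
  proof -
    have "harm x = harm y + (\<Sum>k\<in>{y<..x}. inverse (real k))"
      unfolding harm_def split by (rule sum.union_disjoint) auto
    then show ?thesis by simp
  qed
  moreover have "harm x - harm y \<le> 1 + ln (real p)"
    unfolding y_def by (rule harm_diff_div_le[OF p0 x])
  moreover have "(\<Sum>k\<in>{y<..x}. G (Suc (f k)) / real k) \<ge> 0"
    using G by (intro sum_nonneg) auto
  ultimately show ?thesis using A unfolding y_def[symmetric] by linarith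
qed

end

section \<open>Moments of the number of prime divisors\<close>

definition prime_div_count :: "nat set \<Rightarrow> nat \<Rightarrow> real" where
  "prime_div_count P m = (\<Sum>p\<in>P. if p dvd m then 1 else 0)"

lemma sum_prime_div_count:
  assumes "\<And>p. p \<in> P \<Longrightarrow> p > 0"
  shows "(\<Sum>m=1..x. \<phi> m * prime_div_count P m) = (\<Sum>p\<in>P. \<Sum>k=1..x div p. \<phi> (p * k))"
proof -
  have "(\<Sum>m=1..x. \<phi> m * prime_div_count P m) = (\<Sum>m=1..x. \<Sum>p\<in>P. if p dvd m then \<phi> m else 0)"
    unfolding prime_div_count_def sum_distrib_left by (intro sum.cong) auto
  also have "\<dots> = (\<Sum>p\<in>P. \<Sum>m=1..x. if p dvd m then \<phi> m else 0)" by (rule sum.swap)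
  also have "\<dots> = (\<Sum>p\<in>P. \<Sum>k=1..x div p. \<phi> (p * k))"
    using assms by (intro sum.cong sum_multiples) auto
  finally show ?thesis .
qed

text \<open>The second-moment half of Turan's inequality for any weight under which the multiples of
  d carry at most a d-th of the mass H; it serves for the weights 1/m and 1 alike. Distinct primes
  give at most L^2 H in total, the diagonal adds L H.\<close>

lemma sum_prime_div_count_square_le:
  fixes \<phi> :: "nat \<Rightarrow> real"
  assumes fin: "finite P" and P: "\<And>p. p \<in> P \<Longrightarrow> prime p"
    and multiples: "\<And>d. d > 0 \<Longrightarrow> (\<Sum>m=1..x. if d dvd m then \<phi> m else 0) \<le> H / real d"
    and H: "H \<ge> 0"
  defines "L \<equiv> \<Sum>p\<in>P. 1 / real p"
  shows "(\<Sum>m=1..x. \<phi> m * (prime_div_count P m)\<^sup>2) \<le> (L\<^sup>2 + L) * H"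
proof -
  have P0: "p > 0" if "p \<in> P" for p using P[OF that] by (rule prime_gt_0_nat)
  have "(\<Sum>m=1..x. \<phi> m * (prime_div_count P m)\<^sup>2) =
     (\<Sum>m=1..x. \<Sum>p\<in>P. \<Sum>q\<in>P. if p dvd m \<and> q dvd m then \<phi> m else 0)"
    unfolding prime_div_count_def power2_eq_square sum_product sum_distrib_left
    by (intro sum.cong refl) (auto simp: sum_distrib_left intro!: sum.cong)
  also have "\<dots> = (\<Sum>p\<in>P. \<Sum>q\<in>P. \<Sum>m=1..x. if p dvd m \<and> q dvd m then \<phi> m else 0)"
    by (subst sum.swap, rule sum.cong[OF refl], rule sum.swap)
  also have "\<dots> \<le> (\<Sum>p\<in>P. \<Sum>q\<in>P. H / (real p * real q) + (if p = q then H / real p else 0))"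
  proof (intro sum_mono)
    fix p q assume pq: "p \<in> P" "q \<in> P"
    show "(\<Sum>m=1..x. if p dvd m \<and> q dvd m then \<phi> m else 0)
            \<le> H / (real p * real q) + (if p = q then H / real p else 0)"
    proof (cases "p = q")
      case True
      then show ?thesis using multiples[OF P0[OF pq(1)]] H by (simp add: add_increasing)
    next
      case False
      then have "coprime p q" using P pq by (intro primes_coprime) auto
      then have "p dvd m \<and> q dvd m \<longleftrightarrow> p * q dvd m" for m
        by (metis divides_mult dvd_mult_left dvd_mult_right)
      then show ?thesis using multiples[of "p * q"] P0 pq False by simp
    qed
  qed
  also have "\<dots> = (\<Sum>p\<in>P. \<Sum>q\<in>P. H / (real p * real q)) + (\<Sum>p\<in>P. H / real p)"
    using fin by (simp add: sum.distrib)
  also have "(\<Sum>p\<in>P. \<Sum>q\<in>P. H / (real p * real q)) = H * L\<^sup>2"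
    unfolding L_def power2_eq_square sum_product sum_distrib_left
    by (intro sum.cong refl) (simp add: sum_distrib_left sum_divide_distrib mult.commute)
  also have "(\<Sum>p\<in>P. H / real p) = H * L"
    by (simp add: L_def sum_distrib_left)
  finally show ?thesis by (simp add: algebra_simps)
qed

lemma prime_div_count_square_log:
  assumes "finite P" "\<And>p. p \<in> P \<Longrightarrow> prime p"
  defines "L \<equiv> \<Sum>p\<in>P. 1 / real p"
  shows "(\<Sum>m=1..x. (prime_div_count P m)\<^sup>2 / real m) \<le> (L\<^sup>2 + L) * harm x"
proof -
  have "(\<Sum>m=1..x. if d dvd m then 1 / real m else 0) \<le> harm x / real d" if "d > 0" for d
  proof -
    have "(\<Sum>m=1..x. if d dvd m then 1 / real m else 0) = (\<Sum>k=1..x div d. 1 / real (d * k))"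
      by (rule sum_multiples[OF that])
    also have "\<dots> = harm (x div d) / real d"
      by (simp add: harm_def sum_divide_distrib divide_simps mult.commute)
    also have "\<dots> \<le> harm x / real d"
      by (intro divide_right_mono harm_mono) auto
    finally show ?thesis .
  qed
  from sum_prime_div_count_square_le[OF assms(1,2) this harm_nonneg]
  show ?thesis unfolding L_def by simp
qed

text \<open>Turan's inequality in mean. The variance is at most 3 L \<open>harm x\<close>: one part
  from the second moment, two from the deficit of the first moment, which \<open>zL\<close> bounds
  by \<open>harm x\<close>. Instead of Cauchy-Schwarz, \<bar>u\<bar> \<le> (u^2/s + s)/2 is used
  with s = sqrt L, the typical size of u; this gives 3/2 + 1/2 = 2.\<close>

lemma sum_abs_prime_div_count_log:
  assumes fin: "finite P" and P: "\<And>p. p \<in> P \<Longrightarrow> prime p" and z: "\<And>p. p \<in> P \<Longrightarrow> p \<le> z"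
    and x: "x > 0"
  defines "L \<equiv> \<Sum>p\<in>P. 1 / real p"
  assumes L: "L \<ge> 1" and zL: "(1 + ln (real z)) * L \<le> harm x"
  shows "(\<Sum>m=1..x. \<bar>prime_div_count P m - L\<bar> / real m) \<le> 2 * sqrt L * harm x"
proof -
  have P0: "p > 0" if "p \<in> P" for p using P[OF that] by (rule prime_gt_0_nat)
  define D where "D = 1 + ln (real z)"
  let ?W = "harm x :: real" and ?w = "prime_div_count P"
  have "(\<Sum>m=1..x. ?w m / real m) = (\<Sum>m=1..x. (1 / real m) * ?w m)" by simp
  also have "\<dots> = (\<Sum>p\<in>P. \<Sum>k=1..x div p. 1 / real (p * k))"
    by (rule sum_prime_div_count[OF P0])
  also have "\<dots> = (\<Sum>p\<in>P. harm (x div p) / real p)"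
    by (simp add: harm_def sum_divide_distrib divide_simps mult.commute)
  also have "\<dots> \<ge> (\<Sum>p\<in>P. (?W - D) / real p)"
  proof (intro sum_mono divide_right_mono)
    fix p assume p: "p \<in> P"
    have "ln (real p) \<le> ln (real z)" using P0 z p by (intro ln_mono) auto
    with harm_diff_div_le[OF P0[OF p] x] show "?W - D \<le> harm (x div p)" unfolding D_def by linarith
  qed auto
  also have "(\<Sum>p\<in>P. (?W - D) / real p) = (?W - D) * L"
    by (simp add: L_def sum_distrib_left)
  finally have first: "(\<Sum>m=1..x. ?w m / real m) \<ge> (?W - D) * L" .
  have sqrtL: "sqrt L > 0" "sqrt L * sqrt L = L" using L by auto
  have "(\<Sum>m=1..x. \<bar>?w m - L\<bar> / real m)
      \<le> (\<Sum>m=1..x. (((?w m - L)\<^sup>2 / sqrt L + sqrt L) / 2) / real m)"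
  proof (intro sum_mono divide_right_mono)
    fix m
    have "0 \<le> (\<bar>?w m - L\<bar> - sqrt L)\<^sup>2" by simp
    also have "\<dots> = (?w m - L)\<^sup>2 + sqrt L * sqrt L - 2 * sqrt L * \<bar>?w m - L\<bar>"
      by (simp add: power2_eq_square algebra_simps abs_if)
    finally show "\<bar>?w m - L\<bar> \<le> ((?w m - L)\<^sup>2 / sqrt L + sqrt L) / 2"
      using sqrtL(1) by (simp add: divide_simps algebra_simps)
  qed auto
  also have "\<dots> = (\<Sum>m=1..x. (?w m - L)\<^sup>2 / real m) / (2 * sqrt L) + sqrt L * ?W / 2"
  proof -
    have "(((?w m - L)\<^sup>2 / sqrt L + sqrt L) / 2) / real m
        = (?w m - L)\<^sup>2 / real m / (2 * sqrt L) + sqrt L / 2 * inverse (real m)" for m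
      by (simp add: add_divide_distrib inverse_eq_divide)
    then show ?thesis
      by (simp add: sum.distrib sum_divide_distrib harm_def sum_distrib_left)
  qed
  also have "(\<Sum>m=1..x. (?w m - L)\<^sup>2 / real m)
      = (\<Sum>m=1..x. (?w m)\<^sup>2 / real m) - 2 * L * (\<Sum>m=1..x. ?w m / real m) + L\<^sup>2 * ?W"
    unfolding harm_def sum_distrib_left sum_subtractf[symmetric] sum.distrib[symmetric]
    by (intro sum.cong) (auto simp: power2_eq_square field_simps)
  also have "\<dots> \<le> (L\<^sup>2 + L) * ?W - 2 * L * ((?W - D) * L) + L\<^sup>2 * ?W"
    using prime_div_count_square_log[OF fin P, of x] first L unfolding L_def[symmetric]
    by (intro add_mono diff_mono mult_left_mono) auto
  also have "\<dots> = L * ?W + 2 * L * (D * L)" by (simp add: power2_eq_square algebra_simps)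
  also have "\<dots> \<le> L * ?W + 2 * L * ?W"
    using zL L unfolding D_def by (intro add_mono mult_left_mono) auto
  finally have "(\<Sum>m=1..x. \<bar>?w m - L\<bar> / real m) \<le> (3 * L * ?W) / (2 * sqrt L) + sqrt L * ?W / 2"
    using sqrtL by (simp add: divide_right_mono)
  also have "(3 * L * ?W) / (2 * sqrt L) = 3 / 2 * sqrt L * ?W"
    using sqrtL by (simp add: divide_simps)
  finally show ?thesis by (simp add: mult_ac)
qed

section \<open>Almost invariance and periodic averages\<close>

context prime_step
begin

text \<open>The sum \<open>U\<close>, which weights \<open>G (f m)\<close> by the number of divisors
  of m in P, is evaluated twice. That number is close to L in mean, so U is close to L A; writing m
  = p k, each p contributes nearly B/p, so U is close to L B. Both errors are O(sqrt L) times the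
  mass, and division by L remains.\<close>

lemma log_average_shift:
  fixes G :: "nat \<Rightarrow> real"
  assumes fin: "finite P" and P: "\<And>p. p \<in> P \<Longrightarrow> prime p" and z: "\<And>p. p \<in> P \<Longrightarrow> p \<le> z"
    and x: "x > 0" and G: "\<And>t. 0 \<le> G t" "\<And>t. G t \<le> 1"
  defines "L \<equiv> \<Sum>p\<in>P. 1 / real p"
  assumes L: "L \<ge> 1" and zL: "(1 + ln (real z)) * L \<le> harm x"
  shows "\<bar>(\<Sum>m=1..x. G (f m) / real m) - (\<Sum>m=1..x. G (Suc (f m)) / real m)\<bar>
           \<le> 4 * harm x / sqrt L"
proof -
  have P0: "p > 0" if "p \<in> P" for p using P[OF that] by (rule prime_gt_0_nat)
  let ?W = "harm x :: real" and ?w = "prime_div_count P"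
  define A where "A = (\<Sum>m=1..x. G (f m) / real m)"
  define B where "B = (\<Sum>m=1..x. G (Suc (f m)) / real m)"
  define U where "U = (\<Sum>m=1..x. G (f m) / real m * ?w m)"
  have "U = (\<Sum>p\<in>P. \<Sum>k=1..x div p. G (f (p * k)) / real (p * k))"
    unfolding U_def by (rule sum_prime_div_count[OF P0])
  also have "\<dots> = (\<Sum>p\<in>P. (\<Sum>k=1..x div p. G (f (p * k)) / real k) / real p)"
    by (simp add: sum_divide_distrib mult.commute)
  finally have "U - L * B = (\<Sum>p\<in>P. ((\<Sum>k=1..x div p. G (f (p * k)) / real k) - B) / real p)"
    by (simp add: L_def sum_distrib_right sum_subtractf diff_divide_distrib)
  then have "\<bar>U - L * B\<bar> \<le> (\<Sum>p\<in>P. \<bar>((\<Sum>k=1..x div p. G (f (p * k)) / real k) - B) / real p\<bar>)"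
    by (simp only: sum_abs)
  also have "\<dots> \<le> (\<Sum>p\<in>P. (1 + ln (real z) + ?W / real p) / real p)"
  proof (rule sum_mono)
    fix p assume p: "p \<in> P"
    have "ln (real p) \<le> ln (real z)" using P0 z p by (intro ln_mono) auto
    then have "\<bar>(\<Sum>k=1..x div p. G (f (p * k)) / real k) - B\<bar> \<le> 1 + ln (real z) + ?W / real p"
      using sum_shift_multiples[of p x G, OF P[OF p] x G] unfolding B_def by linarith
    then show "\<bar>((\<Sum>k=1..x div p. G (f (p * k)) / real k) - B) / real p\<bar>
        \<le> (1 + ln (real z) + ?W / real p) / real p"
      by (simp add: divide_right_mono)
  qed
  also have "\<dots> = (1 + ln (real z)) * L + ?W * (\<Sum>p\<in>P. 1 / (real p)\<^sup>2)"
    by (simp add: L_def sum_distrib_left add_divide_distrib sum.distrib power2_eq_square)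
  \<comment> \<open>\<open>zL\<close> absorbs the cut-off losses, and the convergence of the sum of
    1/p^2 absorbs the pairs with p dividing k.\<close>
  also have "\<dots> \<le> ?W + ?W * 1"
  proof (intro add_mono mult_left_mono)
    have "P \<subseteq> {2..}" using P prime_ge_2_nat by auto
    from sum_recip_squares_le[OF fin this] show "(\<Sum>p\<in>P. 1 / (real p)\<^sup>2) \<le> 1" by simp
  qed (use zL harm_nonneg[of x, where 'a = real] in auto)
  finally have UB: "\<bar>U - L * B\<bar> \<le> 2 * ?W" by simp
  have "\<bar>L * A - U\<bar> = \<bar>\<Sum>m=1..x. G (f m) / real m * (L - ?w m)\<bar>"
    unfolding A_def U_def sum_distrib_left sum_subtractf[symmetric]
    by (intro arg_cong[where f = abs] sum.cong) (auto simp: algebra_simps diff_divide_distrib)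
  also have "\<dots> \<le> (\<Sum>m=1..x. \<bar>G (f m) / real m * (L - ?w m)\<bar>)" by (rule sum_abs)
  also have "\<dots> \<le> (\<Sum>m=1..x. \<bar>?w m - L\<bar> / real m)"
  proof (rule sum_mono)
    fix m
    have "G (f m) * \<bar>?w m - L\<bar> \<le> 1 * \<bar>?w m - L\<bar>" using G by (intro mult_right_mono) auto
    then show "\<bar>G (f m) / real m * (L - ?w m)\<bar> \<le> \<bar>?w m - L\<bar> / real m"
      using G by (simp add: abs_mult divide_right_mono abs_minus_commute)
  qed
  also have "\<dots> \<le> 2 * sqrt L * ?W"
    using L zL unfolding L_def by (intro sum_abs_prime_div_count_log[OF fin P z x]) auto
  finally have "\<bar>L * A - U\<bar> \<le> 2 * sqrt L * ?W" .
  with UB have "\<bar>L * A - L * B\<bar> \<le> 2 * sqrt L * ?W + 2 * ?W" by linarith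
  also have "\<dots> \<le> 2 * sqrt L * ?W + 2 * (sqrt L * ?W)"
    using L mult_right_mono[of 1 "sqrt L" ?W] by (simp add: harm_nonneg mult.commute)
  finally have "\<bar>L * A - L * B\<bar> \<le> 2 * sqrt L * ?W + 2 * (sqrt L * ?W)" .
  then have "L * \<bar>A - B\<bar> \<le> 4 * sqrt L * ?W"
    proof -
    have "L * \<bar>A - B\<bar> = \<bar>L * A - L * B\<bar>"
      using L by (simp add: abs_mult flip: right_diff_distrib)
    then show ?thesis
      using \<open>\<bar>L * A - L * B\<bar> \<le> 2 * sqrt L * ?W + 2 * (sqrt L * ?W)\<close> by linarith
  qed
  then have "\<bar>A - B\<bar> \<le> 4 * sqrt L * ?W / L" using L by (simp add: field_simps)
  also have "\<dots> = 4 * ?W / sqrt L"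
    using L by (simp add: divide_simps)
  finally show ?thesis unfolding A_def B_def .
qed

lemma log_average_shift_many:
  fixes G :: "nat \<Rightarrow> real"
  assumes fin: "finite P" and P: "\<And>p. p \<in> P \<Longrightarrow> prime p" and z: "\<And>p. p \<in> P \<Longrightarrow> p \<le> z"
    and x: "x > 0" and G: "\<And>t. 0 \<le> G t" "\<And>t. G t \<le> 1"
  defines "L \<equiv> \<Sum>p\<in>P. 1 / real p"
  assumes L: "L \<ge> 1" and zL: "(1 + ln (real z)) * L \<le> harm x"
  shows "\<bar>(\<Sum>m=1..x. G (f m) / real m) - (\<Sum>m=1..x. G (f m + h) / real m)\<bar>
           \<le> real h * (4 * harm x / sqrt L)"
proof (induction h)
  case (Suc h)
  have "\<bar>(\<Sum>m=1..x. G (f m + h) / real m) - (\<Sum>m=1..x. G (Suc (f m) + h) / real m)\<bar>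
      \<le> 4 * harm x / sqrt L"
    using L zL G unfolding L_def by (intro log_average_shift[OF fin P z x]) auto
  moreover have "real (Suc h) * c = real h * c + c" for c
    by (simp add: distrib_right)
  note this[of "4 * harm x / sqrt L"]
  ultimately show ?case using Suc unfolding add_Suc_right add_Suc by linarith
qed simp

text \<open>Averaging over the shifts h < Q turns the inner sum into one over a full period, which
  no longer depends on \<open>f m\<close>. Each shift costs up to Q times the error of a unit shift,
  so Q must be small against sqrt L. The argument is \<open>Suc (f m)\<close> because the passage to
  natural density, where n = p m, produces this form.\<close>

lemma log_average_periodic:
  fixes G :: "nat \<Rightarrow> real"
  assumes fin: "finite P" and P: "\<And>p. p \<in> P \<Longrightarrow> prime p" and z: "\<And>p. p \<in> P \<Longrightarrow> p \<le> z"
    and x: "x > 0" and G: "\<And>t. 0 \<le> G t" "\<And>t. G t \<le> 1"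
    and Q: "Q > 0" and per: "\<And>t. G (t + Q) = G t"
  defines "L \<equiv> \<Sum>p\<in>P. 1 / real p"
  assumes L: "L \<ge> 1" and zL: "(1 + ln (real z)) * L \<le> harm x"
  shows "(\<Sum>m=1..x. G (Suc (f m)) / real m)
           \<le> harm x * ((\<Sum>h<Q. G h) / real Q + 4 * real Q / sqrt L)"
proof -
  have shift: "(\<Sum>h<Q. G (t + h)) = (\<Sum>h<Q. G h)" for t
  proof (induction t)
    case (Suc t)
    have "(\<Sum>h<Q. G (Suc t + h)) + G t = (\<Sum>h<Suc Q. G (t + h))"
      by (subst sum.lessThan_Suc_shift) simp
    also have "\<dots> = (\<Sum>h<Q. G (t + h)) + G t" using per by simp
    finally show ?case using Suc by simp
  qed simp
  have "real Q * (\<Sum>m=1..x. G (Suc (f m)) / real m)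
      = (\<Sum>h<Q. \<Sum>m=1..x. G (Suc (f m)) / real m)" by simp
  also have "\<dots> \<le> (\<Sum>h<Q. (\<Sum>m=1..x. G (Suc (f m) + h) / real m) + real Q * (4 * harm x / sqrt L))"
  proof (rule sum_mono)
    fix h assume "h \<in> {..<Q}"
    then have "real h * (4 * harm x / sqrt L) \<le> real Q * (4 * harm x / sqrt L)"
      using L harm_nonneg[of x, where 'a = real] by (intro mult_right_mono divide_nonneg_nonneg) auto
    moreover have "\<bar>(\<Sum>m=1..x. G (Suc (f m)) / real m) - (\<Sum>m=1..x. G (Suc (f m + h)) / real m)\<bar>
           \<le> real h * (4 * harm x / sqrt L)"
      using L zL G unfolding L_def
      by (intro log_average_shift_many[OF fin P z x, of "\<lambda>t. G (Suc t)"]) auto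
    ultimately show "(\<Sum>m=1..x. G (Suc (f m)) / real m)
        \<le> (\<Sum>m=1..x. G (Suc (f m) + h) / real m) + real Q * (4 * harm x / sqrt L)"
      by simp
  qed
  also have "\<dots> = (\<Sum>m=1..x. \<Sum>h<Q. G (Suc (f m) + h) / real m) + real Q * (real Q * (4 * harm x / sqrt L))"
    by (simp add: sum.distrib sum.swap[of _ "{..<Q}"])
  also have "(\<Sum>m=1..x. \<Sum>h<Q. G (Suc (f m) + h) / real m) = harm x * (\<Sum>h<Q. G h)"
    unfolding sum_divide_distrib[symmetric] shift
    by (simp add: harm_def sum_distrib_right divide_simps)
  finally have "real Q * (\<Sum>m=1..x. G (Suc (f m)) / real m)
      \<le> harm x * (\<Sum>h<Q. G h) + real Q * (real Q * (4 * harm x / sqrt L))" .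
  then have "(\<Sum>m=1..x. G (Suc (f m)) / real m)
      \<le> (harm x * (\<Sum>h<Q. G h) + real Q * (real Q * (4 * harm x / sqrt L))) / real Q"
    using Q by (simp add: pos_le_divide_eq mult.commute)
  also have "\<dots> = harm x * ((\<Sum>h<Q. G h) / real Q + 4 * real Q / sqrt L)"
    using Q by (simp add: add_divide_distrib algebra_simps)
  finally show ?thesis .
qed

end

section \<open>From logarithmic to natural density\<close>

lemma ln_prime_factor_nonneg:
  assumes "p \<in> prime_factors (n::nat)"
  shows "0 \<le> ln (real p)"
proof -
  have "prime p" using assms by auto
  then have "1 \<le> p" by (rule prime_ge_1_nat)
  then show ?thesis by simp
qed

lemma card_square_multiples_le:
  assumes "finite D" "\<And>d. d \<in> D \<Longrightarrow> d > 0"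
  shows "real (card {n \<in> {1..x}. \<exists>d\<in>D. d\<^sup>2 dvd n}) \<le> real x * (\<Sum>d\<in>D. 1 / (real d)\<^sup>2)"
proof -
  have "{n \<in> {1..x}. \<exists>d\<in>D. d\<^sup>2 dvd n} = (\<Union>d\<in>D. {n \<in> {1..x}. d\<^sup>2 dvd n})" by auto
  then have "real (card {n \<in> {1..x}. \<exists>d\<in>D. d\<^sup>2 dvd n}) \<le> (\<Sum>d\<in>D. real (card {n \<in> {1..x}. d\<^sup>2 dvd n}))"
    using card_UN_le[OF assms(1), of "\<lambda>d. {n \<in> {1..x}. d\<^sup>2 dvd n}"]
    by (simp only: of_nat_le_iff flip: of_nat_sum)
  also have "\<dots> \<le> (\<Sum>d\<in>D. real x * (1 / (real d)\<^sup>2))"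
  proof (rule sum_mono)
    fix d assume "d \<in> D"
    then have d: "d\<^sup>2 > 0" using assms(2) by simp
    have "real (card {n \<in> {1..x}. d\<^sup>2 dvd n}) = (\<Sum>n=1..x. if d\<^sup>2 dvd n then 1 else 0)"
      by (simp flip: sum.inter_filter)
    also have "\<dots> = real (x div d\<^sup>2)" using sum_multiples[OF d, of "\<lambda>_. 1" x] by simp
    also have "\<dots> \<le> real x * (1 / (real d)\<^sup>2)"
      using of_nat_div_le_of_nat[of x "d\<^sup>2", where 'a = real] by simp
    finally show "real (card {n \<in> {1..x}. d\<^sup>2 dvd n}) \<le> real x * (1 / (real d)\<^sup>2)" .
  qed
  finally show ?thesis by (simp add: sum_distrib_left)
qed

lemma sum_recip_squares_tail_le:
  assumes "T > 0"
  shows "(\<Sum>d\<in>{T<..x}. 1 / (real d)\<^sup>2) \<le> 1 / real T"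
proof -
  have "(\<Sum>d\<in>{T<..x}. 1 / (real d)\<^sup>2) \<le> 1 / real T - 1 / real x" if "x \<ge> T"
    using that
  proof (induction x rule: dec_induct)
    case (step n)
    have "{T<..Suc n} = insert (Suc n) {T<..n}" using step.hyps by auto
    moreover have "1 / (real (Suc n))\<^sup>2 \<le> 1 / real n - 1 / real (Suc n)"
      using step.hyps assms by (simp add: divide_simps power2_eq_square)
    ultimately show ?case using step by simp
  qed simp
  moreover have "{T<..x} = {}" if "x < T" using that by auto
  ultimately show ?thesis by (cases "x < T") (auto intro: order_trans)
qed

text \<open>With n = s d^2 and s squarefree, s is the product of its primes, all of which divide n.
  So the weight falls short of ln n by at most 2 ln d, and only a large square divisor can make it
  small.\<close>

lemma sum_ln_prime_factors_ge:
  fixes n :: nat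
  assumes "n > 0"
  shows "ln (real n) - 2 * ln (real (square_part n)) \<le> (\<Sum>p\<in>prime_factors n. ln (real p))"
proof -
  define s where "s = squarefree_part n"
  define d where "d = square_part n"
  have n: "n = s * d\<^sup>2" unfolding s_def d_def by (rule squarefree_decompose)
  then have pos: "s > 0" "d > 0" using assms by auto
  have p0: "p > 0" if "p \<in> prime_factors s" for p using that by (auto intro: prime_gt_0_nat)
  have "s = (\<Prod>p\<in>prime_factors s. p ^ multiplicity p s)"
    using prod_prime_factors[of s] pos by simp
  also have "\<dots> \<le> (\<Prod>p\<in>prime_factors s. p)"
  proof (rule prod_mono)
    fix p assume p: "p \<in> prime_factors s"
    then have "prime p" by auto
    have "multiplicity p s \<le> 1"
      using prime_multiplicity_squarefree_part_le_Suc_0[OF \<open>prime p\<close>, of n] by (simp add: s_def)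
    then have "p ^ multiplicity p s \<le> p ^ 1" using p0[OF p] by (intro power_increasing) auto
    then show "0 \<le> p ^ multiplicity p s \<and> p ^ multiplicity p s \<le> p" by simp
  qed
  finally have "real s \<le> real (\<Prod>p\<in>prime_factors s. p)" by (simp only: of_nat_le_iff)
  then have "real s \<le> (\<Prod>p\<in>prime_factors s. real p)" by (simp only: of_nat_prod)
  then have "ln (real s) \<le> ln (\<Prod>p\<in>prime_factors s. real p)" using pos by (intro ln_mono) auto
  also have "\<dots> = (\<Sum>p\<in>prime_factors s. ln (real p))"
    using p0 by (intro ln_prod) auto
  also have "\<dots> \<le> (\<Sum>p\<in>prime_factors n. ln (real p))"
  proof (rule sum_mono2[OF finite_set_mset])
    show "prime_factors s \<subseteq> prime_factors n" using n assms by (intro dvd_prime_factors) auto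
    show "0 \<le> ln (real p)" if "p \<in> prime_factors n - prime_factors s" for p
      using that by (intro ln_prime_factor_nonneg) auto
  qed
  also have "ln (real s) = ln (real n) - 2 * ln (real d)"
    using pos by (simp add: n ln_mult ln_realpow)
  finally show ?thesis unfolding d_def .
qed

text \<open>Comparison with the convergent series of 2 n powr (-3/2), by ln n \<le> 2 sqrt n. Only
  finite sums occur later, so one uniform bound is enough.\<close>

lemma sum_ln_over_squares_bounded:
  obtains C where "C \<ge> 0" "\<And>A. finite A \<Longrightarrow> (\<Sum>n\<in>A. ln (real n) / (real n)\<^sup>2) \<le> C"
proof
  let ?g = "\<lambda>n::nat. 2 * real n powr (-3/2)"
  have summ: "summable ?g"
    using summable_real_powr_iff[of "-3/2"] by (intro summable_mult) simp
  show "(\<Sum>n\<in>A. ln (real n) / (real n)\<^sup>2) \<le> suminf ?g" if "finite A" for A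
  proof -
    have "ln (real n) / (real n)\<^sup>2 \<le> ?g n" for n
    proof (cases "n = 0")
      case False
      then have n: "real n > 0" by simp
      have "ln (real n) = 2 * ln (sqrt (real n))" using n by (simp add: ln_sqrt)
      also have "\<dots> \<le> 2 * sqrt (real n)"
        using ln_le_minus_one[of "sqrt (real n)"] n by simp
      finally have "ln (real n) / (real n)\<^sup>2 \<le> 2 * sqrt (real n) / (real n)\<^sup>2"
        by (intro divide_right_mono) auto
      also have "\<dots> = 2 * (real n powr (1/2) / real n powr 2)"
        using n by (simp add: powr_half_sqrt)
      also have "\<dots> = ?g n" unfolding powr_diff[symmetric] by simp
      finally show ?thesis .
    qed simp
    then have "(\<Sum>n\<in>A. ln (real n) / (real n)\<^sup>2) \<le> (\<Sum>n\<in>A. ?g n)" by (intro sum_mono)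
    also have "\<dots> \<le> suminf ?g" using summ that by (intro sum_le_suminf) auto
    finally show ?thesis .
  qed
  show "suminf ?g \<ge> 0" by (rule suminf_nonneg[OF summ]) auto
qed

context prime_step
begin

text \<open>
  The terms \<open>n = p m\<close> with \<open>p\<close> dividing \<open>m\<close>, where \<open>f (p m)\<close> is not controlled, contribute only \<open>O(x)\<close>.
\<close>

lemma sum_weighted_prime_factors_le:
  fixes G :: "nat \<Rightarrow> real"
  assumes G: "\<And>t. 0 \<le> G t" "\<And>t. G t \<le> 1"
    and C: "\<And>A. finite A \<Longrightarrow> (\<Sum>n\<in>A. ln (real n) / (real n)\<^sup>2) \<le> C"
  shows "(\<Sum>n=1..x. G (f n) * (\<Sum>p\<in>prime_factors n. ln (real p)))
           \<le> real x * (2 * (\<Sum>m=1..x. G (Suc (f m)) / real m) + C)"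
proof -
  let ?P = "primes_upto x"
  have P0: "p > 0" "prime p" if "p \<in> ?P" for p
    using that by (auto simp: primes_upto_def prime_gt_0_nat)
  have "(\<Sum>n=1..x. G (f n) * (\<Sum>p\<in>prime_factors n. ln (real p)))
      = (\<Sum>n=1..x. \<Sum>p\<in>?P. if p dvd n then ln (real p) * G (f n) else 0)"
  proof (rule sum.cong)
    fix n assume n: "n \<in> {1..x}"
    then have eq: "prime_factors n = {p \<in> ?P. p dvd n}"
      by (auto simp: primes_upto_def prime_factors_dvd dest: dvd_imp_le)
    show "G (f n) * (\<Sum>p\<in>prime_factors n. ln (real p))
        = (\<Sum>p\<in>?P. if p dvd n then ln (real p) * G (f n) else 0)"
      unfolding eq sum_distrib_left by (subst sum.inter_filter) (auto intro!: sum.cong)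
  qed simp
  also have "\<dots> = (\<Sum>p\<in>?P. \<Sum>n=1..x. if p dvd n then ln (real p) * G (f n) else 0)"
    by (rule sum.swap)
  also have "\<dots> = (\<Sum>p\<in>?P. \<Sum>k=1..x div p. ln (real p) * G (f (p * k)))"
    using P0 by (intro sum.cong sum_multiples) auto
  also have "\<dots> \<le> (\<Sum>p\<in>?P. (\<Sum>k=1..x div p. ln (real p) * G (Suc (f k))) + real x * (ln (real p) / (real p)\<^sup>2))"
  proof (rule sum_mono)
    fix p assume p: "p \<in> ?P"
    have ln0: "ln (real p) \<ge> 0" using P0[OF p] by (simp add: Suc_le_eq)
    have "(\<Sum>k=1..x div p. ln (real p) * G (f (p * k)))
        \<le> (\<Sum>k=1..x div p. ln (real p) * G (Suc (f k)) + ln (real p) * (if p dvd k then 1 else 0))"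
    proof (rule sum_mono)
      fix k assume "k \<in> {1..x div p}"
      then have "G (f (p * k)) \<le> G (Suc (f k)) + (if p dvd k then 1 else 0)"
        using f_prime_mult[OF P0(2)[OF p], of k] G(1)[of "Suc (f k)"] G(2)[of "f (p * k)"] by auto
      then show "ln (real p) * G (f (p * k)) \<le> ln (real p) * G (Suc (f k)) + ln (real p) * (if p dvd k then 1 else 0)"
        using ln0 by (metis distrib_left mult_left_mono)
    qed
    also have "\<dots> = (\<Sum>k=1..x div p. ln (real p) * G (Suc (f k))) + ln (real p) * real (x div p div p)"
      using sum_multiples[OF P0(1)[OF p], of "\<lambda>_. 1" "x div p"]
      by (simp add: sum.distrib flip: sum_distrib_left)
    also have "\<dots> \<le> (\<Sum>k=1..x div p. ln (real p) * G (Suc (f k))) + ln (real p) * (real x / (real p)\<^sup>2)"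
      using ln0 of_nat_div_le_of_nat[of x "p * p", where 'a = real] 
      by (intro add_left_mono mult_left_mono) (simp_all add: div_mult2_eq power2_eq_square)
    finally show "(\<Sum>k=1..x div p. ln (real p) * G (f (p * k)))
        \<le> (\<Sum>k=1..x div p. ln (real p) * G (Suc (f k))) + real x * (ln (real p) / (real p)\<^sup>2)"
      by (simp add: mult.commute)
  qed
  also have "\<dots> = (\<Sum>p\<in>?P. \<Sum>k=1..x div p. ln (real p) * G (Suc (f k)))
      + real x * (\<Sum>p\<in>?P. ln (real p) / (real p)\<^sup>2)"
    by (simp add: sum.distrib sum_distrib_left)
  also have "\<dots> \<le> (\<Sum>p\<in>?P. \<Sum>k=1..x div p. ln (real p) * G (Suc (f k))) + real x * C"
    using C by (intro add_mono mult_left_mono) auto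
  also have "(\<Sum>p\<in>?P. \<Sum>k=1..x div p. ln (real p) * G (Suc (f k)))
      = (\<Sum>p\<in>?P. \<Sum>k=1..x. if p * k \<le> x then ln (real p) * G (Suc (f k)) else 0)"
  proof (rule sum.cong)
    fix p assume p: "p \<in> ?P"
    have "k \<le> p * k" for k using P0(1)[OF p] by simp
    then have le: "k \<le> x" if "p * k \<le> x" for k using that le_trans by blast
    have eq: "{1..x div p} = {k \<in> {1..x}. p * k \<le> x}"
      using P0(1)[OF p] by (auto simp: less_eq_div_iff_mult_less_eq mult.commute[of p] dest: le[unfolded mult.commute[of p]])
    show "(\<Sum>k=1..x div p. ln (real p) * G (Suc (f k)))
      = (\<Sum>k=1..x. if p * k \<le> x then ln (real p) * G (Suc (f k)) else 0)"
      unfolding eq by (subst sum.inter_filter) auto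
  qed simp
  also have "\<dots> = (\<Sum>k=1..x. \<Sum>p\<in>?P. if p * k \<le> x then ln (real p) * G (Suc (f k)) else 0)"
    by (rule sum.swap)
  \<comment> \<open>Here counting turns into logarithmic weights: for fixed k the admissible primes
    are those up to x/k, and their logarithms add up to at most 2x/k.\<close>
  also have "\<dots> = (\<Sum>k=1..x. G (Suc (f k)) * chebyshev_theta (x div k))"
  proof (rule sum.cong)
    fix k assume k: "k \<in> {1..x}"
    have "p \<le> p * k" for p using k by simp
    then have le: "p \<le> x" if "p * k \<le> x" for p using that le_trans by blast
    have "primes_upto (x div k) = {p \<in> ?P. p * k \<le> x}"
      using k by (auto simp: primes_upto_def less_eq_div_iff_mult_less_eq dest: le)
    then show "(\<Sum>p\<in>?P. if p * k \<le> x then ln (real p) * G (Suc (f k)) else 0)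
        = G (Suc (f k)) * chebyshev_theta (x div k)"
      by (simp add: chebyshev_theta_def sum.inter_filter[symmetric] sum_distrib_left mult.commute)
  qed simp
  also have "\<dots> \<le> (\<Sum>k=1..x. G (Suc (f k)) * (2 * (real x / real k)))"
  proof (intro sum_mono mult_left_mono)
    fix k
    show "chebyshev_theta (x div k) \<le> 2 * (real x / real k)"
      using chebyshev_theta_le[of "x div k"] of_nat_div_le_of_nat[of x k, where 'a = real] by linarith
  qed (use G in auto)
  also have "\<dots> = real x * (2 * (\<Sum>m=1..x. G (Suc (f m)) / real m))"
    by (simp add: sum_distrib_left mult_ac)
  finally show ?thesis by (simp add: algebra_simps)
qed

text \<open>
  Outside the \<open>n\<close> with a square factor beyond \<open>T\<^sup>2\<close> and the \<open>n \<le> x/T\<close>, the weight of \<open>n\<close> is at least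
  half of \<open>ln x\<close>.
\<close>

lemma natural_average_le_log_average:
  fixes G :: "nat \<Rightarrow> real"
  assumes G: "\<And>t. 0 \<le> G t" "\<And>t. G t \<le> 1"
    and C: "\<And>A. finite A \<Longrightarrow> (\<Sum>n\<in>A. ln (real n) / (real n)\<^sup>2) \<le> C"
    and T: "T > 0" and x: "x \<ge> 2" and Tx: "6 * ln (real T) \<le> ln (real x)"
  shows "(\<Sum>n=1..x. G (f n))
           \<le> real x * (2 / real T + (4 * (\<Sum>m=1..x. G (Suc (f m)) / real m) + 2 * C) / ln (real x))"
proof -
  define B1 where "B1 = {n \<in> {1..x}. \<exists>d\<in>{T<..x}. d\<^sup>2 dvd n}"
  define B2 where "B2 = {n \<in> {1..x}. n * T \<le> x}"
  define w where "w n = (\<Sum>p\<in>prime_factors n. ln (real p))" for n :: nat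
  have lnx: "ln (real x) > 0" using x by simp
  have w0: "w n \<ge> 0" for n unfolding w_def by (intro sum_nonneg ln_prime_factor_nonneg)
  have "real (card B1) \<le> real x * (\<Sum>d\<in>{T<..x}. 1 / (real d)\<^sup>2)"
    unfolding B1_def by (rule card_square_multiples_le) auto
  also have "\<dots> \<le> real x * (1 / real T)"
    using sum_recip_squares_tail_le[OF T] by (intro mult_left_mono) auto
  finally have B1: "real (card B1) \<le> real x / real T" by simp
  have "B2 \<subseteq> {1..x div T}" using T by (auto simp: B2_def less_eq_div_iff_mult_less_eq)
  then have "card B2 \<le> x div T" by (metis card_atLeastAtMost card_mono diff_Suc_1 finite_atLeastAtMost)
  then have B2: "real (card B2) \<le> real x / real T"
    using of_nat_div_le_of_nat[of x T, where 'a = real] by linarith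
  have "(\<Sum>n=1..x. G (f n)) \<le> (\<Sum>n=1..x. (if n \<in> B1 then 1 else 0) + (if n \<in> B2 then 1 else 0)
       + 2 / ln (real x) * (G (f n) * w n))"
  proof (rule sum_mono)
    fix n assume n: "n \<in> {1..x}"
    have pos: "2 / ln (real x) * (G (f n) * w n) \<ge> 0" using lnx G w0 by simp
    show "G (f n) \<le> (if n \<in> B1 then 1 else 0) + (if n \<in> B2 then 1 else 0)
       + 2 / ln (real x) * (G (f n) * w n)"
    proof (cases "n \<in> B1 \<or> n \<in> B2")
      case True
      then show ?thesis using G(2)[of "f n"] pos by auto
    next
      case False
      define d where "d = square_part n"
      have "d \<noteq> 0" using n square_part_0_iff[of n] unfolding d_def by (metis atLeastAtMost_iff not_one_le_zero)
      then have d: "d\<^sup>2 dvd n" "d > 0" by (simp_all add: d_def[symmetric], simp add: d_def)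
      have "d \<le> d\<^sup>2" using d(2) by (simp add: power2_eq_square)
      also have "d\<^sup>2 \<le> x" using d n by (auto dest: dvd_imp_le)
      finally have "d \<le> x" .
      have "d \<le> T"
      proof (rule ccontr)
        assume "\<not> d \<le> T"
        then have "d \<in> {T<..x}" using \<open>d \<le> x\<close> by simp
        then have "n \<in> B1" using d(1) n unfolding B1_def by blast
        with False show False by simp
      qed
      then have "ln (real d) \<le> ln (real T)" using d by (intro ln_mono) auto
      moreover have "ln (real x) \<le> ln (real n) + ln (real T)"
      proof -
        have "x \<le> n * T" using False n unfolding B2_def by auto
        then have "real x \<le> real n * real T" by (metis of_nat_le_iff of_nat_mult)
        moreover have "0 < real x" using x by simp
        ultimately have "ln (real x) \<le> ln (real n * real T)" by (rule ln_mono)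
        then show ?thesis using n T by (simp add: ln_mult)
      qed
      \<comment> \<open>The weight is at least ln x - ln T - 2 ln T, and \<open>Tx\<close> makes 3
        ln T at most half of ln x; hence the 6 in that hypothesis.\<close>
      ultimately have "w n \<ge> ln (real x) / 2"
        using sum_ln_prime_factors_ge[of n] n Tx unfolding w_def d_def by auto
      then have "1 \<le> 2 / ln (real x) * w n" using lnx by (simp add: divide_simps)
      then have "G (f n) * 1 \<le> G (f n) * (2 / ln (real x) * w n)"
        using G(1) by (rule mult_left_mono)
      then show ?thesis using False by (simp add: mult_ac)
    qed
  qed
  also have "\<dots> = real (card B1) + real (card B2) + 2 / ln (real x) * (\<Sum>n=1..x. G (f n) * w n)"
  proof -
    have "(\<Sum>n=1..x. if n \<in> B then 1 else (0::real)) = real (card B)" if "B \<subseteq> {1..x}" for B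
    proof -
      have "(\<Sum>n=1..x. if n \<in> B then 1 else (0::real)) = (\<Sum>n\<in>{n\<in>{1..x}. n \<in> B}. 1)"
        by (subst sum.inter_filter) auto
      also have "{n\<in>{1..x}. n \<in> B} = B" using that by auto
      finally show ?thesis by simp
    qed
    moreover have "B1 \<subseteq> {1..x}" "B2 \<subseteq> {1..x}" by (auto simp: B1_def B2_def)
    ultimately show ?thesis by (simp only: sum.distrib sum_distrib_left)
  qed
  also have "\<dots> \<le> real x / real T + real x / real T + 2 / ln (real x) *
      (real x * (2 * (\<Sum>m=1..x. G (Suc (f m)) / real m) + C))"
    using lnx sum_weighted_prime_factors_le[of G C x, OF G C]
    by (intro add_mono B1 B2 mult_left_mono) (auto simp: w_def)
  also have "\<dots> = real x * (2 / real T + (4 * (\<Sum>m=1..x. G (Suc (f m)) / real m) + 2 * C) / ln (real x))"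
  proof -
    have "x / T + x / T + 2 / l * (x * (2 * S + C)) = x * (2 / T + (4 * S + 2 * C) / l)"
      for x T l S C :: real
      by (simp add: algebra_simps add_divide_distrib)
    then show ?thesis .
  qed
  finally show ?thesis .
qed

end

section \<open>Digits of the values\<close>

text \<open>The indicator that the base b digits of t at positions j to j + k - 1, counted from the
  least significant one, spell the string with value v; it is centred so as to have mean 0 over a
  full period when v < b ^ k.\<close>

definition block_dev :: "nat \<Rightarrow> nat \<Rightarrow> nat \<Rightarrow> nat \<Rightarrow> nat \<Rightarrow> real" where
  "block_dev b k v j t = (if (t div b ^ j) mod b ^ k = v then 1 else 0) - 1 / real b ^ k"

text \<open>Independence of low and high digits under the uniform distribution: h corresponds to the
  pair of its remainder and quotient by A.\<close>

lemma sum_mod_div_product: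
  fixes \<phi> \<psi> :: "nat \<Rightarrow> real"
  assumes "A > 0"
  shows "(\<Sum>h<A * B. \<phi> (h mod A) * \<psi> (h div A)) = (\<Sum>h<A. \<phi> h) * (\<Sum>h<B. \<psi> h)"
proof (induction B)
  case (Suc B)
  have eq: "{..<A * Suc B} = {..<A * B} \<union> (\<lambda>i. A * B + i) ` {..<A}"
  proof (intro equalityI subsetI)
    fix h assume h: "h \<in> {..<A * Suc B}"
    show "h \<in> {..<A * B} \<union> (\<lambda>i. A * B + i) ` {..<A}"
    proof (cases "h < A * B")
      case False
      then have "h = A * B + (h - A * B)" "h - A * B < A" using h by auto
      then show ?thesis by blast
    qed simp
  qed auto
  have "(\<Sum>h<A * Suc B. \<phi> (h mod A) * \<psi> (h div A)) =
      (\<Sum>h<A * B. \<phi> (h mod A) * \<psi> (h div A))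
      + (\<Sum>h\<in>(\<lambda>i. A * B + i) ` {..<A}. \<phi> (h mod A) * \<psi> (h div A))"
    unfolding eq by (rule sum.union_disjoint) auto
  also have "(\<Sum>h\<in>(\<lambda>i. A * B + i) ` {..<A}. \<phi> (h mod A) * \<psi> (h div A)) = (\<Sum>h<A. \<phi> h * \<psi> B)"
    using assms by (subst sum.reindex) (auto simp: inj_on_def intro!: sum.cong)
  also have "(\<Sum>h<A * B. \<phi> (h mod A) * \<psi> (h div A)) + (\<Sum>h<A. \<phi> h * \<psi> B)
      = (\<Sum>h<A. \<phi> h) * (\<Sum>h<Suc B. \<psi> h)"
    unfolding Suc.IH by (simp add: distrib_left sum_distrib_right)
  finally show ?case .
qed simp

lemma block_dev_mod:
  assumes "b \<ge> 1" "j + k \<le> i"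
  shows "block_dev b k v j (t mod b ^ i) = block_dev b k v j t"
proof -
  obtain e where i: "i = j + e" "k \<le> e" using assms(2) by (metis add_le_cancel_left le_add1 le_trans le_iff_add)
  have "(t mod b ^ i) div b ^ j = (t div b ^ j) mod b ^ e"
  proof -
    have "t mod (b ^ j * b ^ e) = b ^ j * (t div b ^ j mod b ^ e) + t mod b ^ j"
      by (rule mod_mult2_eq)
    then show ?thesis using assms(1) by (simp add: i power_add)
  qed
  moreover have "(t div b ^ j) mod b ^ e mod b ^ k = (t div b ^ j) mod b ^ k"
    by (intro mod_mod_cancel le_imp_power_dvd i)
  ultimately show ?thesis by (simp add: block_dev_def)
qed

lemma block_dev_periodic:
  assumes "b \<ge> 1" "j + k \<le> i"
  shows "block_dev b k v j (t + b ^ i) = block_dev b k v j t"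
  using block_dev_mod[OF assms, of v "t + b ^ i"] block_dev_mod[OF assms, of v t] by simp

lemma abs_block_dev_le: "b \<ge> 1 \<Longrightarrow> \<bar>block_dev b k v j t\<bar> \<le> 1"
  by (auto simp: block_dev_def divide_simps)

lemma sum_block_dev_eq_0:
  assumes b: "b \<ge> 1" and v: "v < b ^ k" and M: "j + k \<le> M"
  shows "(\<Sum>h<b ^ M. block_dev b k v j h) = 0"
proof -
  obtain e where e: "M = j + (k + e)" using M by (metis le_iff_add add.assoc)
  have zero: "(\<Sum>h<b ^ k. (if h = v then 1 else 0) - 1 / real b ^ k) = 0"
    using v b by (simp add: sum_subtractf)
  have "(\<Sum>h<b ^ k * b ^ e. block_dev b k v 0 h)
      = (\<Sum>h<b ^ k * b ^ e. ((if h mod b ^ k = v then 1 else 0) - 1 / real b ^ k) * 1)"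
    by (simp add: block_dev_def)
  also have "\<dots> = (\<Sum>h<b ^ k. (if h = v then 1 else 0) - 1 / real b ^ k) * (\<Sum>h<b ^ e. 1)"
    using b by (intro sum_mod_div_product) auto
  finally have inner: "(\<Sum>h<b ^ (k + e). block_dev b k v 0 h) = 0"
    by (simp only: zero power_add mult_zero_left)
  have "(\<Sum>h<b ^ M. block_dev b k v j h) = (\<Sum>h<b ^ j * b ^ (k + e). 1 * block_dev b k v 0 (h div b ^ j))"
    by (simp add: block_dev_def e power_add)
  also have "\<dots> = (\<Sum>h<b ^ j. 1) * (\<Sum>h<b ^ (k + e). block_dev b k v 0 h)"
    using b by (intro sum_mod_div_product[where \<phi> = "\<lambda>_. 1"]) auto
  finally show ?thesis by (simp only: inner mult_zero_right)
qed

text \<open>Disjoint windows are uncorrelated: cutting h at position i puts the lower window into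
  the remainder and the upper one into the quotient, and the factor of the lower one
  vanishes.\<close>

lemma sum_block_dev_product_eq_0:
  assumes b: "b \<ge> 1" and v: "v < b ^ k" and ji: "j + k \<le> i" and M: "i + k \<le> M"
  shows "(\<Sum>h<b ^ M. block_dev b k v j h * block_dev b k v i h) = 0"
proof -
  obtain e where e: "M = i + e" using M by (metis le_iff_add add.assoc)
  have "(\<Sum>h<b ^ M. block_dev b k v j h * block_dev b k v i h)
      = (\<Sum>h<b ^ i * b ^ e. block_dev b k v j (h mod b ^ i) * block_dev b k v 0 (h div b ^ i))"
    unfolding block_dev_mod[OF b ji] by (simp add: e power_add block_dev_def)
  also have "\<dots> = (\<Sum>h<b ^ i. block_dev b k v j h) * (\<Sum>h<b ^ e. block_dev b k v 0 h)"
    using b by (intro sum_mod_div_product) auto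
  finally show ?thesis by (simp only: sum_block_dev_eq_0[OF b v ji] mult_zero_left)
qed

text \<open>Actual minus expected number of occurrences at the starting positions below J, as
  \<open>card_matches\<close> shows. The windows reach up to position J + k - 1, hence the period b
  ^ (J + k).\<close>

definition total_dev :: "nat \<Rightarrow> nat \<Rightarrow> nat \<Rightarrow> nat \<Rightarrow> nat \<Rightarrow> real" where
  "total_dev b k v J t = (\<Sum>j<J. block_dev b k v j t)"

lemma abs_total_dev_le:
  assumes "b \<ge> 1"
  shows "\<bar>total_dev b k v J t\<bar> \<le> real J"
proof -
  have "\<bar>total_dev b k v J t\<bar> \<le> (\<Sum>j<J. \<bar>block_dev b k v j t\<bar>)"
    unfolding total_dev_def by (rule sum_abs)
  also have "\<dots> \<le> (\<Sum>j<J. 1)" by (intro sum_mono abs_block_dev_le assms)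
  finally show ?thesis by simp
qed

lemma total_dev_periodic: "b \<ge> 1 \<Longrightarrow> total_dev b k v J (t + b ^ (J + k)) = total_dev b k v J t"
  unfolding total_dev_def by (intro sum.cong block_dev_periodic) auto

text \<open>Expanding the square, only pairs of overlapping windows survive; each j has fewer than
  2k partners i when k > 0, and each product is at most 1. The bound is linear in J, so relative
  deviations are small for large J.\<close>

lemma sum_total_dev_square_le:
  assumes b: "b \<ge> 1" and v: "v < b ^ k"
  shows "(\<Sum>h<b ^ (J + k). (total_dev b k v J h)\<^sup>2) \<le> 2 * real k * real J * real (b ^ (J + k))"
proof -
  let ?D = "block_dev b k v" and ?N = "b ^ (J + k)"
  have "(\<Sum>h<?N. (total_dev b k v J h)\<^sup>2) = (\<Sum>h<?N. \<Sum>j<J. \<Sum>i<J. ?D j h * ?D i h)"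
    unfolding total_dev_def power2_eq_square sum_product ..
  also have "\<dots> = (\<Sum>j<J. \<Sum>i<J. \<Sum>h<?N. ?D j h * ?D i h)"
    by (subst sum.swap, rule sum.cong[OF refl], rule sum.swap)
  also have "\<dots> \<le> (\<Sum>j<J. \<Sum>i<J. if i \<in> {j + 1 - k..<j + k} then real ?N else 0)"
  proof (intro sum_mono)
    fix j i assume ji: "j \<in> {..<J}" "i \<in> {..<J}"
    show "(\<Sum>h<?N. ?D j h * ?D i h) \<le> (if i \<in> {j + 1 - k..<j + k} then real ?N else 0)"
    proof (cases "i \<in> {j + 1 - k..<j + k}")
      case True
      have "?D j h * ?D i h \<le> 1" for h
      proof -
        have "\<bar>?D j h\<bar> * \<bar>?D i h\<bar> \<le> 1 * 1" by (intro mult_mono abs_block_dev_le b) auto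
        then show ?thesis by (simp flip: abs_mult)
      qed
      then have "(\<Sum>h<?N. ?D j h * ?D i h) \<le> (\<Sum>h<?N. 1)" by (intro sum_mono)
      then show ?thesis using True by simp
    next
      case False
      then consider "j + k \<le> i" | "i + k \<le> j" by force
      then have "(\<Sum>h<?N. ?D j h * ?D i h) = 0"
      proof cases
        case 1
        then show ?thesis using ji by (intro sum_block_dev_product_eq_0 b v) auto
      next
        case 2
        then have "(\<Sum>h<?N. ?D i h * ?D j h) = 0"
          using ji by (intro sum_block_dev_product_eq_0 b v) auto
        then show ?thesis by (simp add: mult.commute)
      qed
      then show ?thesis using False by simp
    qed
  qed
  also have "\<dots> \<le> (\<Sum>j<J. real (2 * k) * real ?N)"
  proof (rule sum_mono)
    fix j
    have "(\<Sum>i<J. if i \<in> {j + 1 - k..<j + k} then real ?N else 0)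
        = (\<Sum>i\<in>{i \<in> {..<J}. i \<in> {j + 1 - k..<j + k}}. real ?N)"
      by (rule sum.inter_filter[symmetric]) simp
    also have "\<dots> = real (card {i \<in> {..<J}. i \<in> {j + 1 - k..<j + k}}) * real ?N" by simp
    also have "card {i \<in> {..<J}. i \<in> {j + 1 - k..<j + k}} \<le> card {j + 1 - k..<j + k}"
      by (intro card_mono) auto
    also have "card {j + 1 - k..<j + k} \<le> 2 * k" by simp
    finally show "(\<Sum>i<J. if i \<in> {j + 1 - k..<j + k} then real ?N else 0) \<le> real (2 * k) * real ?N"
      by (simp add: mult_right_mono)
  qed
  finally show ?thesis by (simp add: mult_ac)
qed

text \<open>
  The cutoff \<open>z\<close> is about \<open>exp (sqrt (ln x))\<close>: small enough for the truncation error, yet with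
  \<open>log log z\<close> of the order of \<open>log log x\<close>.
\<close>

lemma eventually_prime_cutoff:
  "\<exists>x0. \<forall>x\<ge>x0. \<exists>z. (1 + ln (real z)) * prime_recip_sum z \<le> harm x \<and> prime_recip_sum z \<ge> 1
      \<and> prime_recip_sum z \<ge> ln (ln (real x)) / 9"
proof -
  have "eventually (\<lambda>x::real. sqrt (ln x) - 2 \<ge> ln x powr (1/4)) at_top" by real_asymp
  moreover have "eventually (\<lambda>x::real. ln (ln x) \<ge> 9) at_top" by real_asymp
  moreover have "eventually (\<lambda>x::real. sqrt (ln x) \<ge> 4) at_top" by real_asymp
  moreover have "eventually (\<lambda>x::real. exp (sqrt (ln x) - 1) - 1 \<ge> exp (sqrt (ln x) - 2)) at_top"
    by real_asymp
  moreover have "eventually (\<lambda>x::real. x \<ge> exp 1) at_top" by real_asymp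
  ultimately have "eventually (\<lambda>x. sqrt (ln x) - 2 \<ge> ln x powr (1/4) \<and> ln (ln x) \<ge> 9 \<and> sqrt (ln x) \<ge> 4
      \<and> exp (sqrt (ln x) - 1) - 1 \<ge> exp (sqrt (ln x) - 2) \<and> x \<ge> exp 1) at_top"
    by eventually_elim auto
  from filterlim_real_sequentially[unfolded filterlim_iff, rule_format, OF this]
  obtain x0 where x0: "\<And>x. x \<ge> x0 \<Longrightarrow> sqrt (ln (real x)) - 2 \<ge> ln (real x) powr (1/4)
      \<and> ln (ln (real x)) \<ge> 9 \<and> sqrt (ln (real x)) \<ge> 4
      \<and> exp (sqrt (ln (real x)) - 1) - 1 \<ge> exp (sqrt (ln (real x)) - 2) \<and> real x \<ge> exp 1"
    unfolding eventually_sequentially by blast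
  show ?thesis
  proof (rule exI[of _ x0], intro allI impI)
    fix x assume "x \<ge> x0"
    note x = x0[OF this]
    define s where "s = sqrt (ln (real x))"
    \<comment> \<open>Both 1 + ln z and \<open>prime_recip_sum z\<close> are then at most s, the
      latter through the harmonic sum, so their product is at most s^2 = ln x.\<close>
    define z where "z = nat \<lfloor>exp (s - 1)\<rfloor>"
    have s4: "s \<ge> 4" using x by (simp add: s_def)
    have xpos: "real x \<ge> 1" using x by (smt (verit) exp_ge_add_one_self)
    have lnx: "ln (real x) = s * s" using xpos by (simp add: s_def)
    have zle: "real z \<le> exp (s - 1)" unfolding z_def by simp
    have zge: "real z \<ge> exp (s - 1) - 1" unfolding z_def by linarith
    then have zge': "real z \<ge> exp (s - 2)" using x by (simp add: s_def)
    moreover have "exp (s - 2) \<ge> 1 + (s - 2)" by (rule exp_ge_add_one_self)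
    ultimately have z2: "z \<ge> 2" using s4 by linarith
    have "ln (real z) \<le> ln (exp (s - 1))" using zle z2 by (intro ln_mono) auto
    then have lnz: "1 + ln (real z) \<le> s" by simp
    have "ln (exp (s - 2)) \<le> ln (real z)" using zge' by (intro ln_mono) auto
    then have "ln (real z) \<ge> ln (real x) powr (1/4)" using x by (simp add: s_def)
    then have "ln (ln (real x) powr (1/4)) \<le> ln (ln (real z))"
      using s4 lnx by (intro ln_mono) auto
    then have "ln (ln (real x)) / 4 \<le> ln (ln (real z))" by (simp add: ln_powr)
    \<comment> \<open>The available factor is 1/8 = 1/9 + 1/72. It is weakened to 1/9, whose square
      root 1/3 is taken in \<open>average_total_dev_square\<close>.\<close>
    then have big: "ln (ln (real x)) / 9 + ln (ln (real x)) / 72 \<le> prime_recip_sum z"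
      using prime_recip_sum_ge[OF z2] by linarith
    have "prime_recip_sum z \<le> (\<Sum>n=1..z. 1 / real n)"
      unfolding prime_recip_sum_def
      by (intro sum_mono2) (auto simp: primes_upto_def dest: prime_ge_1_nat)
    also have "\<dots> = harm z" by (simp add: harm_def inverse_eq_divide)
    also have "\<dots> \<le> 1 + ln (real z)" using z2 by (intro harm_le_ln) auto
    finally have Ls: "prime_recip_sum z \<le> s" using lnz by linarith
    have L1: "prime_recip_sum z \<ge> 1" "prime_recip_sum z \<ge> ln (ln (real x)) / 9"
      using x big by linarith+
    have "(1 + ln (real z)) * prime_recip_sum z \<le> s * s"
      using lnz Ls L1 s4 by (intro mult_mono) auto
    also have "\<dots> \<le> ln (real x + 1)" unfolding lnx[symmetric] using xpos by (intro ln_mono) auto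
    also have "\<dots> \<le> harm x" by (rule ln_le_harm)
    finally show "\<exists>z. (1 + ln (real z)) * prime_recip_sum z \<le> harm x \<and> prime_recip_sum z \<ge> 1
      \<and> prime_recip_sum z \<ge> ln (ln (real x)) / 9"
      using L1 by blast
  qed
qed

section \<open>Law of large numbers for the digits of f n\<close>

context prime_step
begin

text \<open>The squared relative deviation has mean at most 2k/J over a period, which a large
  \<open>J0\<close> makes small. The shift error is of order b ^ (J + k) / sqrt (log log x), which T
  makes small. The bound on b ^ (J + T) has the form that \<open>power_trunc_len_le\<close> provides
  for a block of length J + T.\<close>

lemma average_total_dev_square:
  assumes b2: "b \<ge> 2" and v: "v < b ^ k" and \<delta>: "\<delta> > 0"
  obtains J0 T x0 where
    "\<And>x J. x \<ge> x0 \<Longrightarrow> J \<ge> J0 \<Longrightarrow> real b ^ (J + T) \<le> real b * sqrt (ln (ln (real x)))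
      \<Longrightarrow> (\<Sum>n=1..x. (total_dev b k v J (f n))\<^sup>2) \<le> \<delta> * real x * (real J)\<^sup>2"
proof -
  have b: "b \<ge> 1" using b2 by simp
  obtain C where C: "C \<ge> 0" "\<And>A. finite A \<Longrightarrow> (\<Sum>n\<in>A. ln (real n) / (real n)\<^sup>2) \<le> C"
    using sum_ln_over_squares_bounded by blast
  obtain x1 where x1: "\<And>x. x \<ge> x1 \<Longrightarrow> \<exists>z. (1 + ln (real z)) * prime_recip_sum z \<le> harm x
      \<and> prime_recip_sum z \<ge> 1 \<and> prime_recip_sum z \<ge> ln (ln (real x)) / 9"
    using eventually_prime_cutoff by blast
  \<comment> \<open>Four shares: one for the exceptional n (2/T'), two for the logarithmic average,
    one for the term with C.\<close>
  define \<eta> where "\<eta> = \<delta> / 4"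
  have \<eta>: "\<eta> > 0" using \<delta> by (simp add: \<eta>_def)
  define T' where "T' = nat \<lceil>2 / \<eta>\<rceil> + 1"
  define J0 where "J0 = nat \<lceil>16 * real k / \<eta>\<rceil> + 1"
  \<comment> \<open>The shift error is 12 b ^ (J + k) / sqrt (log log x) and has to be at most
    \<eta>/8, whence 96; the additional factor b in b ^ (k + 1) cancels the one in the hypothesis on
    J + T.\<close>
  obtain T where T: "96 * real b ^ (k + 1) / \<eta> < 2 ^ T"
    using real_arch_pow[of 2 "96 * real b ^ (k + 1) / \<eta>"] by auto
  have "eventually (\<lambda>x::real. 6 * ln (real T') \<le> ln x \<and> 2 * C / ln x \<le> \<eta> \<and> ln x \<ge> 1 \<and> ln (ln x) > 0) at_top"
  proof (intro eventually_conj)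
    show "eventually (\<lambda>x::real. 6 * ln (real T') \<le> ln x) at_top"
      using ln_at_top by (simp add: filterlim_at_top)
    show "eventually (\<lambda>x::real. 2 * C / ln x \<le> \<eta>) at_top"
    proof -
      have "((\<lambda>x::real. 2 * C / ln x) \<longlongrightarrow> 0) at_top" by real_asymp
      then have "eventually (\<lambda>x::real. 2 * C / ln x < \<eta>) at_top" using \<eta> by (rule order_tendstoD)
      then show ?thesis by eventually_elim simp
    qed
    show "eventually (\<lambda>x::real. ln x \<ge> 1) at_top" by real_asymp
    show "eventually (\<lambda>x::real. ln (ln x) > 0) at_top" by real_asymp
  qed
  from filterlim_real_sequentially[unfolded filterlim_iff, rule_format, OF this]
  obtain x2 where x2: "\<And>x. x \<ge> x2 \<Longrightarrow> 6 * ln (real T') \<le> ln (real x) \<and> 2 * C / ln (real x) \<le> \<eta>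
      \<and> ln (real x) \<ge> 1 \<and> ln (ln (real x)) > 0"
    unfolding eventually_sequentially by blast
  show thesis
  proof (rule that[of "max 2 (max x1 x2)" J0 T])
    fix x J
    assume x: "x \<ge> max 2 (max x1 x2)" and J: "J \<ge> J0"
      and JT: "real b ^ (J + T) \<le> real b * sqrt (ln (ln (real x)))"
    have J1: "real J > 0" using J by (simp add: J0_def)
    define G where "G t = (total_dev b k v J t / real J)\<^sup>2" for t
    have G: "0 \<le> G t" "G t \<le> 1" for t
    proof -
      have "\<bar>total_dev b k v J t / real J\<bar> \<le> 1"
        using abs_total_dev_le[OF b, of k v J t] J1 by simp
      then show "G t \<le> 1" unfolding G_def by (simp add: abs_square_le_1)
    qed (simp add: G_def)
    obtain z where z: "(1 + ln (real z)) * prime_recip_sum z \<le> harm x"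
      "prime_recip_sum z \<ge> 1" "prime_recip_sum z \<ge> ln (ln (real x)) / 9"
      using x1[of x] x by auto
    have x': "6 * ln (real T') \<le> ln (real x)" "2 * C / ln (real x) \<le> \<eta>" "ln (real x) \<ge> 1"
      "ln (ln (real x)) > 0"
      using x2[of x] x by auto
    define Q where "Q = b ^ (J + k)"
    define S where "S = (\<Sum>m=1..x. G (Suc (f m)) / real m)"
    have Q0: "Q > 0" using b by (simp add: Q_def)
    have "S \<le> harm x * ((\<Sum>h<Q. G h) / real Q + 4 * real Q / sqrt (prime_recip_sum z))"
      unfolding S_def prime_recip_sum_def
    proof (rule log_average_periodic[where z = z])
      show "1 \<le> (\<Sum>p\<in>primes_upto z. 1 / real p)"
        "(1 + ln (real z)) * (\<Sum>p\<in>primes_upto z. 1 / real p) \<le> harm x"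
        using z unfolding prime_recip_sum_def by auto
      show "G (t + Q) = G t" for t
        unfolding G_def Q_def total_dev_periodic[OF b] ..
    qed (use x G Q0 in \<open>auto simp: primes_upto_def\<close>)
    also have "\<dots> \<le> (2 * ln (real x)) * (2 * real k / real J + \<eta> / 8)"
    proof (intro mult_mono add_mono)
      have "harm x \<le> 1 + ln (real x)" using x by (intro harm_le_ln) auto
      then show "harm x \<le> 2 * ln (real x)" using x' by linarith
      have "(\<Sum>h<Q. G h) = (\<Sum>h<Q. (total_dev b k v J h)\<^sup>2) / (real J)\<^sup>2"
        by (simp add: G_def power_divide sum_divide_distrib)
      also have "\<dots> \<le> (2 * real k * real J * real Q) / (real J)\<^sup>2"
        using sum_total_dev_square_le[OF b v, of J] unfolding Q_def by (intro divide_right_mono) auto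
      also have "\<dots> = 2 * real k / real J * real Q"
        using J1 by (simp add: power2_eq_square)
      finally show "(\<Sum>h<Q. G h) / real Q \<le> 2 * real k / real J"
        using Q0 by (simp add: pos_divide_le_eq)
      have "sqrt (ln (ln (real x)) / 9) \<le> sqrt (prime_recip_sum z)" using z by simp
      then have sq: "sqrt (ln (ln (real x))) / 3 \<le> sqrt (prime_recip_sum z)"
        by (simp add: real_sqrt_divide)
      have s0: "sqrt (ln (ln (real x))) > 0" using x' by simp
      have "4 * real Q / sqrt (prime_recip_sum z) \<le> 4 * real Q / (sqrt (ln (ln (real x))) / 3)"
        using sq s0 z(2) by (intro divide_left_mono mult_pos_pos) auto
      also have "\<dots> = 12 * real Q / sqrt (ln (ln (real x)))" by simp
      also have "\<dots> \<le> \<eta> / 8"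
      proof -
        have "96 * real b ^ (k + 1) \<le> \<eta> * real b ^ T"
        proof -
          have "(2::real) ^ T \<le> real b ^ T" using b2 by (intro power_mono) auto
          with T have "96 * real b ^ (k + 1) / \<eta> \<le> real b ^ T" by linarith
          then show ?thesis using \<eta> by (simp add: field_simps)
        qed
        then have "96 * real b ^ (k + 1) * real b ^ J \<le> \<eta> * real b ^ T * real b ^ J"
          by (intro mult_right_mono) auto
        also have "\<dots> = \<eta> * real b ^ (J + T)" by (simp add: power_add)
        also have "\<dots> \<le> \<eta> * (real b * sqrt (ln (ln (real x))))"
          using JT \<eta> by (intro mult_left_mono) auto
        finally have "real b * (96 * real Q) \<le> real b * (\<eta> * sqrt (ln (ln (real x))))"
          by (simp add: Q_def power_add mult_ac)
        then have "96 * real Q \<le> \<eta> * sqrt (ln (ln (real x)))" using b by simp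
        then show ?thesis using s0 by (simp add: field_simps)
      qed
      finally show "4 * real Q / sqrt (prime_recip_sum z) \<le> \<eta> / 8" .
    qed (use G x' z(2) in \<open>auto intro!: add_nonneg_nonneg divide_nonneg_nonneg sum_nonneg\<close>)
    also have "\<dots> \<le> (2 * ln (real x)) * (\<eta> / 8 + \<eta> / 8)"
    proof (intro mult_left_mono add_mono)
      have "16 * real k / \<eta> \<le> real J" using J unfolding J0_def by linarith
      then show "2 * real k / real J \<le> \<eta> / 8" using \<eta> J1 by (simp add: field_simps)
    qed (use x' in auto)
    finally have "S \<le> \<eta> / 2 * ln (real x)" by (simp add: mult_ac)
    then have S: "4 * S / ln (real x) \<le> 2 * \<eta>" using x' by (simp add: field_simps)
    have T'0: "T' > 0" by (simp add: T'_def)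
    have "2 / \<eta> \<le> real T'" unfolding T'_def by linarith
    then have T'\<eta>: "2 / real T' \<le> \<eta>" using \<eta> T'0 by (simp add: field_simps)
    have "(\<Sum>n=1..x. G (f n)) \<le> real x * (2 / real T' + (4 * S + 2 * C) / ln (real x))"
      unfolding S_def using x x' by (intro natural_average_le_log_average G C T'0) auto
    also have "\<dots> \<le> real x * (\<eta> + (2 * \<eta> + \<eta>))"
      unfolding add_divide_distrib using T'\<eta> S x' by (intro mult_left_mono add_mono) auto
    also have "\<dots> = \<delta> * real x" by (simp add: \<eta>_def)
    finally have "(\<Sum>n=1..x. G (f n)) \<le> \<delta> * real x" .
    then have "(\<Sum>n=1..x. (total_dev b k v J (f n))\<^sup>2) / (real J)\<^sup>2 \<le> \<delta> * real x"
      by (simp add: G_def power_divide sum_divide_distrib)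
    then show "(\<Sum>n=1..x. (total_dev b k v J (f n))\<^sup>2) \<le> \<delta> * real x * (real J)\<^sup>2"
      using J1 by (simp add: pos_divide_le_eq)
  qed
qed

text \<open>First moment from the second: \<bar>u\<bar> \<le> (u^2/c + c)/2 with c = \<epsilon> J,
  so the previous lemma is applied with \<epsilon>^2.\<close>

lemma average_abs_total_dev:
  assumes b: "b \<ge> 2" and v: "v < b ^ k" and \<epsilon>: "\<epsilon> > 0"
  obtains J0 T x0 where
    "\<And>x J. x \<ge> x0 \<Longrightarrow> J \<ge> J0 \<Longrightarrow> real b ^ (J + T) \<le> real b * sqrt (ln (ln (real x)))
      \<Longrightarrow> (\<Sum>n=1..x. \<bar>total_dev b k v J (f n)\<bar>) \<le> \<epsilon> * real x * real J"
proof -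
  obtain J0 T x0 where *: "\<And>x J. x \<ge> x0 \<Longrightarrow> J \<ge> J0 \<Longrightarrow> real b ^ (J + T) \<le> real b * sqrt (ln (ln (real x)))
      \<Longrightarrow> (\<Sum>n=1..x. (total_dev b k v J (f n))\<^sup>2) \<le> \<epsilon>\<^sup>2 * real x * (real J)\<^sup>2"
    using average_total_dev_square[of b v k "\<epsilon>\<^sup>2"] assms by (metis zero_less_power)
  show thesis
  proof (rule that[of x0 "max 1 J0" T])
    fix x J assume x: "x \<ge> x0" and J: "J \<ge> max 1 J0" and JT: "real b ^ (J + T) \<le> real b * sqrt (ln (ln (real x)))"
    define c where "c = \<epsilon> * real J"
    have c: "c > 0" using \<epsilon> J by (simp add: c_def)
    have "(\<Sum>n=1..x. \<bar>total_dev b k v J (f n)\<bar>) \<le> (\<Sum>n=1..x. ((total_dev b k v J (f n))\<^sup>2 / c + c) / 2)"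
    proof (rule sum_mono)
      fix n
      have "0 \<le> (\<bar>total_dev b k v J (f n)\<bar> - c)\<^sup>2" by simp
      also have "\<dots> = (total_dev b k v J (f n))\<^sup>2 + c * c - 2 * c * \<bar>total_dev b k v J (f n)\<bar>"
        by (simp add: power2_eq_square algebra_simps)
      finally show "\<bar>total_dev b k v J (f n)\<bar> \<le> ((total_dev b k v J (f n))\<^sup>2 / c + c) / 2"
        using c by (simp add: divide_simps algebra_simps)
    qed
    also have "\<dots> = ((\<Sum>n=1..x. (total_dev b k v J (f n))\<^sup>2) / c + c * real x) / 2"
      by (simp add: sum.distrib sum_divide_distrib add_divide_distrib)
    also have "\<dots> \<le> ((c\<^sup>2 * real x) / c + c * real x) / 2"
      using *[OF x _ JT] J c by (intro divide_right_mono add_right_mono) (auto simp: c_def power2_eq_square mult_ac)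
    also have "\<dots> = \<epsilon> * real x * real J"
      using c by (simp add: power2_eq_square) (simp add: c_def)
    finally show "(\<Sum>n=1..x. \<bar>total_dev b k v J (f n)\<bar>) \<le> \<epsilon> * real x * real J" .
  qed
qed

end

section \<open>Normality and digit counts\<close>

lemma summable_digit_series:
  fixes d :: "nat \<Rightarrow> nat"
  assumes b: "b \<ge> 2" and d: "\<And>j. d j < b"
  shows "summable (\<lambda>j. real (d j) / real b ^ Suc j)"
proof (rule summable_comparison_test')
  have "summable (\<lambda>j. (1 / real b) ^ j)" using b by (intro summable_geometric) auto
  then show "summable (\<lambda>j. 1 / real b ^ j)" by (simp add: power_one_over)
  show "norm (real (d j) / real b ^ Suc j) \<le> 1 / real b ^ j" for j
  proof -
    have "real (d j) \<le> real b" using d[of j] by simp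
    then have "real (d j) / real b ^ Suc j \<le> real b / real b ^ Suc j"
      by (intro divide_right_mono) auto
    also have "\<dots> = 1 / real b ^ j" using b by simp
    finally show ?thesis by simp
  qed
qed

lemma digit_series_bounds:
  fixes d :: "nat \<Rightarrow> nat"
  assumes b: "b \<ge> 2" and d: "\<And>j. d j < b" and nonmax: "d m < b - 1"
  shows "0 \<le> (\<Sum>j. real (d j) / real b ^ Suc j)" "(\<Sum>j. real (d j) / real b ^ Suc j) < 1"
proof -
  have summ: "summable (\<lambda>j. real (d j) / real b ^ Suc j)" by (rule summable_digit_series[OF b d])
  show "0 \<le> (\<Sum>j. real (d j) / real b ^ Suc j)" by (rule suminf_nonneg[OF summ]) auto
  have "(\<lambda>j. (1 / real b) ^ j) sums (1 / (1 - 1 / real b))" using b by (intro geometric_sums) auto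
  then have "(\<lambda>j. (real b - 1) / real b * (1 / real b) ^ j) sums ((real b - 1) / real b * (1 / (1 - 1 / real b)))"
    by (rule sums_mult)
  moreover have "(real b - 1) / real b * (1 / (1 - 1 / real b)) = 1" using b by (simp add: divide_simps)
  moreover have "(\<lambda>j. (real b - 1) / real b * (1 / real b) ^ j) = (\<lambda>j. (real b - 1) / real b ^ Suc j)"
    by (simp add: power_one_over)
  ultimately have geo: "(\<lambda>j. (real b - 1) / real b ^ Suc j) sums 1" by (simp only:)
  have "0 < (\<Sum>j. (real b - 1) / real b ^ Suc j - real (d j) / real b ^ Suc j)"
  proof (rule suminf_pos2[where i = m])
    show "summable (\<lambda>j. (real b - 1) / real b ^ Suc j - real (d j) / real b ^ Suc j)"
      using geo summ by (intro summable_diff) (auto simp: sums_iff)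
    show "0 \<le> (real b - 1) / real b ^ Suc j - real (d j) / real b ^ Suc j" for j
    proof -
      have "real (d j) \<le> real b - 1" using d[of j] b by linarith
      then show ?thesis by (simp add: divide_right_mono)
    qed
    have "real (d m) < real b - 1" using nonmax by linarith
    then show "0 < (real b - 1) / real b ^ Suc m - real (d m) / real b ^ Suc m"
      using b by (simp add: divide_strict_right_mono)
  qed
  also have "\<dots> = 1 - (\<Sum>j. real (d j) / real b ^ Suc j)"
    using geo summ by (subst suminf_diff[symmetric]) (auto simp: sums_iff)
  finally show "(\<Sum>j. real (d j) / real b ^ Suc j) < 1" by simp
qed

text \<open>Multiplication by b ^ n splits the series into the integer \<open>I n\<close> formed by
  the first n digits and the tail \<open>r n\<close>. Digits below b - 1 recur, so all tails lie in
  [0, 1) and the floor is exactly \<open>I n\<close>, whose last digit is wanted.\<close>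

lemma base_digit_digit_series:
  fixes d :: "nat \<Rightarrow> nat"
  assumes b: "b \<ge> 2" and d: "\<And>j. d j < b" and nonmax: "\<And>n. \<exists>m\<ge>n. d m < b - 1"
  shows "base_digit b (\<Sum>j. real (d j) / real b ^ Suc j) (Suc n) = d n"
proof -
  define r where "r n = (\<Sum>j. real (d (n + j)) / real b ^ Suc j)" for n
  define I where "I = rec_nat 0 (\<lambda>n v. b * v + d n)"
  have I: "I 0 = 0" "I (Suc n) = b * I n + d n" for n by (simp_all add: I_def)
  have r: "0 \<le> r n" "r n < 1" for n
  proof -
    obtain m where "m \<ge> n" "d m < b - 1" using nonmax by blast
    then have "d (n + (m - n)) < b - 1" by simp
    from digit_series_bounds[where d = "\<lambda>j. d (n + j)", OF b d this]
    show "0 \<le> r n" "r n < 1" by (simp_all add: r_def)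
  qed
  have r_step: "real b * r n = real (d n) + r (Suc n)" for n
  proof -
    have "summable (\<lambda>j. real (d (n + j)) / real b ^ Suc j)" by (rule summable_digit_series[OF b d])
    from suminf_split_head[OF this]
    have "(\<Sum>j. real (d (n + Suc j)) / real b ^ Suc (Suc j)) = r n - real (d n) / real b"
      by (simp add: r_def)
    moreover have "(\<Sum>j. real (d (n + Suc j)) / real b ^ Suc (Suc j)) = r (Suc n) / real b"
    proof -
      have "r (Suc n) / real b = (\<Sum>j. real (d (Suc n + j)) / real b ^ Suc j / real b)"
        unfolding r_def by (rule suminf_divide[symmetric], rule summable_digit_series[OF b d])
      then show ?thesis by (simp add: mult.commute)
    qed
    ultimately show ?thesis using b by (simp add: field_simps)
  qed
  have main: "real b ^ n * r 0 = real (I n) + r n" for n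
  proof (induction n)
    case (Suc n)
    have "real b ^ Suc n * r 0 = real b * (real b ^ n * r 0)" by simp
    also have "\<dots> = real b * real (I n) + real b * r n" by (simp add: Suc distrib_left)
    also have "\<dots> = real (I (Suc n)) + r (Suc n)" by (simp add: I r_step)
    finally show ?case .
  qed (simp add: I)
  have "frac (r 0) = r 0" using r[of 0] by (simp add: frac_eq)
  then have "base_digit b (r 0) (Suc n) = nat \<lfloor>real b ^ Suc n * r 0\<rfloor> mod b"
    by (simp add: base_digit_def)
  also have "\<lfloor>real b ^ Suc n * r 0\<rfloor> = int (I (Suc n))"
    unfolding main using r[of "Suc n"] by (simp add: floor_eq_iff)
  also have "nat (int (I (Suc n))) mod b = d n" using d[of n] unfolding nat_int by (simp add: I)
  finally show ?thesis by (simp add: r_def)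
qed

text \<open>Counts starting positions below N, from 0; a window may run past N. This makes the count
  additive over consecutive ranges of positions.\<close>

definition occurrences :: "(nat \<Rightarrow> nat) \<Rightarrow> nat list \<Rightarrow> nat \<Rightarrow> nat" where
  "occurrences d a N = card {j \<in> {..<N}. \<forall>i<length a. d (j + i) = a ! i}"

text \<open>For n = j + 1 the condition n \<le> x - k says j < N with N the floor of x - k. Since
  N/x tends to 1, the real limit and the limit along integers are equivalent; x = N + k gives one
  direction.\<close>

lemma normal_in_base_digits_iff:
  assumes dig: "\<And>n. base_digit b z (Suc n) = d n"
  shows "normal_in_base b z \<longleftrightarrow> (\<forall>a. a \<noteq> [] \<longrightarrow> set a \<subseteq> {..<b} \<longrightarrow>
    (\<lambda>N. real (occurrences d a N) / real N) \<longlonglongrightarrow> 1 / real b ^ length a)"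
proof -
  have count: "real (card {n :: nat. 1 \<le> n \<and> real n \<le> x - real k \<and>
      (\<forall>i \<in> {1..k}. base_digit b z (n - 1 + i) = a ! (i - 1))}) / x
      = real (occurrences d a (nat \<lfloor>x - real k\<rfloor>)) / x" if k: "length a = k" for x k and a :: "nat list"
  proof -
    have "{n :: nat. 1 \<le> n \<and> real n \<le> x - real k \<and>
        (\<forall>i \<in> {1..k}. base_digit b z (n - 1 + i) = a ! (i - 1))}
      = Suc ` {j \<in> {..<nat \<lfloor>x - real k\<rfloor>}. \<forall>i<length a. d (j + i) = a ! i}" (is "?A = Suc ` ?B")
    proof -
      have iff: "(\<forall>i \<in> {1..k}. base_digit b z (Suc j - 1 + i) = a ! (i - 1)) \<longleftrightarrow>
          (\<forall>i<length a. d (j + i) = a ! i)" for j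
      proof -
        have "{1..k} = Suc ` {..<k}" by (simp add: image_Suc_lessThan)
        then show ?thesis by (auto simp: dig k)
      qed
      have lt: "real (Suc j) \<le> x - real k \<longleftrightarrow> j < nat \<lfloor>x - real k\<rfloor>" for j by linarith
      have "n \<in> ?A \<longleftrightarrow> n \<in> Suc ` ?B" for n
      proof (cases n)
        case (Suc j)
        show ?thesis unfolding Suc using iff[of j] lt[of j] by (simp add: inj_image_mem_iff)
      qed auto
      then show ?thesis by blast
    qed
    then show ?thesis by (simp add: card_image occurrences_def)
  qed
  have equiv: "((\<lambda>x :: real. real (occurrences d a (nat \<lfloor>x - real k\<rfloor>)) / x) \<longlongrightarrow> c) at_top \<longleftrightarrow>
      (\<lambda>N. real (occurrences d a N) / real N) \<longlonglongrightarrow> c" for a k c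
  proof
    assume "((\<lambda>x :: real. real (occurrences d a (nat \<lfloor>x - real k\<rfloor>)) / x) \<longlongrightarrow> c) at_top"
    moreover have "filterlim (\<lambda>N. real N + real k) at_top sequentially" by real_asymp
    ultimately have "(\<lambda>N. real (occurrences d a (nat \<lfloor>real N + real k - real k\<rfloor>)) / (real N + real k)) \<longlonglongrightarrow> c"
      by (rule filterlim_compose)
    then have "(\<lambda>N. real (occurrences d a N) / (real N + real k)) \<longlonglongrightarrow> c" by simp
    moreover have "(\<lambda>N. (real N + real k) / real N) \<longlonglongrightarrow> 1" by real_asymp
    ultimately have "(\<lambda>N. real (occurrences d a N) / (real N + real k) * ((real N + real k) / real N)) \<longlonglongrightarrow> c * 1"
      by (rule tendsto_mult)
    then have "(\<lambda>N. real (occurrences d a N) / real N) \<longlonglongrightarrow> c * 1"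
    proof (rule Lim_transform_eventually)
      show "eventually (\<lambda>N. real (occurrences d a N) / (real N + real k) * ((real N + real k) / real N)
        = real (occurrences d a N) / real N) sequentially"
        using eventually_gt_at_top[of 0] by eventually_elim simp
    qed
    then show "(\<lambda>N. real (occurrences d a N) / real N) \<longlonglongrightarrow> c" by simp
  next
    assume lim: "(\<lambda>N. real (occurrences d a N) / real N) \<longlonglongrightarrow> c"
    have "filterlim (\<lambda>x::real. nat \<lfloor>x - real k\<rfloor>) at_top at_top"
    proof (rule filterlim_at_top[THEN iffD2], rule allI)
      fix Z
      show "eventually (\<lambda>x::real. Z \<le> nat \<lfloor>x - real k\<rfloor>) at_top"
        using eventually_ge_at_top[of "real Z + real k"] by eventually_elim linarith
    qed
    from filterlim_compose[OF lim this]
    have "((\<lambda>x. real (occurrences d a (nat \<lfloor>x - real k\<rfloor>)) / real (nat \<lfloor>x - real k\<rfloor>)) \<longlongrightarrow> c) at_top" .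
    moreover have "((\<lambda>x. real (nat \<lfloor>x - real k\<rfloor>) / x) \<longlongrightarrow> 1) at_top"
    proof (rule tendsto_sandwich)
      show "((\<lambda>x::real. (x - real k - 1) / x) \<longlongrightarrow> 1) at_top" by real_asymp
      show "((\<lambda>x::real. (x - real k) / x) \<longlongrightarrow> 1) at_top" by real_asymp
      show "eventually (\<lambda>x::real. (x - real k - 1) / x \<le> real (nat \<lfloor>x - real k\<rfloor>) / x) at_top"
        using eventually_gt_at_top[of 0] by eventually_elim (intro divide_right_mono; linarith)
      show "eventually (\<lambda>x::real. real (nat \<lfloor>x - real k\<rfloor>) / x \<le> (x - real k) / x) at_top"
        using eventually_gt_at_top[of 0] eventually_gt_at_top[of "real k"]
        by eventually_elim (intro divide_right_mono; linarith)
    qed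
    ultimately have "((\<lambda>x. real (occurrences d a (nat \<lfloor>x - real k\<rfloor>)) / real (nat \<lfloor>x - real k\<rfloor>)
        * (real (nat \<lfloor>x - real k\<rfloor>) / x)) \<longlongrightarrow> c * 1) at_top"
      by (rule tendsto_mult)
    then have "((\<lambda>x. real (occurrences d a (nat \<lfloor>x - real k\<rfloor>)) / x) \<longlongrightarrow> c * 1) at_top"
    proof (rule Lim_transform_eventually)
      show "eventually (\<lambda>x::real. real (occurrences d a (nat \<lfloor>x - real k\<rfloor>)) / real (nat \<lfloor>x - real k\<rfloor>)
        * (real (nat \<lfloor>x - real k\<rfloor>) / x) = real (occurrences d a (nat \<lfloor>x - real k\<rfloor>)) / x) at_top"
        using eventually_ge_at_top[of "real k + 1"]
      proof eventually_elim
        case (elim x)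
        then have "real (nat \<lfloor>x - real k\<rfloor>) \<noteq> 0" by linarith
        moreover have "A / m * (m / x) = A / x" if "m \<noteq> 0" for A m :: real
          using that by simp
        ultimately show ?case by blast
      qed
    qed
    then show "((\<lambda>x. real (occurrences d a (nat \<lfloor>x - real k\<rfloor>)) / x) \<longlongrightarrow> c) at_top" by simp
  qed
  show ?thesis
    unfolding normal_in_base_def
  proof (intro iffI allI impI)
    fix a :: "nat list"
    assume *: "\<forall>k\<ge>1. \<forall>a. length a = k \<longrightarrow> set a \<subseteq> {..<b} \<longrightarrow>
       ((\<lambda>x :: real. real (card {n :: nat. 1 \<le> n \<and> real n \<le> x - real k \<and>
              (\<forall>i \<in> {1..k}. base_digit b z (n - 1 + i) = a ! (i - 1))}) / x)
          \<longlongrightarrow> 1 / real b ^ k) at_top" and a: "a \<noteq> []" "set a \<subseteq> {..<b}"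
    have "length a \<ge> 1" using a by (simp add: Suc_le_eq)
    from *[rule_format, OF this refl a(2)]
    show "(\<lambda>N. real (occurrences d a N) / real N) \<longlonglongrightarrow> 1 / real b ^ length a"
      unfolding count[OF refl] equiv .
  next
    fix k :: nat and a :: "nat list"
    assume *: "\<forall>a. a \<noteq> [] \<longrightarrow> set a \<subseteq> {..<b} \<longrightarrow>
      (\<lambda>N. real (occurrences d a N) / real N) \<longlonglongrightarrow> 1 / real b ^ length a"
      and a: "1 \<le> k" "length a = k" "set a \<subseteq> {..<b}"
    have "a \<noteq> []" using a by auto
    from *[rule_format, OF this a(3)]
    show "((\<lambda>x :: real. real (card {n :: nat. 1 \<le> n \<and> real n \<le> x - real k \<and>
              (\<forall>i \<in> {1..k}. base_digit b z (n - 1 + i) = a ! (i - 1))}) / x)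
          \<longlongrightarrow> 1 / real b ^ k) at_top"
      unfolding count[OF a(2)] equiv a(2) .
  qed
qed

section \<open>Concatenated digit blocks\<close>

definition digits_value :: "nat \<Rightarrow> nat list \<Rightarrow> nat" where
  "digits_value b a = foldl (\<lambda>v c. b * v + c) 0 a"

lemma digits_value_less:
  assumes "set a \<subseteq> {..<b}"
  shows "digits_value b a < b ^ length a"
  using assms
proof (induction a rule: rev_induct)
  case (snoc c a)
  then have "Suc (digits_value b a) \<le> b ^ length a" "c < b" by auto
  then have "b * Suc (digits_value b a) \<le> b * b ^ length a" by (intro mult_left_mono) auto
  then show ?case using \<open>c < b\<close> by (simp add: digits_value_def)
qed (simp add: digits_value_def)

text \<open>Peeling off the last digit turns agreement in all digits into one residue condition, the
  form used in \<open>block_dev\<close>.\<close>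

lemma digits_eq_iff:
  assumes b: "b \<ge> 1" and "set a \<subseteq> {..<b}"
  shows "(\<forall>i<length a. (q div b ^ (length a - Suc i)) mod b = a ! i) \<longleftrightarrow> q mod b ^ length a = digits_value b a"
  using assms(2)
proof (induction a arbitrary: q rule: rev_induct)
  case (snoc c a)
  let ?l = "length a"
  have c: "c < b" using snoc.prems by simp
  have "(\<forall>i<Suc ?l. (q div b ^ (Suc ?l - Suc i)) mod b = (a @ [c]) ! i)
      \<longleftrightarrow> q mod b = c \<and> (\<forall>i<?l. (q div b ^ (Suc ?l - Suc i)) mod b = a ! i)"
    by (auto simp: less_Suc_eq nth_append)
  also have "(\<forall>i<?l. (q div b ^ (Suc ?l - Suc i)) mod b = a ! i)
      \<longleftrightarrow> (\<forall>i<?l. ((q div b) div b ^ (?l - Suc i)) mod b = a ! i)"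
  proof -
    have "q div b ^ (Suc ?l - Suc i) = (q div b) div b ^ (?l - Suc i)" if "i < ?l" for i
    proof -
      have "Suc ?l - Suc i = Suc (?l - Suc i)" using that by simp
      then show ?thesis by (simp add: div_mult2_eq)
    qed
    then show ?thesis by simp
  qed
  also have "\<dots> \<longleftrightarrow> (q div b) mod b ^ ?l = digits_value b a" using snoc by simp
  also have "(q mod b = c \<and> (q div b) mod b ^ ?l = digits_value b a)
      \<longleftrightarrow> q mod b ^ Suc ?l = digits_value b (a @ [c])"
  proof -
    have q: "q mod b ^ Suc ?l = b * ((q div b) mod b ^ ?l) + q mod b"
      by (simp add: mod_mult2_eq)
    have val: "digits_value b (a @ [c]) = b * digits_value b a + c" by (simp add: digits_value_def)
    show ?thesis
    proof
      assume "q mod b ^ Suc ?l = digits_value b (a @ [c])"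
      then have eq: "b * ((q div b) mod b ^ ?l) + q mod b = b * digits_value b a + c"
        unfolding q val .
      have "q mod b < b" using b by simp
      then show "q mod b = c \<and> (q div b) mod b ^ ?l = digits_value b a"
        using arg_cong[OF eq, of "\<lambda>n. n mod b"] arg_cong[OF eq, of "\<lambda>n. n div b"] b c by simp
    qed (simp only: q val)
  qed
  finally show ?case by simp
qed (simp add: digits_value_def)

locale digit_concat =
  fixes b :: nat and f K :: "nat \<Rightarrow> nat"
  assumes base: "b \<ge> 2" and len_pos: "\<And>n. K n \<ge> 1"
begin

definition blocks :: "nat \<Rightarrow> nat list" where
  "blocks n = trunc_digits b (real (f n)) (K n)"

definition digit :: "nat \<Rightarrow> nat" where
  "digit = concat_nth blocks"

text \<open>Blocks are numbered from 1 and positions from 0, so block \<open>Suc n\<close> begins at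
  position \<open>start n\<close>.\<close>

definition start :: "nat \<Rightarrow> nat" where
  "start n = (\<Sum>m=1..n. K m)"

lemma start_simps [simp]: "start 0 = 0" "start (Suc n) = start n + K (Suc n)"
  by (simp_all add: start_def)

lemma start_ge: "n \<le> start n"
proof (induction n)
  case (Suc n)
  then show ?case using len_pos[of "Suc n"] by simp
qed simp

lemma length_concat_blocks: "length (concat (map blocks [1..<Suc n])) = start n"
  by (induction n) (simp_all add: blocks_def)

lemma digit_block:
  assumes "i < K (Suc n)"
  shows "digit (start n + i) = (f (Suc n) div b ^ (K (Suc n) - Suc i)) mod b"
proof -
  let ?c = "concat (map blocks [1..<Suc (Suc n)])"
  have "digit (start n + i) = ?c ! (start n + i)"
    unfolding digit_def
  proof (rule concat_nth_correct[symmetric])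
    show "blocks m \<noteq> []" for m
      using len_pos[of m] by (simp add: blocks_def flip: length_0_conv)
    show "start n + i < length ?c" unfolding length_concat_blocks using assms by simp
  qed
  also have "?c = concat (map blocks [1..<Suc n]) @ blocks (Suc n)" by simp
  also have "\<dots> ! (start n + i) = blocks (Suc n) ! i"
    using length_concat_blocks[of n] by (metis nth_append_length_plus)
  also have "\<dots> = (f (Suc n) div b ^ (K (Suc n) - Suc i)) mod b"
    using assms by (simp add: blocks_def trunc_digits_def nth_upt del: upt_Suc)
  finally show ?thesis .
qed

lemma position_in_block: "\<exists>n i. j = start n + i \<and> i < K (Suc n)"
proof (induction j)
  case 0
  then show ?case using len_pos[of 1] by (intro exI[of _ 0]) auto
next
  case (Suc j)
  then obtain n i where j: "j = start n + i" "i < K (Suc n)" by blast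
  show ?case
  proof (cases "Suc i < K (Suc n)")
    case True
    then show ?thesis using j by (intro exI[of _ n] exI[of _ "Suc i"]) auto
  next
    case False
    then have "Suc j = start (Suc n) + 0" using j by simp
    then show ?thesis using len_pos[of "Suc (Suc n)"] by (intro exI[of _ "Suc n"] exI[of _ 0]) auto
  qed
qed

lemma digit_less: "digit j < b"
proof -
  obtain n i where "j = start n + i" "i < K (Suc n)" using position_in_block by blast
  then show ?thesis using digit_block base by simp
qed

text \<open>The reading direction is reversed: a window at offset i from the left of a block of
  length K has its last digit at position K - k - i from the right, where k is its length.\<close>

lemma digit_window:
  assumes i: "i + length a \<le> K (Suc n)" and a: "set a \<subseteq> {..<b}"
  shows "(\<forall>l<length a. digit (start n + i + l) = a ! l) \<longleftrightarrow>
    (f (Suc n) div b ^ (K (Suc n) - length a - i)) mod b ^ length a = digits_value b a"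
proof -
  let ?q = "f (Suc n) div b ^ (K (Suc n) - length a - i)"
  have "digit (start n + i + l) = (?q div b ^ (length a - Suc l)) mod b" if "l < length a" for l
  proof -
    have "digit (start n + (i + l)) = (f (Suc n) div b ^ (K (Suc n) - Suc (i + l))) mod b"
      using i that by (intro digit_block) auto
    also have "K (Suc n) - Suc (i + l) = (K (Suc n) - length a - i) + (length a - Suc l)"
      using i that by simp
    finally show ?thesis by (simp add: power_add div_mult2_eq add.assoc)
  qed
  then have "(\<forall>l<length a. digit (start n + i + l) = a ! l) \<longleftrightarrow>
      (\<forall>l<length a. (?q div b ^ (length a - Suc l)) mod b = a ! l)" by simp
  also have "\<dots> \<longleftrightarrow> ?q mod b ^ length a = digits_value b a"
    using base a by (intro digits_eq_iff) auto
  finally show ?thesis .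
qed

text \<open>Windows are assigned to the block in which they start, even if they run into the
  following ones.\<close>

definition block_occurrences :: "nat list \<Rightarrow> nat \<Rightarrow> nat" where
  "block_occurrences a n = card {i \<in> {..<K (Suc n)}. \<forall>l<length a. digit (start n + i + l) = a ! l}"

lemma occurrences_start: "occurrences digit a (start n) = (\<Sum>m<n. block_occurrences a m)"
proof (induction n)
  case (Suc n)
  let ?P = "\<lambda>j. \<forall>l<length a. digit (j + l) = a ! l"
  have "{j \<in> {..<start (Suc n)}. ?P j} = {j \<in> {..<start n}. ?P j} \<union>
      (\<lambda>i. start n + i) ` {i \<in> {..<K (Suc n)}. ?P (start n + i)}"
  proof (intro equalityI subsetI)
    fix j assume j: "j \<in> {j \<in> {..<start (Suc n)}. ?P j}"
    show "j \<in> {j \<in> {..<start n}. ?P j} \<union> (\<lambda>i. start n + i) ` {i \<in> {..<K (Suc n)}. ?P (start n + i)}"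
    proof (cases "j < start n")
      case False
      then have "j = start n + (j - start n)" "j - start n < K (Suc n)" using j by auto
      then show ?thesis using j by (intro UnI2 image_eqI[of _ _ "j - start n"]) auto
    qed (use j in auto)
  qed auto
  then have "occurrences digit a (start (Suc n)) = card {j \<in> {..<start n}. ?P j} +
      card ((\<lambda>i. start n + i) ` {i \<in> {..<K (Suc n)}. ?P (start n + i)})"
    unfolding occurrences_def by (subst card_Un_disjoint[symmetric]) auto
  also have "card ((\<lambda>i. start n + i) ` {i \<in> {..<K (Suc n)}. ?P (start n + i)}) = block_occurrences a n"
    unfolding block_occurrences_def by (subst card_image) auto
  finally show ?case using Suc by (simp add: occurrences_def)
qed (simp add: occurrences_def)

text \<open>Leading zeros count as digits, so for a string of zeros this set is infinite; it is
  always cut down to an initial segment.\<close>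

definition matches :: "nat list \<Rightarrow> nat \<Rightarrow> nat set" where
  "matches a t = {j. (t div b ^ j) mod b ^ length a = digits_value b a}"

text \<open>Windows inside the block correspond to matches under the reversal i to K - k - i. At
  most k starting positions have a window that crosses the end of the block.\<close>

lemma block_occurrences_window:
  assumes a: "a \<noteq> []" "set a \<subseteq> {..<b}"
  defines "k \<equiv> length a"
  shows "card (matches a (f (Suc n)) \<inter> {..<K (Suc n) + 1 - k}) \<le> block_occurrences a n"
    "block_occurrences a n \<le> card (matches a (f (Suc n)) \<inter> {..<K (Suc n) + 1 - k}) + k"
proof -
  let ?K = "K (Suc n)" and ?C = "matches a (f (Suc n))"
  let ?P = "\<lambda>i. \<forall>l<length a. digit (start n + i + l) = a ! l"
  have k: "k \<ge> 1" using a by (simp add: k_def Suc_le_eq)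
  define W where "W = {i. i + k \<le> ?K \<and> ?P i}"
  have W: "i \<in> W \<longleftrightarrow> i + k \<le> ?K \<and> ?K - k - i \<in> ?C" for i
    using digit_window[of i a n] a(2) unfolding W_def matches_def k_def by auto
  have finW: "finite W" by (rule finite_subset[of _ "{..?K}"]) (auto simp: W_def)
  have "bij_betw (\<lambda>i. ?K - k - i) W (?C \<inter> {..<?K + 1 - k})"
  proof (rule bij_betwI[where g = "\<lambda>j. ?K - k - j"])
    show "(\<lambda>i. ?K - k - i) \<in> W \<rightarrow> ?C \<inter> {..<?K + 1 - k}" by (auto simp: W)
    show "(\<lambda>j. ?K - k - j) \<in> ?C \<inter> {..<?K + 1 - k} \<rightarrow> W" by (auto simp: W)
  qed (auto simp: W)
  then have cW: "card W = card (?C \<inter> {..<?K + 1 - k})" by (rule bij_betw_same_card)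
  define B where "B = {i \<in> {..<?K}. ?P i}"
  have bo: "block_occurrences a n = card B" by (simp add: block_occurrences_def B_def)
  have "B \<subseteq> W \<union> {?K - k..<?K}" by (auto simp: B_def W_def)
  then have "card B \<le> card (W \<union> {?K - k..<?K})" using finW by (intro card_mono) auto
  also have "\<dots> \<le> card W + card {?K - k..<?K}" by (rule card_Un_le)
  also have "\<dots> \<le> card W + k" by simp
  finally show "block_occurrences a n \<le> card (?C \<inter> {..<?K + 1 - k}) + k" by (simp add: bo cW)
  have "W \<subseteq> B" using k by (auto simp: B_def W_def)
  then show "card (?C \<inter> {..<?K + 1 - k}) \<le> block_occurrences a n"
    unfolding bo cW[symmetric] by (intro card_mono) (auto simp: B_def)
qed

lemma card_matches:
  "real (card (matches a t \<inter> {..<J})) = total_dev b (length a) (digits_value b a) J t + real J / real b ^ length a"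
proof -
  have eq: "matches a t \<inter> {..<J} = {j \<in> {..<J}. (t div b ^ j) mod b ^ length a = digits_value b a}"
    by (auto simp: matches_def)
  have "real (card (matches a t \<inter> {..<J}))
      = (\<Sum>j<J. if (t div b ^ j) mod b ^ length a = digits_value b a then 1 else 0)"
    unfolding eq by (simp flip: sum.inter_filter)
  then show ?thesis by (simp add: total_dev_def block_dev_def sum_subtractf)
qed

lemma card_Int_lessThan_diff: "card (C \<inter> {..<M}) \<le> card (C \<inter> {..<J}) + (M - J)" for M J :: nat
proof -
  have "card (C \<inter> {..<M}) \<le> card (C \<inter> {..<J} \<union> {J..<M})" by (intro card_mono) auto
  also have "\<dots> \<le> card (C \<inter> {..<J}) + card {J..<M}" by (rule card_Un_le)
  finally show ?thesis by simp
qed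

text \<open>J is a common cutoff for blocks of different lengths, so that one periodic function can
  be averaged over all of them. Replacing the block length by J changes the count and the expected
  count by at most the difference.\<close>

lemma block_occurrences_dev:
  assumes a: "a \<noteq> []" "set a \<subseteq> {..<b}"
  defines "k \<equiv> length a" and "v \<equiv> digits_value b a"
  shows "\<bar>real (block_occurrences a n) - real (K (Suc n)) / real b ^ k\<bar>
    \<le> \<bar>total_dev b k v J (f (Suc n))\<bar> + 2 * real k + 2 * \<bar>real (K (Suc n)) - real J\<bar>"
proof -
  define C where "C = matches a (f (Suc n))"
  define M where "M = K (Suc n) + 1 - k"
  have k: "k \<ge> 1" using a by (simp add: k_def Suc_le_eq)
  have 1: "card (C \<inter> {..<M}) \<le> block_occurrences a n" "block_occurrences a n \<le> card (C \<inter> {..<M}) + k"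
    using block_occurrences_window[OF a, of n] by (simp_all add: C_def M_def k_def)
  have 2: "card (C \<inter> {..<M}) \<le> card (C \<inter> {..<J}) + (M - J)" "card (C \<inter> {..<J}) \<le> card (C \<inter> {..<M}) + (J - M)"
    by (rule card_Int_lessThan_diff)+
  have 3: "real (card (C \<inter> {..<J})) = total_dev b k v J (f (Suc n)) + real J / real b ^ k"
    unfolding C_def k_def v_def by (rule card_matches)
  have M: "M \<le> K (Suc n)" "K (Suc n) \<le> M + k" using k by (auto simp: M_def)
  have "\<bar>real (block_occurrences a n) - real (card (C \<inter> {..<J}))\<bar> \<le> \<bar>real (K (Suc n)) - real J\<bar> + 2 * real k"
    using 1 2 M by linarith
  moreover have "\<bar>real J / real b ^ k - real (K (Suc n)) / real b ^ k\<bar> \<le> \<bar>real (K (Suc n)) - real J\<bar>"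
  proof -
    have "\<bar>real J / real b ^ k - real (K (Suc n)) / real b ^ k\<bar> = \<bar>real (K (Suc n)) - real J\<bar> / real b ^ k"
      by (simp add: diff_divide_distrib[symmetric] abs_minus_commute)
    also have "\<dots> \<le> \<bar>real (K (Suc n)) - real J\<bar> / 1"
      using base by (intro divide_left_mono) auto
    finally show ?thesis by simp
  qed
  moreover have "\<bar>B - Q\<bar> \<le> \<bar>T\<bar> + 2 * c + 2 * w"
    if "\<bar>B - (T + P)\<bar> \<le> w + 2 * c" "\<bar>P - Q\<bar> \<le> w" for B Q T P c w :: real
    using that by linarith
  ultimately show ?thesis unfolding 3 by blast
qed

text \<open>Sums the block estimates; the unfinished block containing N costs at most its own
  length.\<close>

lemma occurrences_dev:
  assumes a: "a \<noteq> []" "set a \<subseteq> {..<b}" and N: "start n \<le> N" "N \<le> start (Suc n)"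
  defines "k \<equiv> length a" and "v \<equiv> digits_value b a"
  shows "\<bar>real (occurrences digit a N) - real N / real b ^ k\<bar> \<le> real (K (Suc n)) +
    (\<Sum>m=1..n. \<bar>total_dev b k v J (f m)\<bar> + 2 * real k + 2 * \<bar>real (K m) - real J\<bar>)"
proof -
  let ?occ = "occurrences digit a" and ?\<beta> = "1 / real b ^ k"
  have \<beta>: "0 \<le> ?\<beta>" "?\<beta> \<le> 1" using base by auto
  have "real (?occ (start n)) - real (start n) * ?\<beta>
      = (\<Sum>m<n. real (block_occurrences a m) - real (K (Suc m)) / real b ^ k)"
    unfolding occurrences_start
    by (induction n) (simp_all add: algebra_simps add_divide_distrib)
  also have "\<bar>\<dots>\<bar> \<le> (\<Sum>m<n. \<bar>real (block_occurrences a m) - real (K (Suc m)) / real b ^ k\<bar>)"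
    by (rule sum_abs)
  also have "\<dots> \<le> (\<Sum>m<n. \<bar>total_dev b k v J (f (Suc m))\<bar> + 2 * real k + 2 * \<bar>real (K (Suc m)) - real J\<bar>)"
    unfolding k_def v_def by (intro sum_mono block_occurrences_dev a)
  also have "\<dots> = (\<Sum>m=1..n. \<bar>total_dev b k v J (f m)\<bar> + 2 * real k + 2 * \<bar>real (K m) - real J\<bar>)"
    by (rule sum.reindex_bij_witness[where i = "\<lambda>m. m - 1" and j = Suc]) auto
  finally have 1: "\<bar>real (?occ (start n)) - real (start n) * ?\<beta>\<bar>
      \<le> (\<Sum>m=1..n. \<bar>total_dev b k v J (f m)\<bar> + 2 * real k + 2 * \<bar>real (K m) - real J\<bar>)" .
  have occ: "?occ M = card ({j. \<forall>i<length a. digit (j + i) = a ! i} \<inter> {..<M})" for M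
    unfolding occurrences_def by (rule arg_cong[where f = card]) auto
  have 2: "?occ N \<le> ?occ (start n) + (N - start n)" "?occ (start n) \<le> ?occ N + (start n - N)"
    unfolding occ by (rule card_Int_lessThan_diff)+
  have 3: "0 \<le> (real N - real (start n)) * ?\<beta>" "(real N - real (start n)) * ?\<beta> \<le> real N - real (start n)"
    using N \<beta> mult_left_mono[OF \<beta>(2), of "real N - real (start n)"] by auto
  have "\<bar>real (?occ N) - real N * ?\<beta>\<bar> \<le> \<bar>real (?occ (start n)) - real (start n) * ?\<beta>\<bar> + real (K (Suc n))"
  proof -
    have "real (?occ N) \<le> real (?occ (start n)) + (real N - real (start n))"
      "real (?occ (start n)) \<le> real (?occ N)" "real N \<le> real (start n) + real (K (Suc n))"
      using 2 N by simp_all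
    moreover have "\<bar>p - u\<bar> \<le> \<bar>q - w\<bar> + c"
      if "p \<le> q + (M - s)" "q \<le> p" "M \<le> s + c" "0 \<le> u - w" "u - w \<le> M - s" for p q u w M s c :: real
      using that by linarith
    ultimately show ?thesis using 3 unfolding left_diff_distrib by blast
  qed
  with 1 show ?thesis by simp
qed

end

section \<open>Normality up to one half\<close>

lemma trunc_len_mono:
  assumes b: "b \<ge> 2" and y: "y > 0" and mn: "m \<le> n"
  shows "trunc_len b y m \<le> trunc_len b y n"
proof (cases "m > exp (exp 1)")
  case True
  have lnm: "ln m > exp 1"
    using True by (metis exp_gt_zero less_trans ln_exp ln_less_cancel_iff)
  then have lnlnm: "ln (ln m) > 1"
    by (metis exp_gt_zero less_trans ln_exp ln_less_cancel_iff)
  have m0: "0 < m" using True exp_gt_zero less_trans by blast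
  have "ln m \<le> ln n" using mn m0 by (rule ln_mono)
  moreover have "0 < ln m" using lnm exp_gt_zero less_trans by blast
  ultimately have "ln (ln m) \<le> ln (ln n)" by (rule ln_mono)
  then have "ln (ln (ln m)) \<le> ln (ln (ln n))" by (rule ln_mono) (use lnlnm in simp)
  then have "y * (ln (ln (ln m)) / ln (real b)) \<le> y * (ln (ln (ln n)) / ln (real b))"
    using b y by (intro mult_left_mono divide_right_mono) auto
  then have "nat \<lceil>y * (ln (ln (ln m)) / ln (real b))\<rceil> \<le> nat \<lceil>y * (ln (ln (ln n)) / ln (real b))\<rceil>"
    by (intro nat_mono ceiling_mono)
  moreover have "n > exp (exp 1)" using True mn by linarith
  ultimately show ?thesis using True unfolding trunc_len_def by simp
next
  case False
  then have "trunc_len b y m = 1" unfolding trunc_len_def by simp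
  then show ?thesis using trunc_len_pos[OF b y, of n] by simp
qed

lemma trunc_len_bounds:
  assumes b: "b \<ge> 2" and y: "y > 0" and x: "x > exp (exp 1)"
  shows "y * (ln (ln (ln x)) / ln (real b)) \<le> real (trunc_len b y x)"
    "real (trunc_len b y x) \<le> y * (ln (ln (ln x)) / ln (real b)) + 1"
proof -
  have "trunc_len b y x = nat \<lceil>y * (ln (ln (ln x)) / ln (real b))\<rceil>"
    using x unfolding trunc_len_def by simp
  moreover have "trunc_len b y x \<ge> 1" by (rule trunc_len_pos[OF b y])
  ultimately show "y * (ln (ln (ln x)) / ln (real b)) \<le> real (trunc_len b y x)"
    "real (trunc_len b y x) \<le> y * (ln (ln (ln x)) / ln (real b)) + 1"
    by linarith+
qed

lemma trunc_len_at_top: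
  assumes b: "b \<ge> 2" and y: "y > 0"
  shows "filterlim (\<lambda>n. trunc_len b y (real n)) at_top sequentially"
proof -
  have pos: "y / ln (real b) > 0" using b y by simp
  have "filterlim (\<lambda>x::real. ln (ln (ln x))) at_top at_top" by real_asymp
  then have "filterlim (\<lambda>x::real. y / ln (real b) * ln (ln (ln x))) at_top at_top"
    by (rule filterlim_tendsto_pos_mult_at_top[OF tendsto_const pos])
  then have "filterlim (\<lambda>n. y / ln (real b) * ln (ln (ln (real n)))) at_top sequentially"
    using filterlim_real_sequentially by (rule filterlim_compose)
  then have "filterlim (\<lambda>n. real (trunc_len b y (real n))) at_top sequentially"
  proof (rule filterlim_at_top_mono)
    have "eventually (\<lambda>n. real n > exp (exp 1)) sequentially"
      using filterlim_real_sequentially unfolding filterlim_at_top_dense by blast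
    then show "eventually (\<lambda>n. y / ln (real b) * ln (ln (ln (real n))) \<le> real (trunc_len b y (real n))) sequentially"
    proof eventually_elim
      case (elim n)
      from trunc_len_bounds(1)[OF b y this] show ?case by simp
    qed
  qed
  then show ?thesis by (simp add: filterlim_sequentially_iff_filterlim_real)
qed

text \<open>This is where y \<le> 1/2 enters. The factor b pays for rounding the length up.\<close>

lemma power_trunc_len_le:
  assumes b: "b \<ge> 2" and y: "0 < y" "y \<le> 1 / 2"
  shows "eventually (\<lambda>n. real b ^ trunc_len b y (real n) \<le> real b * sqrt (ln (ln (real n)))) sequentially"
proof -
  have "eventually (\<lambda>x::real. x > exp (exp 1) \<and> ln (ln (ln x)) \<ge> 0 \<and> ln (ln x) > 0) at_top"
    by (intro eventually_conj; real_asymp)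
  from filterlim_real_sequentially[unfolded filterlim_iff, rule_format, OF this]
  show ?thesis
  proof eventually_elim
    case (elim n)
    have lnb: "ln (real b) > 0" using b by simp
    have "real (trunc_len b y (real n)) \<le> y * (ln (ln (ln (real n))) / ln (real b)) + 1"
      using elim by (intro trunc_len_bounds(2) b y) auto
    then have "real (trunc_len b y (real n)) * ln (real b) \<le> (y * (ln (ln (ln (real n))) / ln (real b)) + 1) * ln (real b)"
      using lnb by (intro mult_right_mono) auto
    also have "\<dots> = y * ln (ln (ln (real n))) + ln (real b)" using lnb by (simp add: field_simps)
    also have "\<dots> \<le> 1 / 2 * ln (ln (ln (real n))) + ln (real b)"
      using elim y by (intro add_right_mono mult_right_mono) auto
    also have "\<dots> = ln (real b * sqrt (ln (ln (real n))))"
      using elim b by (simp add: ln_mult ln_sqrt)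
    finally have "ln (real b ^ trunc_len b y (real n)) \<le> ln (real b * sqrt (ln (ln (real n))))"
      using b by (simp add: ln_realpow)
    then show ?case using b elim by (subst (asm) ln_le_cancel_iff) auto
  qed
qed

text \<open>Replacing n by its square root changes log log n only by ln 2, hence the triple
  logarithm by o(1). So all but about sqrt n of the first n blocks have nearly the same
  length.\<close>

lemma trunc_len_sqrt:
  assumes b: "b \<ge> 2" and y: "0 < y"
  shows "eventually (\<lambda>n. \<forall>m. n \<le> m * m \<longrightarrow> trunc_len b y (real n) \<le> trunc_len b y (real m) + 2) sequentially"
proof -
  \<comment> \<open>A change of c in the triple logarithm amounts to one digit of the block;
    rounding up costs the second digit.\<close>
  define c where "c = ln (real b) / y"
  have c: "c > 0" using b y by (simp add: c_def)
  have "((\<lambda>x::real. ln (ln (ln x)) - ln (ln (ln x) - ln 2)) \<longlongrightarrow> 0) at_top" by real_asymp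
  then have "eventually (\<lambda>x::real. ln (ln (ln x)) - ln (ln (ln x) - ln 2) < c) at_top"
    using c by (rule order_tendstoD)
  moreover have "eventually (\<lambda>x::real. x > exp (exp 1) ^ 2 \<and> ln (ln x) - ln 2 > 0 \<and> ln x > 0) at_top"
    by (intro eventually_conj; real_asymp)
  ultimately have "eventually (\<lambda>x::real. ln (ln (ln x)) - ln (ln (ln x) - ln 2) < c \<and>
      x > exp (exp 1) ^ 2 \<and> ln (ln x) - ln 2 > 0 \<and> ln x > 0) at_top"
    by eventually_elim auto
  from filterlim_real_sequentially[unfolded filterlim_iff, rule_format, OF this]
  show ?thesis
  proof eventually_elim
    case (elim n)
    show ?case
    proof (intro allI impI)
      fix m assume m: "n \<le> m * m"
      then have m': "real n \<le> real m ^ 2" unfolding power2_eq_square by (metis of_nat_le_iff of_nat_mult)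
      have "exp (exp 1) ^ 2 < real m ^ 2" using elim m' by linarith
      then have mee: "real m > exp (exp 1)" by (rule power_less_imp_less_base) simp
      then have m0: "real m > 0" using exp_gt_zero less_trans by blast
      have n0: "real n > 0" using elim by (metis exp_gt_zero less_trans zero_less_power)
      have nee: "real n > exp (exp 1)"
      proof -
        have "exp (exp 1) * 1 \<le> exp (exp 1) * exp (exp (1::real))"
          by (intro mult_left_mono) (auto intro: order_trans[OF _ exp_ge_add_one_self])
        moreover have "exp (exp 1) * exp (exp 1) < real n" using elim by (simp only: power2_eq_square)
        ultimately show ?thesis by linarith
      qed
      have "ln (real n) \<le> ln (real m ^ 2)" using m' n0 by (rule ln_mono)
      also have "\<dots> = 2 * ln (real m)" using m0 by (simp add: ln_realpow)
      finally have 1: "ln (real n) / 2 \<le> ln (real m)" by simp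
      have "ln (ln (real n)) - ln 2 = ln (ln (real n) / 2)" using elim by (simp add: ln_div)
      also have "\<dots> \<le> ln (ln (real m))" using 1 by (rule ln_mono) (use elim in simp)
      finally have "ln (ln (ln (real n)) - ln 2) \<le> ln (ln (ln (real m)))"
        by (rule ln_mono) (use elim in simp)
      then have "ln (ln (ln (real n))) \<le> ln (ln (ln (real m))) + c" using elim by linarith
      then have "y * (ln (ln (ln (real n))) / ln (real b)) \<le> y * ((ln (ln (ln (real m))) + c) / ln (real b))"
        using b y by (intro mult_left_mono divide_right_mono) auto
      also have "\<dots> = y * (ln (ln (ln (real m))) / ln (real b)) + 1"
        using b y by (simp add: c_def field_simps)
      also have "\<dots> \<le> real (trunc_len b y (real m)) + 1"
        using trunc_len_bounds(1)[OF b y mee] by simp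
      finally show "trunc_len b y (real n) \<le> trunc_len b y (real m) + 2"
        using trunc_len_bounds(2)[OF b y nee] by linarith
    qed
  qed
qed

lemma card_small_squares: "real (card {m \<in> {1..n}. m * m < n}) \<le> sqrt (real n)"
proof -
  have "{m \<in> {1..n}. m * m < n} \<subseteq> {1..nat \<lfloor>sqrt (real n)\<rfloor>}"
  proof
    fix m assume "m \<in> {m \<in> {1..n}. m * m < n}"
    then have "m \<ge> 1" "real m * real m < real n" by (auto simp flip: of_nat_mult)
    then have "real m \<le> sqrt (real n)" by (intro real_le_rsqrt) (simp add: power2_eq_square)
    then show "m \<in> {1..nat \<lfloor>sqrt (real n)\<rfloor>}" using \<open>m \<ge> 1\<close> by (simp add: le_nat_floor)
  qed
  then have "card {m \<in> {1..n}. m * m < n} \<le> card {1..nat \<lfloor>sqrt (real n)\<rfloor>}"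
    by (intro card_mono) auto
  then have "card {m \<in> {1..n}. m * m < n} \<le> nat \<lfloor>sqrt (real n)\<rfloor>" by simp
  then have "real (card {m \<in> {1..n}. m * m < n}) \<le> real (nat \<lfloor>sqrt (real n)\<rfloor>)" by (rule of_nat_mono)
  also have "\<dots> \<le> sqrt (real n)" by (rule of_nat_floor) simp
  finally show ?thesis .
qed

section \<open>Digits of theta\<close>

locale theta_digits = prime_step f + digit_concat b f "\<lambda>n. trunc_len b y (real n)"
  for b :: nat and f :: "nat \<Rightarrow> nat" and y :: real +
  assumes y_pos: "y > 0"
begin

abbreviation len :: "nat \<Rightarrow> nat" where
  "len n \<equiv> trunc_len b y (real n)"

lemma len_mono: "m \<le> n \<Longrightarrow> len m \<le> len n"
  by (rule trunc_len_mono[OF base y_pos]) simp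

text \<open>At a prime the value of f is 1, so its block begins with 0 once it has two digits. This
  rules out an expansion ending in digits b - 1.\<close>

lemma infinitely_many_zero_digits: "\<exists>m\<ge>n. digit m = 0"
proof -
  have "eventually (\<lambda>n. len n \<ge> 2) sequentially"
    using trunc_len_at_top[OF base y_pos] by (simp add: filterlim_at_top)
  then obtain n0 where n0: "\<And>n. n \<ge> n0 \<Longrightarrow> len n \<ge> 2" unfolding eventually_sequentially by blast
  obtain p where p: "prime p" "p > max n n0" using bigger_prime by blast
  then obtain q where q: "p = Suc q" by (cases p) auto
  have "f p = 1" using f_prime_mult[OF p(1), of 1] f_1 p(1) by (auto dest: prime_gt_1_nat)
  moreover have len: "len p \<ge> 2" using n0 p by simp
  have "1 < b ^ (len p - 1)" using base len by (intro one_less_power) auto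
  then have "(1 div b ^ (len p - 1)) mod b = 0" by simp
  ultimately have "digit (start q + 0) = 0"
    using digit_block[of 0 q] len unfolding q by simp
  moreover have "start q \<ge> n" using start_ge[of q] p q by simp
  ultimately show ?thesis by auto
qed

lemma normal_theta_iff:
  "normal_in_base b (theta b (\<lambda>n. real (f n)) y) \<longleftrightarrow> (\<forall>a. a \<noteq> [] \<longrightarrow> set a \<subseteq> {..<b} \<longrightarrow>
    (\<lambda>N. real (occurrences digit a N) / real N) \<longlonglongrightarrow> 1 / real b ^ length a)"
proof (rule normal_in_base_digits_iff)
  fix n
  have "theta b (\<lambda>n. real (f n)) y = (\<Sum>j. real (digit j) / real b ^ Suc j)"
    unfolding theta_def digit_def blocks_def ..
  moreover have "\<exists>m\<ge>n. digit m < b - 1" for n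
  proof -
    obtain m where "m \<ge> n" "digit m = 0" using infinitely_many_zero_digits by blast
    then show ?thesis using base by (intro exI[of _ m]) simp
  qed
  ultimately show "base_digit b (theta b (\<lambda>n. real (f n)) y) (Suc n) = digit n"
    using base_digit_digit_series[OF base digit_less] by presburger
qed

lemma sum_len_deviation:
  assumes half: "\<forall>m. n \<le> m * m \<longrightarrow> len n \<le> len m + 2"
  shows "(\<Sum>m=1..n. real (len n) - real (len m)) \<le> 2 * real n + sqrt (real n) * real (len n)"
proof -
  have "(\<Sum>m=1..n. real (len n) - real (len m)) \<le> (\<Sum>m=1..n. 2 + (if m * m < n then real (len n) else 0))"
  proof (rule sum_mono)
    fix m
    show "real (len n) - real (len m) \<le> 2 + (if m * m < n then real (len n) else 0)"
    proof (cases "m * m < n")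
      case False
      then have "len n \<le> len m + 2" using half by simp
      then show ?thesis using False by simp
    qed simp
  qed
  also have "\<dots> = 2 * real n + real (card {m \<in> {1..n}. m * m < n}) * real (len n)"
    by (simp add: sum.distrib flip: sum.inter_filter)
  also have "\<dots> \<le> 2 * real n + sqrt (real n) * real (len n)"
    using card_small_squares[of n] by (simp add: mult_right_mono)
  finally show ?thesis .
qed

text \<open>Turns error bounds relative to \<open>n * len n\<close> into bounds relative to the
  position N.\<close>

lemma start_lower:
  assumes half: "\<forall>m. n \<le> m * m \<longrightarrow> len n \<le> len m + 2" and n: "n \<ge> 16" and len: "len n \<ge> 8"
  shows "real (start n) \<ge> real n * real (len n) / 4"
proof -
  have "sqrt (real n) * 4 \<le> sqrt (real n) * sqrt (real n)"
    using n by (intro mult_left_mono) (auto intro: real_le_rsqrt)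
  then have s: "sqrt (real n) \<le> real n / 4" by simp
  have "real n * real (len n) - real (start n) = (\<Sum>m=1..n. real (len n) - real (len m))"
    by (simp add: start_def sum_subtractf)
  also have "\<dots> \<le> 2 * real n + sqrt (real n) * real (len n)" by (rule sum_len_deviation[OF half])
  also have "\<dots> \<le> real (len n) / 4 * real n + real n / 4 * real (len n)"
    using s len by (intro add_mono mult_right_mono) auto
  finally show ?thesis by (simp add: field_simps)
qed

lemma normal_le_half:
  assumes y_half: "y \<le> 1 / 2"
  shows "normal_in_base b (theta b (\<lambda>n. real (f n)) y)"
  unfolding normal_theta_iff
proof (intro allI impI)
  fix a assume a: "a \<noteq> []" "set a \<subseteq> {..<b}"
  define k where "k = length a"
  define v where "v = digits_value b a"
  have v: "v < b ^ k" unfolding v_def k_def by (rule digits_value_less[OF a(2)])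
  show "(\<lambda>N. real (occurrences digit a N) / real N) \<longlonglongrightarrow> 1 / real b ^ length a"
    unfolding k_def[symmetric]
  proof (rule LIMSEQ_I)
    fix r :: real assume r: "r > 0"
    \<comment> \<open>The final error is 12 \<epsilon>: three contributions of \<epsilon>, times 4
      from \<open>start_lower\<close>.\<close>
    define \<epsilon> where "\<epsilon> = r / 16"
    have \<epsilon>: "\<epsilon> > 0" using r by (simp add: \<epsilon>_def)
    obtain J0 T x0 where dev: "\<And>x J. x \<ge> x0 \<Longrightarrow> J \<ge> J0 \<Longrightarrow> real b ^ (J + T) \<le> real b * sqrt (ln (ln (real x)))
      \<Longrightarrow> (\<Sum>n=1..x. \<bar>total_dev b k v J (f n)\<bar>) \<le> \<epsilon> * real x * real J"
      by (rule average_abs_total_dev[OF base v \<epsilon>]) (erule that)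
    \<comment> \<open>Cost per block that does not grow with its length: 2k for boundary windows, 2T
      for the omitted digits, 4 for unequal lengths, with room to spare.\<close>
    define c where "c = 2 * real k + 2 * real T + 6"
    have "eventually (\<lambda>n. len n \<ge> max 8 (max (J0 + T) (nat \<lceil>c / \<epsilon>\<rceil>))) sequentially"
      using trunc_len_at_top[OF base y_pos] unfolding filterlim_at_top by blast
    moreover have "eventually (\<lambda>n. 3 / real n + 2 / sqrt (real n) < \<epsilon>) sequentially"
    proof -
      have "(\<lambda>n. 3 / real n + 2 / sqrt (real n)) \<longlonglongrightarrow> 0" by real_asymp
      then show ?thesis using \<epsilon> by (rule order_tendstoD)
    qed
    ultimately have "eventually (\<lambda>n. n \<ge> 16 \<and> n \<ge> x0 \<and> len n \<ge> max 8 (max (J0 + T) (nat \<lceil>c / \<epsilon>\<rceil>))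
        \<and> 3 / real n + 2 / sqrt (real n) < \<epsilon>
        \<and> real b ^ len n \<le> real b * sqrt (ln (ln (real n)))
        \<and> (\<forall>m. n \<le> m * m \<longrightarrow> len n \<le> len m + 2)
        \<and> (\<forall>m. Suc n \<le> m * m \<longrightarrow> len (Suc n) \<le> len m + 2)) sequentially"
      using eventually_ge_at_top[of 16] eventually_ge_at_top[of x0]
        power_trunc_len_le[OF base y_pos y_half] trunc_len_sqrt[OF base y_pos]
        trunc_len_sqrt[OF base y_pos, THEN eventually_sequentially_Suc[THEN iffD2]]
      by eventually_elim simp
    then obtain n1 where n1: "\<And>n. n \<ge> n1 \<Longrightarrow> n \<ge> 16 \<and> n \<ge> x0 \<and> len n \<ge> max 8 (max (J0 + T) (nat \<lceil>c / \<epsilon>\<rceil>))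
        \<and> 3 / real n + 2 / sqrt (real n) < \<epsilon>
        \<and> real b ^ len n \<le> real b * sqrt (ln (ln (real n)))
        \<and> (\<forall>m. n \<le> m * m \<longrightarrow> len n \<le> len m + 2)
        \<and> (\<forall>m. Suc n \<le> m * m \<longrightarrow> len (Suc n) \<le> len m + 2)"
      unfolding eventually_sequentially by blast
    show "\<exists>N0. \<forall>N\<ge>N0. norm (real (occurrences digit a N) / real N - 1 / real b ^ k) < r"
    proof (rule exI[of _ "start n1"], intro allI impI)
      fix N assume N: "N \<ge> start n1"
      obtain n i where ni: "N = start n + i" "i < len (Suc n)" using position_in_block by blast
      have "n \<ge> n1"
      proof (rule ccontr)
        assume "\<not> n \<ge> n1"
        then have "Suc n \<le> n1" by simp
        then have "start (Suc n) \<le> start n1" unfolding start_def by (intro sum_mono2) auto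
        then show False using N ni by simp
      qed
      note n = n1[OF this]
      \<comment> \<open>Leaving out T top digits gives J + T = \<open>len n\<close>, which meets the
        size condition of \<open>dev\<close> although b ^ \<open>len n\<close> itself may be as
        large as the spread of f.\<close>
      define J where "J = len n - T"
      have J: "J \<ge> J0" "J + T = len n" "J \<le> len n" using n by (auto simp: J_def)
      have "\<bar>real (occurrences digit a N) - real N / real b ^ k\<bar> \<le> real (len (Suc n)) +
          (\<Sum>m=1..n. \<bar>total_dev b k v J (f m)\<bar> + 2 * real k + 2 * \<bar>real (len m) - real J\<bar>)"
        unfolding k_def v_def using ni by (intro occurrences_dev a) auto
      also have "\<dots> \<le> (real (len n) + 2) + (\<Sum>m=1..n. \<bar>total_dev b k v J (f m)\<bar> + 2 * real k +
          2 * (real T + (real (len n) - real (len m))))"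
      proof (intro add_mono sum_mono mult_left_mono)
        have "Suc n \<le> n * n" 
        proof -
          have "2 * n \<le> n * n" using n by (intro mult_right_mono) auto
          then show ?thesis using n by linarith
        qed
        then show "real (len (Suc n)) \<le> real (len n) + 2" using n by force
        fix m assume "m \<in> {1..n}"
        then have "len m \<le> len n" by (intro len_mono) simp
        then show "\<bar>real (len m) - real J\<bar> \<le> real T + (real (len n) - real (len m))"
          using J by linarith
      qed auto
      also have "\<dots> = (real (len n) + 2) + ((\<Sum>m=1..n. \<bar>total_dev b k v J (f m)\<bar>) + 2 * real k * real n
          + 2 * real T * real n + 2 * (\<Sum>m=1..n. real (len n) - real (len m)))"
      proof -
        have "l + (\<Sum>m=1..n. A m + c + 2 * (t + D m))
            = l + ((\<Sum>m=1..n. A m) + c * real n + 2 * t * real n + 2 * (\<Sum>m=1..n. D m))"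
          for A D :: "nat \<Rightarrow> real" and l c t :: real
          by (simp add: sum.distrib sum_distrib_left algebra_simps)
        then show ?thesis .
      qed
      also have "\<dots> \<le> (real (len n) + 2 * real (len n)) + (\<epsilon> * real n * real (len n) + 2 * real k * real n
          + 2 * real T * real n + 2 * (2 * real n + sqrt (real n) * real (len n)))"
      proof (intro add_mono mult_left_mono order_refl)
        show "2 \<le> 2 * real (len n)" using n by auto
        have "(\<Sum>m=1..n. \<bar>total_dev b k v J (f m)\<bar>) \<le> \<epsilon> * real n * real J"
          using n J by (intro dev) auto
        also have "\<dots> \<le> \<epsilon> * real n * real (len n)" using J \<epsilon> by (intro mult_left_mono) auto
        finally show "(\<Sum>m=1..n. \<bar>total_dev b k v J (f m)\<bar>) \<le> \<epsilon> * real n * real (len n)" .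
        show "(\<Sum>m=1..n. real (len n) - real (len m)) \<le> 2 * real n + sqrt (real n) * real (len n)"
          using n by (intro sum_len_deviation) auto
      qed simp_all
      also have "\<dots> \<le> real n * real (len n) * (3 / real n + 2 / sqrt (real n) + \<epsilon> + c / real (len n))"
      proof -
        have n0: "real n > 0" "sqrt (real n) > 0" "real (len n) > 0" using n by auto
        have "real n * real (len n) * (3 / real n + 2 / sqrt (real n) + \<epsilon> + c / real (len n))
           = 3 * real (len n) + 2 * (real n / sqrt (real n)) * real (len n) + \<epsilon> * real n * real (len n) + c * real n"
          using n0 by (simp add: distrib_left)
        also have "real n / sqrt (real n) = sqrt (real n)" by (rule real_div_sqrt) simp
        finally show ?thesis by (simp add: c_def algebra_simps)
      qed
      also have "\<dots> \<le> real n * real (len n) * (\<epsilon> + \<epsilon> + \<epsilon>)"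
      proof (intro mult_left_mono add_mono)
        have "c / \<epsilon> \<le> real (len n)" using n by linarith
        moreover have "real (len n) > 0" using n by auto
        ultimately show "c / real (len n) \<le> \<epsilon>" using \<epsilon> by (simp add: field_simps)
      qed (use n in auto)
      also have "\<dots> \<le> 4 * real N * (3 * \<epsilon>)"
      proof -
        have "real n * real (len n) / 4 \<le> real (start n)" using n by (intro start_lower) auto
        then have "real n * real (len n) \<le> 4 * real N" using ni by simp
        then have "real n * real (len n) * (3 * \<epsilon>) \<le> 4 * real N * (3 * \<epsilon>)"
          using \<epsilon> by (intro mult_right_mono) auto
        then show ?thesis by simp
      qed
      finally have le: "\<bar>real (occurrences digit a N) - real N / real b ^ k\<bar> \<le> 12 * \<epsilon> * real N" by (simp add: mult_ac)
      have N0: "real N > 0" using start_ge[of n] ni n by simp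
      have "norm (real (occurrences digit a N) / real N - 1 / real b ^ k)
          = \<bar>real (occurrences digit a N) - real N / real b ^ k\<bar> / real N"
      proof -
        have "real (occurrences digit a N) / real N - 1 / real b ^ k
            = (real (occurrences digit a N) - real N / real b ^ k) / real N"
          using N0 by (simp add: diff_divide_distrib)
        then show ?thesis by (simp only: real_norm_def abs_divide abs_of_nat)
      qed
      also have "\<dots> \<le> 12 * \<epsilon>" using le N0 by (simp add: pos_divide_le_eq)
      also have "\<dots> < r" using r by (simp add: \<epsilon>_def)
      finally show "norm (real (occurrences digit a N) / real N - 1 / real b ^ k) < r" .
    qed
  qed
qed

end

section \<open>Failure beyond one half\<close>

text \<open>Turan's inequality. The second moment contributes \<mu> x; rounding in
  \<open>x div p\<close> loses less than 1 for each of at most x primes, which costs 2 \<mu> x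
  through the first moment.\<close>

lemma sum_prime_div_count_variance_le:
  fixes x :: nat
  defines "\<mu> \<equiv> prime_recip_sum x"
  shows "(\<Sum>n=1..x. (prime_div_count (primes_upto x) n - \<mu>)\<^sup>2) \<le> 3 * \<mu> * real x"
proof -
  let ?P = "primes_upto x" and ?w = "prime_div_count (primes_upto x)"
  have P: "prime p" if "p \<in> ?P" for p using that by (simp add: primes_upto_def)
  then have P0: "p > 0" if "p \<in> ?P" for p using that prime_gt_0_nat by blast
  have \<mu>0: "\<mu> \<ge> 0" unfolding \<mu>_def prime_recip_sum_def by (intro sum_nonneg) auto
  have "(\<Sum>n=1..x. if d dvd n then 1 else 0) \<le> real x / real d" if "d > 0" for d
    using sum_multiples[OF that, of "\<lambda>_. 1" x] of_nat_div_le_of_nat[of x d, where 'a = real] by simp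
  from sum_prime_div_count_square_le[where \<phi> = "\<lambda>_. 1", OF finite_primes_upto P this]
  have second: "(\<Sum>n=1..x. (?w n)\<^sup>2) \<le> (\<mu>\<^sup>2 + \<mu>) * real x"
    by (simp add: \<mu>_def prime_recip_sum_def)
  have "(\<Sum>n=1..x. ?w n) = (\<Sum>n=1..x. 1 * ?w n)" by simp
  also have "\<dots> = (\<Sum>p\<in>?P. \<Sum>k=1..x div p. 1)" by (rule sum_prime_div_count[OF P0])
  also have "\<dots> = (\<Sum>p\<in>?P. real (x div p))" by simp
  also have "\<dots> \<ge> (\<Sum>p\<in>?P. real x / real p - 1)"
  proof (rule sum_mono)
    fix p assume p: "p \<in> ?P"
    have "x = p * (x div p) + x mod p" by simp
    then have "x \<le> p * (x div p) + p"
      using mod_less_divisor[OF P0[OF p], of x] by linarith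
    then have "real x \<le> real (p * (x div p) + p)" by (simp only: of_nat_le_iff)
    then show "real x / real p - 1 \<le> real (x div p)"
      using P0[OF p] by (simp add: divide_simps algebra_simps)
  qed
  also have "(\<Sum>p\<in>?P. real x / real p - 1) = real x * \<mu> - real (card ?P)"
    by (simp add: sum_subtractf \<mu>_def prime_recip_sum_def sum_distrib_left)
  finally have "(\<Sum>n=1..x. ?w n) \<ge> real x * \<mu> - real (card ?P)" .
  moreover have "card ?P \<le> card {1..x}"
    using P0 by (intro card_mono) (auto simp: primes_upto_def Suc_le_eq)
  ultimately have first: "(\<Sum>n=1..x. ?w n) \<ge> real x * \<mu> - real x" by simp
  have "(\<Sum>n=1..x. (?w n - \<mu>)\<^sup>2) = (\<Sum>n=1..x. (?w n)\<^sup>2) - 2 * \<mu> * (\<Sum>n=1..x. ?w n) + \<mu>\<^sup>2 * real x"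
  proof -
    have "(\<Sum>n=1..x. (?w n - \<mu>)\<^sup>2) = (\<Sum>n=1..x. (?w n)\<^sup>2 - 2 * \<mu> * ?w n + \<mu>\<^sup>2)"
      by (intro sum.cong) (auto simp: power2_eq_square algebra_simps)
    then show ?thesis by (simp add: sum.distrib sum_subtractf sum_distrib_left)
  qed
  also have "\<dots> \<le> (\<mu>\<^sup>2 + \<mu>) * real x - 2 * \<mu> * (real x * \<mu> - real x) + \<mu>\<^sup>2 * real x"
    using second first \<mu>0 by (intro add_mono diff_mono mult_left_mono) auto
  also have "\<dots> = 3 * \<mu> * real x" by (simp add: power2_eq_square algebra_simps)
  finally show ?thesis .
qed

text \<open>At most 3/4 of the integers have a square divisor above 1, and by Chebyshev's inequality
  at most 3/24 = 1/8 deviate by B or more, which leaves 1/8.\<close>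

lemma card_squarefree_concentrated:
  assumes B: "B > 0" "24 * prime_recip_sum x \<le> B\<^sup>2"
  shows "real (card {n \<in> {1..x}. squarefree n \<and> \<bar>prime_div_count (primes_upto x) n - prime_recip_sum x\<bar> < B})
           \<ge> real x / 8"
proof -
  let ?w = "prime_div_count (primes_upto x)" and ?\<mu> = "prime_recip_sum x"
  define A where "A = {n \<in> {1..x}. squarefree n \<and> \<bar>?w n - ?\<mu>\<bar> < B}"
  define A1 where "A1 = {n \<in> {1..x}. \<exists>d\<in>{2..x}. d\<^sup>2 dvd n}"
  define A2 where "A2 = {n \<in> {1..x}. \<bar>?w n - ?\<mu>\<bar> \<ge> B}"
  have "{1..x} \<subseteq> A \<union> A1 \<union> A2"
  proof
    fix n assume n: "n \<in> {1..x}"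
    show "n \<in> A \<union> A1 \<union> A2"
    proof (cases "squarefree n")
      case False
      then obtain d where d: "d\<^sup>2 dvd n" "\<not> is_unit d" by (rule not_squarefreeE)
      have "d \<noteq> 0" using d(1) n by (intro notI) simp
      with d(2) have d2: "d \<ge> 2" by simp
      have "d \<le> d\<^sup>2" using d2 by (simp add: power2_eq_square)
      also have "d\<^sup>2 \<le> x" using d(1) n by (auto dest: dvd_imp_le)
      finally show ?thesis using n d(1) d2 by (auto simp: A1_def)
    qed (use n in \<open>auto simp: A_def A2_def\<close>)
  qed
  then have "card {1..x} \<le> card (A \<union> A1 \<union> A2)"
    by (intro card_mono) (auto simp: A_def A1_def A2_def)
  also have "\<dots> \<le> card A + card A1 + card A2"
    by (intro order_trans[OF card_Un_le] add_right_mono card_Un_le)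
  finally have "real x \<le> real (card A) + real (card A1) + real (card A2)" by simp
  moreover have "real (card A1) \<le> real x * (3 / 4)"
  proof -
    have "real (card A1) \<le> real x * (\<Sum>d\<in>{2..x}. 1 / (real d)\<^sup>2)"
      unfolding A1_def by (rule card_square_multiples_le) auto
    also have "\<dots> \<le> real x * (3 / 4)"
      by (intro mult_left_mono sum_recip_squares_le) auto
    finally show ?thesis .
  qed
  moreover have "real (card A2) \<le> real x / 8"
  proof -
    have "real (card A2) * B\<^sup>2 = (\<Sum>n\<in>A2. B\<^sup>2)" by simp
    also have "\<dots> \<le> (\<Sum>n\<in>A2. (?w n - ?\<mu>)\<^sup>2)"
    proof (rule sum_mono)
      fix n assume "n \<in> A2"
      then have "B \<le> \<bar>?w n - ?\<mu>\<bar>" by (simp add: A2_def)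
      then have "B\<^sup>2 \<le> \<bar>?w n - ?\<mu>\<bar>\<^sup>2" using B(1) by (intro power_mono) auto
      then show "B\<^sup>2 \<le> (?w n - ?\<mu>)\<^sup>2" by simp
    qed
    also have "\<dots> \<le> (\<Sum>n=1..x. (?w n - ?\<mu>)\<^sup>2)" by (intro sum_mono2) (auto simp: A2_def)
    also have "\<dots> \<le> 3 * ?\<mu> * real x" by (rule sum_prime_div_count_variance_le)
    also have "\<dots> \<le> B\<^sup>2 / 8 * real x" using B by (intro mult_right_mono) auto
    finally have "real (card A2) * B\<^sup>2 \<le> (real x / 8) * B\<^sup>2" by (simp add: mult.commute)
    then show ?thesis using B(1) by (subst (asm) mult_le_cancel_right) auto
  qed
  ultimately show ?thesis unfolding A_def by linarith
qed

text \<open>Stripping off primes one at a time meets only the case covered by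
  \<open>f_prime_mult\<close>; this is why the failure argument is confined to squarefree
  integers.\<close>

lemma (in prime_step) f_squarefree:
  assumes "squarefree n"
  shows "f n = card (prime_factors n)"
  using assms
proof (induction n rule: less_induct)
  case (less n)
  show ?case
  proof (cases "n = 1")
    case False
    then obtain p where p: "prime p" "p dvd n" using prime_factor_nat by blast
    then obtain m where m: "n = p * m" by blast
    have n0: "n \<noteq> 0" using less.prems by (intro notI) simp
    then have m0: "m > 0" using m by simp
    have npm: "\<not> p dvd m"
    proof
      assume "p dvd m"
      then have "p\<^sup>2 dvd n" unfolding m power2_eq_square by (intro mult_dvd_mono) auto
      then have "is_unit p" by (rule squarefreeD[OF less.prems])
      then show False using p(1) by simp
    qed
    have "m < n" using prime_gt_1_nat[OF p(1)] m0 by (simp add: m)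
    moreover have "squarefree m" using less.prems m by (metis dvd_triv_right squarefree_mono)
    ultimately have "f m = card (prime_factors m)" by (rule less.IH)
    moreover have "prime_factors n = insert p (prime_factors m)"
      using m m0 p(1) by (simp add: prime_factorization_mult prime_factorization_prime)
    moreover have "p \<notin> prime_factors m" using npm by auto
    ultimately show ?thesis using f_prime_mult[OF p(1) m0 npm] by (simp add: m)
  qed (use f_1 in simp)
qed

lemma prime_div_count_primes_upto:
  assumes "n \<in> {1..x}"
  shows "prime_div_count (primes_upto x) n = real (card (prime_factors n))"
proof -
  have "prime_factors n = {p \<in> primes_upto x. p dvd n}"
    using assms by (auto simp: primes_upto_def prime_factors_dvd dest: dvd_imp_le)
  then show ?thesis unfolding prime_div_count_def by (simp flip: sum.inter_filter)
qed

text \<open>The sum is unbounded and grows by at most 1 at each step, so the first x at which it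
  reaches c does not overshoot by 1.\<close>

lemma prime_recip_sum_hits:
  assumes "c \<ge> 1"
  obtains x where "c \<le> prime_recip_sum x" "prime_recip_sum x < c + 1"
proof -
  have "filterlim (\<lambda>x::real. ln (ln x) / 2) at_top at_top" by real_asymp
  from filterlim_compose[OF this filterlim_real_sequentially]
  have "eventually (\<lambda>n. c \<le> ln (ln (real n)) / 2) sequentially"
    by (simp add: filterlim_at_top)
  then have "eventually (\<lambda>n. c \<le> prime_recip_sum n) sequentially"
    using eventually_ge_at_top[of 2]
  proof eventually_elim
    case (elim n)
    then show ?case using prime_recip_sum_ge[of n] by linarith
  qed
  then have ex: "\<exists>n. c \<le> prime_recip_sum n" unfolding eventually_sequentially by blast
  define x where "x = (LEAST n. c \<le> prime_recip_sum n)"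
  have 1: "c \<le> prime_recip_sum x" unfolding x_def using ex by (rule LeastI_ex)
  have "prime_recip_sum 0 = 0" by (simp add: prime_recip_sum_def primes_upto_less_2)
  then obtain x' where x': "x = Suc x'" using 1 assms by (cases x) auto
  then have "x' < (LEAST n. c \<le> prime_recip_sum n)" by (simp add: x_def)
  then have 2: "prime_recip_sum x' < c" using not_less_Least by force
  have "primes_upto (Suc x') \<subseteq> insert (Suc x') (primes_upto x')" by (auto simp: primes_upto_def)
  then have "prime_recip_sum (Suc x') \<le> (\<Sum>p\<in>insert (Suc x') (primes_upto x'). 1 / real p)"
    unfolding prime_recip_sum_def by (intro sum_mono2) auto
  also have "\<dots> \<le> 1 / real (Suc x') + prime_recip_sum x'"
    by (simp add: prime_recip_sum_def sum.insert_if)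
  also have "\<dots> < 1 + c" using 2 by (intro add_le_less_mono) auto
  finally show thesis using 1 x' by (intro that[of x]) auto
qed

lemma prime_recip_sum_le_self: "prime_recip_sum x \<le> real x"
proof -
  have "prime_recip_sum x \<le> (\<Sum>p\<in>primes_upto x. 1)"
    unfolding prime_recip_sum_def by (intro sum_mono) (auto simp: divide_simps primes_upto_def dest: prime_gt_0_nat)
  also have "\<dots> = real (card (primes_upto x))" by simp
  also have "card (primes_upto x) \<le> card {1..x}"
    by (intro card_mono) (auto simp: primes_upto_def Suc_le_eq dest: prime_gt_0_nat)
  finally show ?thesis by simp
qed

lemma prime_recip_sum_le_13_lnln:
  "eventually (\<lambda>x. prime_recip_sum x \<le> 13 * ln (ln (real x))) sequentially"
proof -
  have "eventually (\<lambda>x::real. 13 + 12 * ln (ln x / ln 2 + 1) \<le> 13 * ln (ln x)) at_top" by real_asymp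
  from filterlim_real_sequentially[unfolded filterlim_iff, rule_format, OF this] eventually_ge_at_top[of 2]
  show ?thesis
  proof eventually_elim
    case (elim n)
    then show ?case using prime_recip_sum_le[of n] by linarith
  qed
qed

section \<open>Long runs of zeros\<close>

context theta_digits
begin

text \<open>The length is expressed through the actual mean. This lies between 1/2 and 13 times log
  log x, so only a bounded number of digits is lost.\<close>

lemma len_estimates:
  "eventually (\<lambda>x. y * (ln (prime_recip_sum x) - ln 13) / ln (real b) \<le> real (len x) \<and>
     real (len x) \<le> y * (ln (prime_recip_sum x) + ln 2) / ln (real b) + 1) sequentially"
proof -
  have "eventually (\<lambda>x::real. x > exp (exp 1) \<and> ln (ln x) > 0 \<and> x \<ge> 2) at_top"
    by (intro eventually_conj; real_asymp)
  from filterlim_real_sequentially[unfolded filterlim_iff, rule_format, OF this] prime_recip_sum_le_13_lnln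
  show ?thesis
  proof eventually_elim
    case (elim x)
    let ?\<mu> = "prime_recip_sum x" and ?l = "ln (ln (real x))"
    have x: "real x > exp (exp 1)" "x \<ge> 2" using elim by auto
    have lo: "?l \<le> 2 * ?\<mu>" using prime_recip_sum_ge[OF x(2)] by simp
    have l0: "?l > 0" using elim by simp
    then have \<mu>0: "?\<mu> > 0" using lo by linarith
    have lnb: "ln (real b) > 0" using base by simp
    have "ln (?\<mu> / 13) \<le> ln ?l" by (rule ln_mono) (use elim \<mu>0 in auto)
    then have "ln ?\<mu> - ln 13 \<le> ln ?l" using \<mu>0 by (simp add: ln_div)
    then have "y * (ln ?\<mu> - ln 13) / ln (real b) \<le> y * (ln ?l / ln (real b))"
      using y_pos lnb by (simp add: divide_right_mono)
    moreover have "ln ?l \<le> ln (2 * ?\<mu>)" using lo l0 by (rule ln_mono)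
    then have "ln ?l \<le> ln ?\<mu> + ln 2" using \<mu>0 by (simp add: ln_mult)
    then have "y * (ln ?l / ln (real b)) \<le> y * (ln ?\<mu> + ln 2) / ln (real b)"
      using y_pos lnb by (simp add: divide_right_mono)
    ultimately show ?case using trunc_len_bounds[OF base y_pos x(1)] by linarith
  qed
qed

lemma zero_block:
  assumes "j + k \<le> M" "e < b ^ j"
  shows "((b ^ M + e) div b ^ j) mod b ^ k = 0"
proof -
  obtain c where M: "M = j + (k + c)" using assms(1) by (metis le_iff_add add.assoc)
  have "(b ^ M + e) div b ^ j = b ^ (k + c)"
    using base assms(2) by (simp add: M power_add[of b j])
  then show ?thesis by (simp add: power_add)
qed

text \<open>
  The parameters are such that \<open>\<bar>f n - \<mu>\<bar> < b ^ r\<close> with \<open>\<mu>\<close> in \<open>[b ^ M + b ^ r, b ^ M + b ^ r + 1)\<close> and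
  \<open>r\<close> about \<open>M/2\<close>; the base \<open>b\<close> expansion of \<open>f n\<close> then has zeros at the positions from \<open>r + 2\<close> to \<open>M - 1\<close>.
\<close>

lemma many_zero_blocks:
  assumes y_half: "y > 1 / 2" and k: "k \<ge> 1"
  defines "\<kappa> \<equiv> min 1 y - 1 / 2"
  shows "\<exists>M0. \<forall>M\<ge>M0. \<exists>x\<ge>M. x > 0 \<and>
    real (occurrences digit (replicate k 0) (start x)) \<ge> \<kappa> / (32 * y) * real (start x)"
proof -
  define lb where "lb = ln (real b)"
  have lb: "lb > 0" using base by (simp add: lb_def)
  \<comment> \<open>About \<kappa> M zeros are visible: they fill the positions from M/2 to M, and a
    block of about y M digits shows those below min 1 y times M.\<close>
  have \<kappa>: "\<kappa> > 0" using y_half by (simp add: \<kappa>_def min_def)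
  \<comment> \<open>\<open>len x\<close> will lie between y M - c1 and y M + c2: the 13 and 2 come
    from \<open>len_estimates\<close>, the 3 from \<mu> \<le> 3 b ^ M, the 1 from rounding
    up.\<close>
  define c1 where "c1 = y * ln 13 / lb"
  define c2 where "c2 = y * (ln 3 + ln 2) / lb + 1"
  have c0: "c1 \<ge> 0" "c2 \<ge> 1" using y_pos lb by (simp_all add: c1_def c2_def)
  have "eventually (\<lambda>x. x \<ge> 256 \<and> (\<forall>m. x \<le> m * m \<longrightarrow> len x \<le> len m + 2) \<and>
     y * (ln (prime_recip_sum x) - ln 13) / ln (real b) \<le> real (len x) \<and>
     real (len x) \<le> y * (ln (prime_recip_sum x) + ln 2) / ln (real b) + 1) sequentially"
    using eventually_ge_at_top[of 256] trunc_len_sqrt[OF base y_pos] len_estimates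
    by eventually_elim simp
  then obtain M1 where M1: "\<And>x. x \<ge> M1 \<Longrightarrow> x \<ge> 256 \<and> (\<forall>m. x \<le> m * m \<longrightarrow> len x \<le> len m + 2) \<and>
     y * (ln (prime_recip_sum x) - ln 13) / ln (real b) \<le> real (len x) \<and>
     real (len x) \<le> y * (ln (prime_recip_sum x) + ln 2) / ln (real b) + 1"
    unfolding eventually_sequentially by blast
  define c3 where "c3 = c1 + 8 + real k"
  \<comment> \<open>This bound is the inequality \<open>key\<close> below, solved for M.\<close>
  obtain M2 where M2: "real M2 \<ge> (2 * y * c3 + \<kappa> * c2) / (\<kappa> * y)" using real_arch_simple by blast
  show ?thesis
  proof (rule exI[of _ "max 8 (max M1 M2)"], intro allI impI)
    fix M assume M: "M \<ge> max 8 (max M1 M2)"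
    \<comment> \<open>The 4 yields 2r \<ge> M + 7, so b ^ (2r) is at least 2^7 b ^ M and exceeds 24
      \<mu>, as the concentration lemma demands.\<close>
    define r where "r = M div 2 + 4"
    have "M \<ge> 8" using M by simp
    then have r: "2 * r \<ge> M + 7" "r \<le> M" unfolding r_def by presburger+
    have r': "real r \<le> real M / 2 + 4"
      using of_nat_div_le_of_nat[of M 2, where 'a = real] by (simp add: r_def)
    \<comment> \<open>The offset b ^ r keeps \<open>f n\<close> above b ^ M in spite of its
      deviation; just below b ^ M the digits would be b - 1 instead of 0.\<close>
    define c where "c = real (b ^ M + b ^ r)"
    have "c \<ge> 1" using base by (simp add: c_def add_increasing2)
    then obtain x where x: "c \<le> prime_recip_sum x" "prime_recip_sum x < c + 1"
      by (rule prime_recip_sum_hits)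
    let ?\<mu> = "prime_recip_sum x"
    have bM1: "real b ^ M \<ge> 1" using base by simp
    have br: "real b ^ r \<le> real b ^ M" using base r by (intro power_increasing) auto
    have \<mu>: "real b ^ M \<le> ?\<mu>" "?\<mu> \<le> 3 * real b ^ M"
      using x br bM1 zero_le_power[of "real b" r] unfolding c_def of_nat_add of_nat_power by linarith+
    have "real M \<le> real b ^ M"
    proof -
      have "M < b ^ M" using base by (intro power_gt_expt) auto
      then show ?thesis by (metis less_imp_le of_nat_le_iff of_nat_power)
    qed
    also have "\<dots> \<le> real x" using \<mu>(1) prime_recip_sum_le_self[of x] by linarith
    finally have xM: "x \<ge> M" by simp
    have x256: "x \<ge> 256" and half: "\<forall>m. x \<le> m * m \<longrightarrow> len x \<le> len m + 2"
      and len_lo: "y * (ln ?\<mu> - ln 13) / lb \<le> real (len x)"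
      and len_hi: "real (len x) \<le> y * (ln ?\<mu> + ln 2) / lb + 1"
      using M1[of x] xM M unfolding lb_def by auto
    have "real M * lb = ln (real b ^ M)" using base by (simp add: lb_def ln_realpow)
    also have "\<dots> \<le> ln ?\<mu>" using \<mu>(1) by (rule ln_mono) (use bM1 in linarith)
    finally have "y * (real M * lb - ln 13) / lb \<le> y * (ln ?\<mu> - ln 13) / lb"
      using y_pos lb by (intro divide_right_mono mult_left_mono) auto
    moreover have "y * (real M * lb - ln 13) / lb = y * real M - c1"
      using lb by (simp add: c1_def field_simps)
    ultimately have lo: "y * real M - c1 \<le> real (len x)" using len_lo by linarith
    have "ln ?\<mu> \<le> ln (3 * real b ^ M)" using \<mu>(2) by (rule ln_mono) (use \<mu>(1) bM1 in linarith)
    also have "\<dots> = ln 3 + real M * lb" using base by (simp add: lb_def ln_mult ln_realpow)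
    finally have "y * (ln ?\<mu> + ln 2) / lb \<le> y * ((ln 3 + real M * lb) + ln 2) / lb"
      using y_pos lb by (intro divide_right_mono mult_left_mono) auto
    moreover have "y * ((ln 3 + real M * lb) + ln 2) / lb + 1 = y * real M + c2"
      using lb by (simp add: c2_def field_simps)
    ultimately have hi: "real (len x) \<le> y * real M + c2" using len_hi by linarith

    define A where "A = {n \<in> {1..x}. squarefree n \<and> \<bar>prime_div_count (primes_upto x) n - ?\<mu>\<bar> < real b ^ r}"
    have cardA: "real (card A) \<ge> real x / 8"
      unfolding A_def
    proof (rule card_squarefree_concentrated)
      have "24 * ?\<mu> \<le> 72 * real b ^ M" using \<mu>(2) by simp
      also have "\<dots> \<le> 2 ^ 7 * real b ^ M" by simp
      also have "\<dots> \<le> real b ^ 7 * real b ^ M" using base by (intro mult_right_mono power_mono) auto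
      also have "\<dots> = real b ^ (7 + M)" by (simp add: power_add)
      also have "\<dots> \<le> real b ^ (2 * r)" using base r by (intro power_increasing) auto
      finally show "24 * ?\<mu> \<le> (real b ^ r)\<^sup>2" by (simp add: power_mult mult.commute[of 2])
    qed (use base in auto)
    \<comment> \<open>For these n the block is at most two digits shorter than \<open>len x\<close>.
      The discarded n number at most sqrt x, which is at most x/16 as x \<ge> 256.\<close>
    define A' where "A' = {n \<in> A. x \<le> n * n}"
    have cardA': "real (card A') \<ge> real x / 16"
    proof -
      have "A \<subseteq> A' \<union> {n \<in> {1..x}. n * n < x}" by (auto simp: A'_def A_def)
      then have "card A \<le> card (A' \<union> {n \<in> {1..x}. n * n < x})"
        by (intro card_mono) (auto simp: A'_def A_def)
      also have "\<dots> \<le> card A' + card {n \<in> {1..x}. n * n < x}" by (rule card_Un_le)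
      finally have "real (card A) \<le> real (card A') + real (card {n \<in> {1..x}. n * n < x})" by simp
      moreover have "sqrt (real x) * 16 \<le> sqrt (real x) * sqrt (real x)"
        using x256 by (intro mult_left_mono) (auto intro: real_le_rsqrt)
      then have "sqrt (real x) \<le> real x / 16" by simp
      ultimately show ?thesis using cardA card_small_squares[of x] by linarith
    qed

    \<comment> \<open>Number of starting positions for k zeros from r + 2 up to the visible end of
      the run: the run stops at M, and each block from A' shows at least \<open>len x - 2\<close>
      digits.\<close>
    define L where "L = min M (len x - 2) + 1 - k - (r + 2)"
    have block: "L \<le> block_occurrences (replicate k 0) (n - 1)" if n: "n \<in> A'" for n
    proof -
      have nA: "n \<in> {1..x}" "squarefree n" "\<bar>prime_div_count (primes_upto x) n - ?\<mu>\<bar> < real b ^ r" "x \<le> n * n"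
        using n by (auto simp: A'_def A_def)
      have n1: "Suc (n - 1) = n" using nA by simp
      have w: "prime_div_count (primes_upto x) n = real (f n)"
        using prime_div_count_primes_upto[OF nA(1)] f_squarefree[OF nA(2)] by simp
      have fn: "real (b ^ M) < real (f n)" "real (f n) < real (b ^ M + 2 * b ^ r + 1)"
        using nA(3) x unfolding w c_def of_nat_add of_nat_mult of_nat_power of_nat_numeral of_nat_1
        by linarith+
      then have "b ^ M < f n" "f n < b ^ M + 2 * b ^ r + 1" by (simp_all only: of_nat_less_iff)
      then have e: "f n = b ^ M + (f n - b ^ M)" "f n - b ^ M \<le> 2 * b ^ r" by linarith+
      define e where "e = f n - b ^ M"
      note e = e[folded e_def]
      \<comment> \<open>The excess is at most 2 b ^ r, hence below 4 b ^ r; this fixes r + 2 as the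
        start of the zeros.\<close>
      have er: "e < b ^ (r + 2)"
      proof -
        have "2 * 2 \<le> b * b" using base by (intro mult_mono) auto
        then have "4 * b ^ r \<le> b ^ (r + 2)" by (simp add: power_add power2_eq_square mult_right_mono)
        moreover have "b ^ r > 0" using base by simp
        ultimately show ?thesis using e(2) by linarith
      qed
      have zero: "digits_value b (replicate k 0) = 0"
        unfolding digits_value_def by (induction k) auto
      have "len x - 2 \<le> len n" using half nA(4) by force
      have "{r + 2..<min M (len x - 2) + 1 - k} \<subseteq> matches (replicate k 0) (f n) \<inter> {..<len n + 1 - k}"
      proof
        fix j assume j: "j \<in> {r + 2..<min M (len x - 2) + 1 - k}"
        have "j + k \<le> M" using j by auto
        moreover have "b ^ (r + 2) \<le> b ^ j" using j base by (intro power_increasing) auto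
        then have "e < b ^ j" using er by linarith
        ultimately have "(f n div b ^ j) mod b ^ k = 0" unfolding e(1) by (rule zero_block)
        moreover have "j < len n + 1 - k" using j \<open>len x - 2 \<le> len n\<close> by auto
        ultimately show "j \<in> matches (replicate k 0) (f n) \<inter> {..<len n + 1 - k}"
          by (simp add: matches_def zero)
      qed
      then have "card {r + 2..<min M (len x - 2) + 1 - k} \<le> card (matches (replicate k 0) (f n) \<inter> {..<len n + 1 - k})"
        by (intro card_mono) auto
      also have "\<dots> \<le> block_occurrences (replicate k 0) (n - 1)"
        using block_occurrences_window(1)[of "replicate k 0" "n - 1"] k base unfolding n1 by auto
      finally show ?thesis by (simp add: L_def)
    qed
    have "card A' * L \<le> (\<Sum>n\<in>A'. block_occurrences (replicate k 0) (n - 1))"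
      using sum_mono[of A' "\<lambda>_. L", OF block] by simp
    also have "\<dots> = (\<Sum>m\<in>(\<lambda>n. n - 1) ` A'. block_occurrences (replicate k 0) m)"
      by (subst sum.reindex) (auto simp: inj_on_def A'_def A_def)
    also have "\<dots> \<le> (\<Sum>m<x. block_occurrences (replicate k 0) m)"
      by (intro sum_mono2) (auto simp: A'_def A_def)
    also have "\<dots> = occurrences digit (replicate k 0) (start x)" by (rule occurrences_start[symmetric])
    finally have occ: "real (card A') * real L \<le> real (occurrences digit (replicate k 0) (start x))"
      by (metis of_nat_le_iff of_nat_mult)

    have L: "\<kappa> * real M - c3 \<le> real L"
    proof -
      have "real L \<ge> min (real M) (real (len x) - 2) + 1 - real k - (real r + 2)"
      proof -
        have "min M (len x - 2) + 1 \<le> L + k + (r + 2)" unfolding L_def by linarith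
        then have "real (min M (len x - 2)) + 1 \<le> real L + real k + (real r + 2)" by linarith
        moreover have "min (real M) (real (len x) - 2) \<le> real (min M (len x - 2))"
          by (cases "M \<le> len x - 2") (auto simp: min_def)
        ultimately show ?thesis by linarith
      qed
      moreover have "min 1 y * real M - c1 \<le> min (real M) (real (len x) - 2) + 2"
      proof -
        have "min 1 y * real M \<le> 1 * real M" "min 1 y * real M \<le> y * real M"
          by (intro mult_right_mono; simp)+
        then show ?thesis using lo c0 by (simp add: min_def)
      qed
      ultimately show ?thesis using r' unfolding \<kappa>_def c3_def by (simp add: left_diff_distrib)
    qed
    have start: "real (start x) \<le> real x * (y * real M + c2)"
    proof -
      have "start x \<le> (\<Sum>m=1..x. len x)" unfolding start_def by (intro sum_mono len_mono) auto
      then have "start x \<le> x * len x" by simp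
      then have "real (start x) \<le> real x * real (len x)" by (metis of_nat_le_iff of_nat_mult)
      also have "\<dots> \<le> real x * (y * real M + c2)" using hi by (intro mult_left_mono) auto
      finally show ?thesis .
    qed
    \<comment> \<open>Half of \<kappa> is given up to absorb the constants; with the proportion 1/16
      of A' this gives the 32.\<close>
    have key: "\<kappa> / (2 * y) * (y * real M + c2) \<le> \<kappa> * real M - c3"
    proof -
      have "(2 * y * c3 + \<kappa> * c2) / (\<kappa> * y) \<le> real M" using M2 M by linarith
      then have "2 * y * c3 + \<kappa> * c2 \<le> real M * (\<kappa> * y)" using \<kappa> y_pos by (simp add: pos_divide_le_eq)
      then show ?thesis using y_pos by (simp add: field_simps)
    qed
    have "\<kappa> / (32 * y) * real (start x) \<le> \<kappa> / (32 * y) * (real x * (y * real M + c2))"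
      using start \<kappa> y_pos by (intro mult_left_mono) auto
    also have "\<dots> = real x / 16 * (\<kappa> / (2 * y) * (y * real M + c2))" by simp
    also have "\<dots> \<le> real x / 16 * real L" using key L by (intro mult_left_mono) auto
    also have "\<dots> \<le> real (card A') * real L" using cardA' by (intro mult_right_mono) auto
    also have "\<dots> \<le> real (occurrences digit (replicate k 0) (start x))" by (rule occ)
    finally show "\<exists>x\<ge>M. x > 0 \<and> real (occurrences digit (replicate k 0) (start x)) \<ge> \<kappa> / (32 * y) * real (start x)"
      using xM x256 by (intro exI[of _ x]) auto
  qed
qed

text \<open>The frequency c of zero runs does not depend on their length k, whereas normality would
  force b ^ -k, which is below c for large k.\<close>

lemma not_normal_gt_half:
  assumes y_half: "y > 1 / 2"
  shows "\<not> normal_in_base b (theta b (\<lambda>n. real (f n)) y)"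
proof
  assume normal: "normal_in_base b (theta b (\<lambda>n. real (f n)) y)"
  define c where "c = (min 1 y - 1 / 2) / (32 * y)"
  have c: "c > 0" using y_half by (simp add: c_def min_def)
  obtain k0 where k0: "1 / c < real b ^ k0" using real_arch_pow[of "real b" "1 / c"] base by auto
  define k where "k = Suc k0"
  have "real b ^ k0 \<le> real b ^ k" unfolding k_def using base by (intro power_increasing) auto
  then have "1 / c < real b ^ k" using k0 by linarith
  then have small: "1 / real b ^ k < c" using c base by (simp add: field_simps)
  define a :: "nat list" where "a = replicate k 0"
  have a: "a \<noteq> []" "set a \<subseteq> {..<b}" "length a = k" using base by (auto simp: a_def k_def)
  have "(\<lambda>N. real (occurrences digit a N) / real N) \<longlonglongrightarrow> 1 / real b ^ k"
    using normal[unfolded normal_theta_iff, rule_format, OF a(1,2)] unfolding a(3) .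
  then have "eventually (\<lambda>N. real (occurrences digit a N) / real N < c) sequentially"
    using small by (rule order_tendstoD)
  then obtain N0 where N0: "\<And>N. N \<ge> N0 \<Longrightarrow> real (occurrences digit a N) / real N < c"
    unfolding eventually_sequentially by blast
  obtain M0 where M0: "\<forall>M\<ge>M0. \<exists>x\<ge>M. x > 0 \<and> real (occurrences digit a (start x)) \<ge> c * real (start x)"
    using many_zero_blocks[OF y_half, of k] unfolding a_def c_def k_def by auto
  obtain x where x: "x \<ge> max M0 N0" "x > 0" "real (occurrences digit a (start x)) \<ge> c * real (start x)"
    using M0 by (meson max.cobounded1)
  have "start x \<ge> N0" "real (start x) > 0" using start_ge[of x] x by auto
  then have "real (occurrences digit a (start x)) < c * real (start x)"
    using N0[of "start x"] by (simp add: pos_divide_less_eq)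
  with x(3) show False by simp
qed

end

section \<open>The two prime-counting functions as instances\<close>

definition big_omega_nat :: "nat \<Rightarrow> nat" where
  "big_omega_nat n = size (prime_factorization n)"

definition small_omega_nat :: "nat \<Rightarrow> nat" where
  "small_omega_nat n = card (prime_factors n)"

lemma prime_step_big_omega: "prime_step big_omega_nat"
  by unfold_locales
    (auto simp: big_omega_nat_def prime_factorization_mult prime_factorization_prime prime_gt_0_nat)

lemma prime_step_small_omega: "prime_step small_omega_nat"
proof unfold_locales
  fix p m :: nat
  assume "prime p" "m > 0" "\<not> p dvd m"
  moreover from this have "p \<notin> prime_factors m" by auto
  ultimately show "small_omega_nat (p * m) = Suc (small_omega_nat m)"
    by (simp add: small_omega_nat_def prime_factorization_mult prime_factorization_prime prime_gt_0_nat)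
qed (simp add: small_omega_nat_def)

lemma theta_digits_intro:
  assumes "prime_step f" "b \<ge> 2" "y > 0"
  shows "theta_digits b f y"
proof -
  interpret prime_step f by (rule assms)
  show ?thesis by unfold_locales (use assms trunc_len_pos in auto)
qed

theorem theorem1p1:
  fixes b :: nat
  assumes "b \<ge> 2"
  shows "(\<forall>y :: real. 0 < y \<and> y \<le> 1 / 2 \<longrightarrow>
            normal_in_base b (theta b big_omega y) \<and> normal_in_base b (theta b small_omega y))
       \<and> (\<forall>y :: real. y > 1 / 2 \<longrightarrow>
            \<not> normal_in_base b (theta b big_omega y) \<and> \<not> normal_in_base b (theta b small_omega y))"
proof -
  have *: "(y \<le> 1 / 2 \<longrightarrow> normal_in_base b (theta b (\<lambda>n. real (f n)) y)) \<and>
      (y > 1 / 2 \<longrightarrow> \<not> normal_in_base b (theta b (\<lambda>n. real (f n)) y))"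
    if "prime_step f" "y > 0" for f y
  proof -
    interpret theta_digits b f y using that assms by (intro theta_digits_intro)
    show ?thesis using normal_le_half not_normal_gt_half by blast
  qed
  have "big_omega = (\<lambda>n. real (big_omega_nat n))" "small_omega = (\<lambda>n. real (small_omega_nat n))"
    by (auto simp: big_omega_def small_omega_def big_omega_nat_def small_omega_nat_def)
  then show ?thesis
    using *[OF prime_step_big_omega] *[OF prime_step_small_omega] by force
qed

end
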